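(* Let $N\in\mathbb{N}$, $\alpha\in(0,2)$. Let $D_0,D_1\subset\mathbb{R}^N$ be bounded open starshaped sets such that $0\in D_1$, $\overline{D}_1\subset D_0$, and $D_0\setminus\overline{D}_1$ satisfies a uniform exterior cone condition. Then there exists a unique solution $u$ of $$(P)\qquad (-\Delta)^{\alpha/2}u=0\ \text{ in } D_0\setminus\overline{D}_1,\qquad u=0\ \text{ in }\mathbb{R}^N\setminus D_0,\qquad u=1\ \text{ in }\overline{D}_1 .$$ It satisfies $0<u<1$ on $D_0\setminus\overline{D}_1$, and all superlevel sets $U(\ell)=\{x\in\mathbb{R}^N:u(x)\ge\ell\}$, $\ell\in(0,1)$, are starshaped. If moreover $D_0$ and $D_1$ are strictly starshaped, then all $U(\ell)$, $\ell\in(0,1)$, are strictly starshaped.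
   Context: Let $\mathcal{L}^1_\alpha$ be the space of Borel functions $u:\mathbb{R}^N\to\mathbb{R}\cup\{\infty\}$ with $\int_{\mathbb{R}^N}\frac{|u(x)|}{(1+|x|)^{N+\alpha}}\,dx<\infty$. For $u\in\mathcal{L}^1_\alpha$ and $x\in\mathbb{R}^N$, the fractional Laplacian is $$(-\Delta)^{\alpha/2}u(x)=c_{N,\alpha}\lim_{\varepsilon\downarrow0}\int_{|x-y|>\varepsilon}\frac{u(x)-u(y)}{|x-y|^{N+\alpha}}\,dy$$ whenever the limit exists, with $c_{N,\alpha}=2^{\alpha-2}\pi^{-N/2}\alpha(2-\alpha)\Gamma(\frac{N+\alpha}{2})/\Gamma(2-\frac{\alpha}{2})$. It exists everywhere for functions in $C_c^2(\mathbb{R}^N)$. For $u\in\mathcal{L}^1_\alpha$ the distribution $(-\Delta)^{\alpha/2}u$ is defined by $\langle(-\Delta)^{\alpha/2}u,\varphi\rangle=\int_{\mathbb{R}^N}u\,(-\Delta)^{\alpha/2}\varphi\,dx$ for $\varphi\in C_c^\infty(\mathbb{R}^N)$. A solution of $(P)$ is a function $u$ that is continuous and bounded on $\mathbb{R}^N$, with $u=0$ in $\mathbb{R}^N\setminus D_0$, $u=1$ in $\overline{D}_1$, and $(-\Delta)^{\alpha/2}u=0$ as distributions in $D_0\setminus\overline{D}_1$, i.e. $\langle(-\Delta)^{\alpha/2}u,\varphi\rangle=0$ for all $\varphi\in C_c^\infty(D_0\setminus\overline{D}_1)$. A set $A\subset\mathbb{R}^N$ is starshaped (with respect to $0$) if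 $sA\subseteq A$ for every $s\in[0,1]$. It is strictly starshaped if $0$ is in the interior of $A$ and any ray starting from $0$ intersects the boundary of $A$ in only one point. *)

theory Defs
  imports "HOL-Analysis.Analysis"
begin

definition starshaped :: "'a::real_vector set \<Rightarrow> bool" where
  "starshaped A \<longleftrightarrow> (\<forall>s\<in>{0..1}. (\<lambda>x. s *\<^sub>R x) ` A \<subseteq> A)"

definition ray :: "'a::real_vector \<Rightarrow> 'a set" where
  "ray v = {t *\<^sub>R v | t. t \<ge> 0}"

definition strictly_starshaped :: "'a::real_normed_vector set \<Rightarrow> bool" where
  "strictly_starshaped A \<longleftrightarrow>
     0 \<in> interior A \<and> (\<forall>v. v \<noteq> 0 \<longrightarrow> (\<exists>!p. p \<in> ray v \<inter> frontier A))"

text \<open>The closed finite right circular cone with vertex \<open>p\<close>, axis direction \<open>e\<close>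
  (a unit vector), opening half-angle \<open>\<theta>\<close> and height \<open>h\<close>.\<close>

definition finite_cone :: "'a::euclidean_space \<Rightarrow> 'a \<Rightarrow> real \<Rightarrow> real \<Rightarrow> 'a set" where
  "finite_cone p e \<theta> h = {p + z | z. norm z * cos \<theta> \<le> z \<bullet> e \<and> z \<bullet> e \<le> h}"

text \<open>The uniform condition in the sense of Gilbarg--Trudinger: at every boundary point there is
  an exterior cone, and all these cones are congruent to a fixed one, that is, the half-angle and
  the height do not depend on the boundary point.\<close>

definition uniform_exterior_cone :: "'a::euclidean_space set \<Rightarrow> bool" where
  "uniform_exterior_cone \<Omega> \<longleftrightarrow>
     (\<exists>\<theta> h. 0 < \<theta> \<and> \<theta> < pi / 2 \<and> 0 < h \<and>
        (\<forall>p\<in>frontier \<Omega>. \<exists>e. norm e = 1 \<and> finite_cone p e \<theta> h \<inter> closure \<Omega> = {p}))"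

text \<open>\<open>C_times k f\<close>: \<open>f\<close> is \<open>k\<close> times continuously differentiable on the whole space.\<close>

primrec C_times :: "nat \<Rightarrow> ('a::euclidean_space \<Rightarrow> real) \<Rightarrow> bool" where
  "C_times 0 f \<longleftrightarrow> continuous_on UNIV f"
| "C_times (Suc k) f \<longleftrightarrow>
     (\<forall>x. f differentiable (at x)) \<and>
     (\<forall>b\<in>Basis. C_times k (\<lambda>x. frechet_derivative f (at x) b))"

definition test_functions :: "'a::euclidean_space set \<Rightarrow> ('a \<Rightarrow> real) set" where
  "test_functions \<Omega> =
     {\<phi>. (\<forall>k. C_times k \<phi>) \<and> compact (closure {x. \<phi> x \<noteq> 0}) \<and> closure {x. \<phi> x \<noteq> 0} \<subseteq> \<Omega>}"

definition L1_weighted :: "real \<Rightarrow> ('a::euclidean_space \<Rightarrow> real) set" where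
  "L1_weighted \<alpha> =
     {u. u \<in> borel_measurable borel \<and>
         integrable lborel (\<lambda>x. \<bar>u x\<bar> / (1 + norm x) powr (real DIM('a) + \<alpha>))}"

definition frac_const :: "nat \<Rightarrow> real \<Rightarrow> real" where
  "frac_const N \<alpha> =
     2 powr (\<alpha> - 2) * pi powr (- real N / 2) * \<alpha> * (2 - \<alpha>)
       * Gamma ((real N + \<alpha>) / 2) / Gamma (2 - \<alpha> / 2)"

text \<open>The pointwise operator \<open>(-\<Delta>)\<close> to the power \<open>\<alpha>/2\<close>. The value is meaningful only where the
  limit exists, which is the case at every point for the test functions.\<close>

definition frac_lap :: "real \<Rightarrow> ('a::euclidean_space \<Rightarrow> real) \<Rightarrow> 'a \<Rightarrow> real" where
  "frac_lap \<alpha> u x =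
     frac_const DIM('a) \<alpha> *
     Lim (at_right 0) (\<lambda>\<epsilon>. LINT y:{y. norm (x - y) > \<epsilon>}|lborel.
        (u x - u y) / norm (x - y) powr (real DIM('a) + \<alpha>))"

definition frac_lap_distr ::
    "real \<Rightarrow> ('a::euclidean_space \<Rightarrow> real) \<Rightarrow> ('a \<Rightarrow> real) \<Rightarrow> real" where
  "frac_lap_distr \<alpha> u \<phi> = (LINT x|lborel. u x * frac_lap \<alpha> \<phi> x)"

definition frac_harmonic_on ::
    "real \<Rightarrow> ('a::euclidean_space \<Rightarrow> real) \<Rightarrow> 'a set \<Rightarrow> bool" where
  "frac_harmonic_on \<alpha> u \<Omega> \<longleftrightarrow>
     u \<in> L1_weighted \<alpha> \<and> (\<forall>\<phi>\<in>test_functions \<Omega>. frac_lap_distr \<alpha> u \<phi> = 0)"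

definition solves_P ::
    "real \<Rightarrow> 'a::euclidean_space set \<Rightarrow> 'a set \<Rightarrow> ('a \<Rightarrow> real) \<Rightarrow> bool" where
  "solves_P \<alpha> D0 D1 u \<longleftrightarrow>
     continuous_on UNIV u \<and> bounded (range u) \<and>
     (\<forall>x. x \<notin> D0 \<longrightarrow> u x = 0) \<and> (\<forall>x\<in>closure D1. u x = 1) \<and>
     frac_harmonic_on \<alpha> u (D0 - closure D1)"

end

theory Submission
  imports Defs "HOL-Complex_Analysis.Great_Picard"
begin

text \<open>
  Existence. Replace the kernel \<open>\<bar>z\<bar> powr - (N + \<alpha>)\<close> by its restriction to \<open>\<bar>z\<bar> > \<epsilon>\<close>. The kernel is then
  integrable, the Dirichlet problem is solved by monotone iteration, and the maximum principle holds
  for bounded Borel functions. At a boundary point, the exterior cone contains a ball of comparable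
  radius at every scale, on which the solution equals its boundary value; a comparison shows that
  the oscillation there drops by a fixed factor from a scale to a sufficiently smaller one,
  uniformly in \<open>\<epsilon>\<close>. Since translates of a solution are solutions, comparing \<open>u (x + h)\<close> with \<open>u x\<close>
  carries this boundary modulus of continuity to the whole space, so no interior regularity is
  needed. A subsequence converges pointwise as \<open>\<epsilon>\<close> tends to \<open>0\<close>, and the truncated operators,
  applied to a test function, converge dominatedly.

  Comparison. A mollified distributional subsolution attains a positive maximum only where the
  mollifier is an admissible test function, which is impossible by the definition of the
  principal value; this gives uniqueness and, with an explicit subsolution, a strong maximum
  principle. Applied to \<open>u (s x) - u x\<close>, which is harmonic on \<open>\<Omega> \<inter> \<Omega> / s\<close> and nonnegative
  elsewhere, it gives the starshapedness. The strict form needs a point where the difference is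
  positive, and any \<open>q \<notin> D0\<close> with \<open>s q \<in> D0\<close> is one.
\<close>

subsection \<open>The kernel and its truncations\<close>

text \<open>The limiting operator is awkward to start from: its kernel is not integrable and it acts
  pointwise only on regular functions. After truncation it is the kernel mass times \<open>f\<close>
  minus a convolution, so it acts on every bounded Borel function, and its vanishing says that
  \<open>f\<close> equals a weighted mean of its own values. The price is that truncated solutions
  need not be continuous. Equicontinuity is therefore available only for \<epsilon> below a
  threshold depending on the prescribed modulus, and a pointwise limit along a subsequence replaces
  a compactness theorem for continuous functions. The boundary argument profits from data that are 0
  or 1 and locally constant off the domain: near a boundary point either \<open>u\<close> or
  \<open>1 - u\<close> vanishes on the whole nearby complement. In the limit all pairings go through
  \<open>frac_lim\<close>, the second-difference form of the principal value without its positive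
  constant. Both maximum principles exploit nonlocality: far values enter every equation with
  positive weight, so the principles work on disconnected open sets, and the reference point of the
  strong version may lie anywhere outside the open set.\<close>

definition frac_kernel :: "real \<Rightarrow> 'a::euclidean_space \<Rightarrow> real" where
  "frac_kernel \<alpha> z = 1 / norm z powr (real DIM('a) + \<alpha>)"

definition trunc_kernel :: "real \<Rightarrow> real \<Rightarrow> 'a::euclidean_space \<Rightarrow> real" where
  "trunc_kernel \<alpha> \<epsilon> z = (if norm z > \<epsilon> then frac_kernel \<alpha> z else 0)"

text \<open>The substitution y = x + z is built in and the normalising constant is left out; it is
  positive, so it does not affect which functions are harmonic.\<close>

definition trunc_lap :: "real \<Rightarrow> real \<Rightarrow> ('a::euclidean_space \<Rightarrow> real) \<Rightarrow> 'a \<Rightarrow> real" where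
  "trunc_lap \<alpha> \<epsilon> f x = (LINT z|lborel. trunc_kernel \<alpha> \<epsilon> z * (f x - f (x + z)))"

lemma frac_kernel_measurable [measurable]: "frac_kernel \<alpha> \<in> borel_measurable borel"
  unfolding frac_kernel_def by measurable

lemma trunc_kernel_measurable [measurable]: "trunc_kernel \<alpha> \<epsilon> \<in> borel_measurable borel"
  unfolding trunc_kernel_def by measurable

lemma frac_kernel_nonneg [simp]: "0 \<le> frac_kernel \<alpha> z"
  by (simp add: frac_kernel_def)

lemma trunc_kernel_nonneg [simp]: "0 \<le> trunc_kernel \<alpha> \<epsilon> z"
  by (simp add: trunc_kernel_def)

lemma frac_kernel_minus [simp]: "frac_kernel \<alpha> (- z) = frac_kernel \<alpha> z"
  by (simp add: frac_kernel_def)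

lemma trunc_kernel_minus [simp]: "trunc_kernel \<alpha> \<epsilon> (- z) = trunc_kernel \<alpha> \<epsilon> z"
  by (simp add: trunc_kernel_def)

lemma trunc_lap_measurable [measurable]:
  assumes [measurable]: "f \<in> borel_measurable borel"
  shows "trunc_lap \<alpha> \<epsilon> f \<in> borel_measurable borel"
proof -
  have "(\<lambda>x. LINT z|lborel. trunc_kernel \<alpha> \<epsilon> z * (f x - f (x + z))) \<in> borel_measurable lborel"
    by (rule lborel.borel_measurable_lebesgue_integral) measurable
  then show ?thesis
    by (simp add: trunc_lap_def [abs_def])
qed

section \<open>Lebesgue integrals: affine substitution, lower bounds, dyadic majorants\<close>

lemma
  fixes f :: "'a::euclidean_space \<Rightarrow> real"
  assumes f [measurable]: "f \<in> borel_measurable borel" and c: "c \<noteq> 0"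
  shows lborel_integral_affine:
      "(LINT x|lborel. f (t + c *\<^sub>R x)) * \<bar>c\<bar> ^ DIM('a) = (LINT x|lborel. f x)"
    and lborel_integrable_affine:
      "integrable lborel (\<lambda>x. f (t + c *\<^sub>R x)) \<longleftrightarrow> integrable lborel f"
proof -
  have eq: "(LINT x|lborel. f x) =
      (LINT x|density (distr lborel borel (\<lambda>x. t + c *\<^sub>R x)) (\<lambda>_. \<bar>c\<bar>^DIM('a)). f x)"
    using lborel_affine[OF c, of t] by simp
  also have "\<dots> = (LINT x|distr lborel borel (\<lambda>x. t + c *\<^sub>R x). \<bar>c\<bar>^DIM('a) *\<^sub>R f x)"
    by (rule integral_density) auto
  also have "\<dots> = (LINT x|lborel. \<bar>c\<bar>^DIM('a) *\<^sub>R f (t + c *\<^sub>R x))"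
    by (rule integral_distr) auto
  finally show "(LINT x|lborel. f (t + c *\<^sub>R x)) * \<bar>c\<bar> ^ DIM('a) = (LINT x|lborel. f x)"
    by simp
  have "integrable lborel f \<longleftrightarrow>
      integrable (density (distr lborel borel (\<lambda>x. t + c *\<^sub>R x)) (\<lambda>_. \<bar>c\<bar>^DIM('a))) f"
    using lborel_affine[OF c, of t] by simp
  also have "\<dots> \<longleftrightarrow> integrable (distr lborel borel (\<lambda>x. t + c *\<^sub>R x)) (\<lambda>x. \<bar>c\<bar>^DIM('a) *\<^sub>R f x)"
    by (rule integrable_density) auto
  also have "\<dots> \<longleftrightarrow> integrable lborel (\<lambda>x. \<bar>c\<bar>^DIM('a) *\<^sub>R f (t + c *\<^sub>R x))"
    by (rule integrable_distr_eq) auto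
  also have "\<dots> \<longleftrightarrow> integrable lborel (\<lambda>x. f (t + c *\<^sub>R x))"
    using c by simp
  finally show "integrable lborel (\<lambda>x. f (t + c *\<^sub>R x)) \<longleftrightarrow> integrable lborel f" by simp
qed

lemma
  fixes f :: "'a::euclidean_space \<Rightarrow> real"
  assumes f: "f \<in> borel_measurable borel"
  shows lborel_integral_shift: "(LINT x|lborel. f (t + x)) = (LINT x|lborel. f x)"
    and lborel_integrable_shift: "integrable lborel (\<lambda>x. f (t + x)) \<longleftrightarrow> integrable lborel f"
    and lborel_integral_minus: "(LINT x|lborel. f (- x)) = (LINT x|lborel. f x)"
    and lborel_integrable_minus: "integrable lborel (\<lambda>x. f (- x)) \<longleftrightarrow> integrable lborel f"
  using lborel_integral_affine[OF f, of 1 t] lborel_integrable_affine[OF f, of 1 t]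
    lborel_integral_affine[OF f, of "-1" 0] lborel_integrable_affine[OF f, of "-1" 0] by simp_all

text \<open>Serves lower bounds by geometry alone: one ball on which the integrand is not small
  suffices for the positivity of a mass or of an interaction.\<close>

lemma integral_ge_on_ball:
  fixes f :: "'a::euclidean_space \<Rightarrow> real"
  assumes "integrable lborel f" "\<And>x. 0 \<le> f x" "\<And>x. x \<in> ball q r \<Longrightarrow> c \<le> f x" "0 \<le> r"
  shows "c * (unit_ball_vol DIM('a) * r ^ DIM('a)) \<le> (LINT x|lborel. f x)"
proof -
  have "(LINT x|lborel. c * indicator (ball q r) x) \<le> (LINT x|lborel. f x)"
    using assms(2,3) emeasure_bounded_finite[of "ball q r"]
    by (intro integral_mono assms(1) integrable_mult_right integrable_real_indicator)
      (auto simp: indicator_def)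
  moreover have "(LINT x|lborel. c * indicator (ball q r) x) = c * measure lborel (ball q r)"
    by simp
  ultimately show ?thesis using content_ball[of r q] assms(4) by simp
qed

text \<open>\<open>h\<close> is dominated pointwise by the sum over n of \<open>c n\<close> times
  the indicator of the ball of radius \<open>r n\<close>, whose integral is the given series up to
  the volume of the unit ball. This does the work of polar coordinates.\<close>

lemma integrable_dyadic:
  fixes h :: "'a::euclidean_space \<Rightarrow> real"
  assumes h: "h \<in> borel_measurable borel" "\<And>z. 0 \<le> h z"
    and c: "\<And>n::nat. 0 \<le> c n" and r: "\<And>n. 0 \<le> r n"
    and sum: "summable (\<lambda>n. c n * r n ^ DIM('a))"
    and dom: "\<And>z. h z > 0 \<Longrightarrow> \<exists>n. norm z \<le> r n \<and> h z \<le> c n"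
  shows "integrable lborel h"
proof (rule integrableI_bounded)
  show "h \<in> borel_measurable lborel" using h by simp
  let ?V = "unit_ball_vol (real DIM('a))"
  have "(\<integral>\<^sup>+ x. ennreal (norm (h x)) \<partial>lborel)
      \<le> (\<integral>\<^sup>+ (x::'a). (\<Sum>n. ennreal (c n) * indicator (cball 0 (r n)) x) \<partial>lborel)"
  proof (intro nn_integral_mono)
    fix x :: 'a
    show "ennreal (norm (h x)) \<le> (\<Sum>n. ennreal (c n) * indicator (cball 0 (r n)) x)"
    proof (cases "h x > 0")
      case True
      from dom[OF True] obtain n where n: "norm x \<le> r n" "h x \<le> c n" by auto
      have "ennreal (norm (h x)) \<le> (\<Sum>k\<in>{n}. ennreal (c k) * indicator (cball 0 (r k)) x)"
        using n h(2) by (simp add: ennreal_leI)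
      also have "\<dots> \<le> (\<Sum>n. ennreal (c n) * indicator (cball 0 (r n)) x)"
        by (rule sum_le_suminf) auto
      finally show ?thesis .
    next
      case False
      then have "h x = 0" using h(2)[of x] by simp
      then show ?thesis by simp
    qed
  qed
  also have "\<dots> = (\<Sum>n. \<integral>\<^sup>+ x. ennreal (c n) * indicator (cball 0 (r n)) x \<partial>(lborel::'a measure))"
    by (rule nn_integral_suminf) (use borel_closed[OF closed_cball] in measurable)
  also have "\<dots> = (\<Sum>n. ennreal (?V * (c n * r n ^ DIM('a))))"
    using c r by (intro suminf_cong, subst nn_integral_cmult_indicator)
      (simp_all add: emeasure_cball ennreal_mult[symmetric] mult_ac)
  also have "\<dots> < \<infinity>"
    unfolding infinity_ennreal_def less_top[symmetric] using sum c r
    by (intro ennreal_suminf_neq_top summable_mult) auto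
  finally show "(\<integral>\<^sup>+ x. ennreal (norm (h x)) \<partial>lborel) < \<infinity>" .
qed

section \<open>Mass and homogeneity of the kernel\<close>

locale frac_order =
  fixes \<alpha> :: real
  assumes alpha_pos: "0 < \<alpha>" and alpha_less: "\<alpha> < 2"
begin

text \<open>On the shell 2^n < |z| <= 2^(n+1) the kernel is at most 2^(-(N + alpha) n), while the
  volume grows like 2^(N n); the remaining ratio 2^(-alpha) is summable because alpha > 0.\<close>

lemma integrable_trunc_kernel_1: "integrable lborel (trunc_kernel \<alpha> 1 :: 'a::euclidean_space \<Rightarrow> real)"
proof (rule integrable_dyadic)
  let ?b = "real DIM('a) + \<alpha>"
  have b: "?b > 0" using alpha_pos by simp
  show "0 \<le> 2 powr (- ?b * real n)" "0 \<le> (2::real) ^ Suc n" for n by simp_all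
  have "2 powr (- ?b * real n) * (2 ^ Suc n) ^ DIM('a) = 2 ^ DIM('a) * (2 powr (-\<alpha>)) ^ n" for n
  proof -
    have "2 powr (- ?b * real n) = (2 powr (-\<alpha>)) ^ n * inverse ((2 ^ n) ^ DIM('a))"
      by (simp add: powr_realpow[symmetric] powr_powr powr_add[symmetric] powr_minus[symmetric] algebra_simps)
    moreover have "((2::real) ^ Suc n) ^ DIM('a) = 2 ^ DIM('a) * (2 ^ n) ^ DIM('a)"
      by (simp add: power_mult_distrib)
    ultimately show ?thesis by simp
  qed
  then show "summable (\<lambda>n. 2 powr (- ?b * real n) * (2 ^ Suc n) ^ DIM('a))"
    using alpha_pos by (simp only:) (intro summable_mult summable_geometric, simp add: powr_less_one)
  fix z :: 'a assume "trunc_kernel \<alpha> 1 z > 0"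
  then have z: "norm z > 1" by (auto simp: trunc_kernel_def split: if_splits)
  \<comment> \<open>The least exponent reached by |z| picks the shell; |z| > 1 makes it a
    successor.\<close>
  define m where "m = (LEAST n. norm z \<le> 2 ^ n)"
  have m: "norm z \<le> 2 ^ m" unfolding m_def
    by (rule LeastI_ex) (meson less_imp_le one_less_numeral_iff real_arch_pow semiring_norm(76))
  have "m \<noteq> 0" using m z by (metis leD power_0)
  then obtain n where n: "m = Suc n" using not0_implies_Suc by blast
  have "\<not> norm z \<le> 2 ^ n" using not_less_Least[of n "\<lambda>n. norm z \<le> 2 ^ n"] n m_def by simp
  then have "2 powr real n < norm z" by (simp add: powr_realpow)
  then have "(2 powr real n) powr ?b \<le> norm z powr ?b"
    using b by (intro powr_mono2) auto
  moreover have "trunc_kernel \<alpha> 1 z = inverse (norm z powr ?b)" using z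
    by (simp add: trunc_kernel_def frac_kernel_def inverse_eq_divide)
  ultimately have "trunc_kernel \<alpha> 1 z \<le> inverse ((2 powr real n) powr ?b)"
    by (simp add: le_imp_inverse_le)
  also have "\<dots> = 2 powr (- ?b * real n)"
    by (simp add: powr_powr powr_minus[symmetric] algebra_simps)
  finally show "\<exists>n. norm z \<le> 2 ^ Suc n \<and> trunc_kernel \<alpha> 1 z \<le> 2 powr (- ?b * real n)"
    using m n by auto
qed auto

text \<open>The weight min(1, |z|^2) is the bound for second differences of a C^2 function of
  compact support, so this is the majorant for integrals of the kernel against them.\<close>

definition min_kernel :: "'a::euclidean_space \<Rightarrow> real" where
  "min_kernel z = min 1 ((norm z)\<^sup>2) * frac_kernel \<alpha> z"

lemma integrable_min_kernel: "integrable lborel (min_kernel :: 'a::euclidean_space \<Rightarrow> real)"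
proof -
  let ?b = "real DIM('a) + \<alpha>"
  have b: "?b > 0" using alpha_pos by simp
  \<comment> \<open>Near the origin the dyadic series has ratio 2^(alpha - 2), which is where alpha
    < 2 enters; the part |z| > 1 is \<open>trunc_kernel\<close> with threshold 1.\<close>
  define h :: "'a \<Rightarrow> real" where "h z = (if norm z \<le> 1 then (norm z)\<^sup>2 * frac_kernel \<alpha> z else 0)" for z
  have "integrable lborel h"
  proof (rule integrable_dyadic)
    show "h \<in> borel_measurable borel" unfolding h_def by measurable
    show "0 \<le> h z" for z by (simp add: h_def)
    show "0 \<le> 2 powr (-2 * real n) * 2 powr (?b * real (Suc n))" "0 \<le> (1/2::real) ^ n" for n by simp_all
    have p2: "(1/2) ^ k = 2 powr (- real k)" for k
      by (simp add: powr_minus powr_realpow power_one_over inverse_eq_divide)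
    have "2 powr (-2 * real n) * 2 powr (?b * real (Suc n)) * ((1/2) ^ n) ^ DIM('a)
        = 2 powr ?b * (2 powr (\<alpha> - 2)) ^ n" for n
    proof -
      have "((1/2::real) ^ n) ^ DIM('a) = 2 powr (- real n * real DIM('a))"
        by (simp add: p2 powr_realpow[symmetric] powr_powr)
      moreover have "(2 powr (\<alpha> - 2)) ^ n = 2 powr ((\<alpha> - 2) * real n)"
        by (simp add: powr_realpow[symmetric] powr_powr)
      ultimately show ?thesis
        by (simp add: powr_add[symmetric] algebra_simps)
    qed
    then show "summable (\<lambda>n. 2 powr (-2 * real n) * 2 powr (?b * real (Suc n)) * ((1/2) ^ n) ^ DIM('a))"
      using alpha_less by (simp only:) (intro summable_mult summable_geometric, simp add: powr_less_one)
    fix z :: 'a assume "h z > 0"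
    then have z: "norm z \<le> 1" "norm z > 0" by (auto simp: h_def split: if_splits)
    define m where "m = (LEAST n. (1/2) ^ n < norm z)"
    have m: "(1/2) ^ m < norm z" unfolding m_def
      by (rule LeastI_ex) (use real_arch_pow_inv[of "norm z" "1/2"] z in auto)
    have "m \<noteq> 0" using m z by (metis leD power_0)
    then obtain n where n: "m = Suc n" using not0_implies_Suc by blast
    have n2: "norm z \<le> (1/2) ^ n" using not_less_Least[of n "\<lambda>n. (1/2) ^ n < norm z"] n m_def by simp
    have "(2 powr (- real m)) powr ?b \<le> norm z powr ?b"
      using b m unfolding p2 by (intro powr_mono2) auto
    then have "frac_kernel \<alpha> z \<le> inverse ((2 powr (- real m)) powr ?b)"
      by (simp add: frac_kernel_def le_imp_inverse_le inverse_eq_divide[symmetric])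
    also have "\<dots> = 2 powr (?b * real (Suc n))"
      by (simp add: powr_powr powr_minus[symmetric] n algebra_simps)
    finally have k: "frac_kernel \<alpha> z \<le> 2 powr (?b * real (Suc n))" .
    have "(norm z)\<^sup>2 \<le> ((1/2) ^ n)\<^sup>2" using n2 by (intro power_mono) auto
    also have "\<dots> = 2 powr (-2 * real n)"
      unfolding p2 by (simp add: power2_eq_square powr_add[symmetric])
    finally have "h z \<le> 2 powr (-2 * real n) * 2 powr (?b * real (Suc n))"
      using k z by (auto simp: h_def intro!: mult_mono)
    then show "\<exists>n. norm z \<le> (1/2) ^ n \<and> h z \<le> 2 powr (-2 * real n) * 2 powr (?b * real (Suc n))"
      using n2 by auto
  qed
  then have "integrable lborel (\<lambda>z. h z + trunc_kernel \<alpha> 1 z)"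
    by (intro Bochner_Integration.integrable_add integrable_trunc_kernel_1)
  also have "(\<lambda>z. h z + trunc_kernel \<alpha> 1 z) = min_kernel"
  proof
    fix z :: 'a
    have "norm z \<le> 1 \<longleftrightarrow> (norm z)\<^sup>2 \<le> 1" by (simp add: abs_square_le_1)
    then show "h z + trunc_kernel \<alpha> 1 z = min_kernel z"
      by (auto simp: h_def trunc_kernel_def min_kernel_def min_def)
  qed
  finally show ?thesis .
qed

lemma frac_kernel_scale:
  fixes z :: "'a::euclidean_space"
  assumes "r > 0"
  shows "frac_kernel \<alpha> (r *\<^sub>R z) = r powr (- \<alpha>) / r ^ DIM('a) * frac_kernel \<alpha> z"
  using assms by (simp add: frac_kernel_def powr_mult powr_add powr_minus powr_realpow field_simps)

text \<open>The kernel is homogeneous of degree -(N + alpha) and the substitution contributes r^N,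
  so r^(-alpha) remains. With \<open>F\<close> an indicator this rescales truncations, with
  \<open>F\<close> a bound for second differences it rescales bumps.\<close>

lemma
  fixes F :: "'a::euclidean_space \<Rightarrow> real"
  assumes [measurable]: "F \<in> borel_measurable borel" and r: "r > 0"
  shows integral_frac_kernel_scale: "(LINT z|lborel. frac_kernel \<alpha> z * F ((1/r) *\<^sub>R z)) =
      r powr (-\<alpha>) * (LINT z|lborel. frac_kernel \<alpha> z * F z)"
    and integrable_frac_kernel_scale: "integrable lborel (\<lambda>z. frac_kernel \<alpha> z * F z) \<Longrightarrow>
      integrable lborel (\<lambda>z. frac_kernel \<alpha> z * F ((1/r) *\<^sub>R z))"
proof -
  have "(LINT z|lborel. frac_kernel \<alpha> z * F ((1/r) *\<^sub>R z)) =
      (LINT z|lborel. frac_kernel \<alpha> (r *\<^sub>R z) * F z) * r ^ DIM('a)"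
    using r lborel_integral_affine[of "\<lambda>z. frac_kernel \<alpha> z * F ((1/r) *\<^sub>R z)" r 0] by simp
  also have "\<dots> = r powr (-\<alpha>) * (LINT z|lborel. frac_kernel \<alpha> z * F z)"
    using r by (simp add: frac_kernel_scale mult.assoc)
  finally show "(LINT z|lborel. frac_kernel \<alpha> z * F ((1/r) *\<^sub>R z)) =
      r powr (-\<alpha>) * (LINT z|lborel. frac_kernel \<alpha> z * F z)" .
  assume "integrable lborel (\<lambda>z. frac_kernel \<alpha> z * F z)"
  then have "integrable lborel (\<lambda>z. frac_kernel \<alpha> (r *\<^sub>R z) * F z)"
    using r by (simp add: frac_kernel_scale mult.assoc)
  then show "integrable lborel (\<lambda>z. frac_kernel \<alpha> z * F ((1/r) *\<^sub>R z))"
    using r lborel_integrable_affine[of "\<lambda>z. frac_kernel \<alpha> z * F ((1/r) *\<^sub>R z)" r 0] by simp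
qed

text \<open>The type argument carries the dimension, on which the value depends although neither
  \<epsilon> nor the result type mentions it.\<close>

definition kernel_mass :: "'a::euclidean_space itself \<Rightarrow> real \<Rightarrow> real" where
  "kernel_mass _ \<epsilon> = (LINT z|(lborel :: 'a measure). trunc_kernel \<alpha> \<epsilon> z)"

lemma
  assumes "\<epsilon> > 0"
  shows integrable_trunc_kernel: "integrable lborel (trunc_kernel \<alpha> \<epsilon> :: 'a::euclidean_space \<Rightarrow> real)"
    and kernel_mass_eq: "kernel_mass TYPE('a) \<epsilon> = \<epsilon> powr (-\<alpha>) * kernel_mass TYPE('a) 1"
proof -
  define F :: "'a \<Rightarrow> real" where "F z = (if norm z > 1 then 1 else 0)" for z
  have [measurable]: "F \<in> borel_measurable borel" unfolding F_def by measurable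
  have 1: "trunc_kernel \<alpha> 1 = (\<lambda>z::'a. frac_kernel \<alpha> z * F z)"
    by (auto simp: trunc_kernel_def F_def)
  have 2: "trunc_kernel \<alpha> \<epsilon> = (\<lambda>z::'a. frac_kernel \<alpha> z * F ((1/\<epsilon>) *\<^sub>R z))"
    using assms by (auto simp: trunc_kernel_def F_def field_simps)
  show "integrable lborel (trunc_kernel \<alpha> \<epsilon> :: 'a \<Rightarrow> real)" unfolding 2
    by (rule integrable_frac_kernel_scale) (use assms integrable_trunc_kernel_1[where 'a='a] in \<open>simp_all add: 1\<close>)
  show "kernel_mass TYPE('a) \<epsilon> = \<epsilon> powr (-\<alpha>) * kernel_mass TYPE('a) 1"
    unfolding kernel_mass_def 1 2 using assms by (intro integral_frac_kernel_scale) auto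
qed

lemma kernel_mass_pos:
  assumes "\<epsilon> > 0"
  shows "kernel_mass TYPE('a::euclidean_space) \<epsilon> > 0"
proof -
  let ?b = "real DIM('a) + \<alpha>"
  have b: "?b > 0" using alpha_pos by simp
  obtain e :: 'a where e: "norm e = 1" using vector_choose_size[of 1] by auto
  \<comment> \<open>The unit ball about a point of norm \<open>\<epsilon> + 1\<close> lies in the
    shell between \<epsilon> and \<open>\<epsilon> + 2\<close>, where the kernel is bounded
    below.\<close>
  define q where "q = (\<epsilon> + 1) *\<^sub>R e"
  have q: "norm q = \<epsilon> + 1" using assms e by (simp add: q_def)
  have "1 / (\<epsilon> + 2) powr ?b * (unit_ball_vol DIM('a) * 1 ^ DIM('a)) \<le> kernel_mass TYPE('a) \<epsilon>"
    unfolding kernel_mass_def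
  proof (rule integral_ge_on_ball)
    fix x assume "x \<in> ball q 1"
    then have "norm (q - x) < 1" by (simp add: dist_norm)
    then have "\<epsilon> < norm x" "norm x < \<epsilon> + 2"
      using norm_triangle_ineq2[of q x] norm_triangle_ineq2[of x q] q
      by (auto simp: norm_minus_commute)
    then show "1 / (\<epsilon> + 2) powr ?b \<le> trunc_kernel \<alpha> \<epsilon> x"
      using b assms by (auto simp: trunc_kernel_def frac_kernel_def intro!: divide_left_mono powr_mono2 mult_pos_pos)
  qed (use assms integrable_trunc_kernel in auto)
  moreover have "1 / (\<epsilon> + 2) powr ?b * (unit_ball_vol DIM('a) * 1 ^ DIM('a)) > 0"
    using assms by simp
  ultimately show ?thesis by linarith
qed

end

subsection \<open>Smooth functions of compact support\<close>

text \<open>\<open>C_times\<close> is phrased with \<open>frechet_derivative\<close>, a choice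
  operator; this rule lets a derivative be exhibited instead and drives the closure properties
  below.\<close>

lemma C_times_SucI:
  assumes d: "\<And>x. (f has_derivative f' x) (at x)"
    and C: "\<And>b. b \<in> Basis \<Longrightarrow> C_times k (\<lambda>x. f' x b)"
  shows "C_times (Suc k) f"
proof -
  have "frechet_derivative f (at x) = f' x" for x
    using frechet_derivative_at[OF d] by simp
  then show ?thesis using d C by (auto simp: differentiable_def)
qed

lemma C_times_derivative:
  assumes "C_times (Suc k) f"
  shows "(f has_derivative frechet_derivative f (at x)) (at x)"
  using assms frechet_derivative_works by auto

lemma C_times_continuous: "C_times k f \<Longrightarrow> continuous_on UNIV f"
  by (cases k) (auto intro!: differentiable_imp_continuous_on simp: differentiable_on_def)

lemma C_times_Suc_lower: "C_times (Suc k) f \<Longrightarrow> C_times k f"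
proof (induction k arbitrary: f)
  case 0
  then show ?case using C_times_continuous[OF 0] by simp
next
  case (Suc k)
  have "C_times k (\<lambda>x. frechet_derivative f (at x) b)" if "b \<in> Basis" for b
    using Suc.IH Suc.prems that by (metis C_times.simps(2))
  then show ?case using Suc.prems by simp
qed

lemma C_times_const: "C_times k (\<lambda>x. c)"
  by (induction k arbitrary: c) (auto intro!: C_times_SucI[where f'="\<lambda>_ _. 0"] simp del: C_times.simps(2))

lemma C_times_inner: "C_times k (\<lambda>x. x \<bullet> b)"
proof (cases k)
  case 0
  then show ?thesis by (simp add: continuous_on_inner)
next
  case (Suc n)
  then show ?thesis
    by (auto intro!: C_times_SucI[where f'="\<lambda>_ h. h \<bullet> b"] derivative_eq_intros C_times_const
        simp del: C_times.simps(2))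
qed

lemma C_times_add:
  "C_times k f \<Longrightarrow> C_times k g \<Longrightarrow> C_times k (\<lambda>x. f x + g x)"
proof (induction k arbitrary: f g)
  case 0
  then show ?case by (auto intro: continuous_on_add)
next
  case (Suc k)
  note d = Suc.prems[THEN C_times_derivative]
  show ?case
  proof (rule C_times_SucI)
    fix x
    show "((\<lambda>x. f x + g x) has_derivative
      (\<lambda>v. frechet_derivative f (at x) v + frechet_derivative g (at x) v)) (at x)"
      by (intro has_derivative_add d)
  qed (use Suc in auto)
qed

lemma C_times_mult:
  "C_times k f \<Longrightarrow> C_times k g \<Longrightarrow> C_times k (\<lambda>x. f x * g x)"
proof (induction k arbitrary: f g)
  case 0
  then show ?case by (auto intro: continuous_on_mult)
next
  case (Suc k)
  note d = Suc.prems[THEN C_times_derivative]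
  note l = Suc.prems[THEN C_times_Suc_lower]
  show ?case
  proof (rule C_times_SucI)
    fix x
    show "((\<lambda>x. f x * g x) has_derivative
      (\<lambda>v. f x * frechet_derivative g (at x) v + frechet_derivative f (at x) v * g x)) (at x)"
      by (intro has_derivative_mult d)
  qed (use Suc l in \<open>auto intro!: C_times_add\<close>)
qed

lemma C_times_scale:
  assumes "C_times k f"
  shows "C_times k (\<lambda>x. f (c *\<^sub>R x))"
  using assms
proof (induction k arbitrary: f)
  case 0
  then show ?case by (auto intro!: continuous_on_compose2[of UNIV f] continuous_intros)
next
  case (Suc k)
  show ?case
  proof (rule C_times_SucI)
    fix x
    have "((\<lambda>x. f (c *\<^sub>R x)) has_derivative
        (\<lambda>v. frechet_derivative f (at (c *\<^sub>R x)) (c *\<^sub>R v))) (at x)"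
      by (rule has_derivative_compose[OF _ C_times_derivative[OF Suc.prems]])
        (auto intro!: derivative_eq_intros)
    then show "((\<lambda>x. f (c *\<^sub>R x)) has_derivative
        (\<lambda>v. c * frechet_derivative f (at (c *\<^sub>R x)) v)) (at x)"
      using linear_scale[OF has_derivative_linear[OF C_times_derivative[OF Suc.prems]]] by simp
  qed (use Suc in \<open>auto intro!: C_times_mult C_times_const\<close>)
qed

section \<open>A smooth bump built from exp (-1/t)\<close>

definition flat_exp :: "real poly \<Rightarrow> real \<Rightarrow> real" where
  "flat_exp p t = (if t > 0 then poly p (1 / t) * exp (- (1 / t)) else 0)"

text \<open>The extra power makes the induction over the coefficients work: splitting off the
  constant coefficient moves one more factor \<open>s\<close> into the power.\<close>

lemma power_poly_exp_tendsto_0: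
  "((\<lambda>s::real. s ^ k * poly p s * exp (- s)) \<longlongrightarrow> 0) at_top"
proof (induction p arbitrary: k)
  case 0
  then show ?case by simp
next
  case (pCons a p)
  have "((\<lambda>s::real. a * (s ^ k / exp s) + s ^ Suc k * poly p s * exp (- s)) \<longlongrightarrow> a * 0 + 0) at_top"
    by (intro tendsto_intros tendsto_power_div_exp_0 pCons.IH)
  then show ?case by (simp add: algebra_simps exp_minus divide_simps)
qed

text \<open>With s = 1/t, differentiating p(s) exp(-s) in t gives s^2 (p - p')(s) exp(-s). The
  polynomial parameter closes the family under differentiation, so smoothness becomes an induction
  without formulas for higher derivatives.\<close>

lemma flat_exp_deriv:
  "(flat_exp p has_field_derivative flat_exp ([:0, 0, 1:] * (p - pderiv p)) t) (at t)"
proof (cases t "0::real" rule: linorder_cases)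
  case less
  have "(flat_exp p has_field_derivative 0) (at t)"
    by (rule has_field_derivative_transform_within_open[of "\<lambda>_. 0" 0 t "{..<0}"])
      (use less in \<open>auto simp: flat_exp_def\<close>)
  then show ?thesis using less by (simp add: flat_exp_def)
next
  case greater
  let ?q = "[:0, 0, 1:] * (p - pderiv p)"
  have "((\<lambda>t. poly p (1 / t) * exp (- (1 / t))) has_field_derivative poly ?q (1 / t) * exp (- (1 / t))) (at t)"
    using greater
    by (auto intro!: derivative_eq_intros DERIV_chain2[OF poly_DERIV] simp: field_simps power2_eq_square)
  then have "(flat_exp p has_field_derivative poly ?q (1 / t) * exp (- (1 / t))) (at t)"
    by (rule has_field_derivative_transform_within_open[where S = "{0<..}"])
      (use greater in \<open>auto simp: flat_exp_def\<close>)
  then show ?thesis using greater by (simp add: flat_exp_def)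
next
  case equal
  \<comment> \<open>At 0 the left difference quotient is 0, and the right one is s p(s) exp(-s) with
    s = 1/h tending to infinity.\<close>
  have "((\<lambda>h. flat_exp p h / h) \<longlongrightarrow> 0) (at_left 0)"
    by (rule tendsto_eventually) (auto simp: flat_exp_def eventually_at_filter)
  moreover have "((\<lambda>h. flat_exp p h / h) \<longlongrightarrow> 0) (at_right 0)"
  proof (rule Lim_transform_eventually)
    show "((\<lambda>h::real. inverse h ^ 1 * poly p (inverse h) * exp (- inverse h)) \<longlongrightarrow> 0) (at_right 0)"
      by (rule filterlim_compose[OF power_poly_exp_tendsto_0 filterlim_inverse_at_top_right])
    show "\<forall>\<^sub>F h in at_right 0. inverse h ^ 1 * poly p (inverse h) * exp (- inverse h) = flat_exp p h / h"
      by (auto simp: flat_exp_def eventually_at_filter inverse_eq_divide)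
  qed
  ultimately have "((\<lambda>h. flat_exp p h / h) \<longlongrightarrow> 0) (at 0)"
    by (rule filterlim_split_at)
  then show ?thesis using equal by (simp add: has_field_derivative_iff flat_exp_def)
qed

lemma C_times_flat_exp:
  fixes h :: "'a::euclidean_space \<Rightarrow> real"
  assumes h: "\<And>x. (h has_derivative h' x) (at x)"
    and h': "\<And>k b. b \<in> Basis \<Longrightarrow> C_times k (\<lambda>x. h' x b)"
  shows "C_times k (\<lambda>x. flat_exp p (h x))"
proof -
  have d: "((\<lambda>x. flat_exp p (h x)) has_derivative
      (\<lambda>v. flat_exp ([:0, 0, 1:] * (p - pderiv p)) (h x) * h' x v)) (at x)" for x p
    by (rule has_derivative_compose[OF h flat_exp_deriv[unfolded has_field_derivative_def]])
  show ?thesis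
  proof (induction k arbitrary: p)
    case 0
    show ?case using d
      by (auto intro!: has_derivative_continuous_on)
  next
    case (Suc k)
    show ?case by (rule C_times_SucI[OF d]) (intro C_times_mult Suc h')
  qed
qed

text \<open>The squared norm keeps the function smooth at its centre. It is not normalised; the
  height at the centre is exp(-1).\<close>

definition bump :: "'a::euclidean_space \<Rightarrow> real \<Rightarrow> 'a \<Rightarrow> real" where
  "bump p r x = flat_exp 1 (1 - (norm (x - p) / r)\<^sup>2)"

lemma C_times_bump: "C_times k (bump p r)"
proof -
  define c where "c = 1 / r\<^sup>2"
  have 1: "1 - (norm (x - p) / r)\<^sup>2 = 1 - (x - p) \<bullet> (x - p) * c" for x
    by (simp add: power_divide power2_norm_eq_inner c_def)
  have "C_times k (\<lambda>x. flat_exp 1 (1 - (x - p) \<bullet> (x - p) * c))"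
  proof (rule C_times_flat_exp)
    show "((\<lambda>x. 1 - (x - p) \<bullet> (x - p) * c) has_derivative
        (\<lambda>v. (- 2 * c) * (x \<bullet> v + - (p \<bullet> v)))) (at x)" for x
      by (auto intro!: derivative_eq_intros simp: inner_diff inner_commute algebra_simps)
    show "C_times k (\<lambda>x. - 2 * c * (x \<bullet> b + - (p \<bullet> b)))" for k b
      by (intro C_times_mult C_times_add C_times_const C_times_inner)
  qed
  then show ?thesis unfolding bump_def[abs_def] 1 .
qed

lemma bump_nonneg: "0 \<le> bump p r x"
  and bump_le_1: "bump p r x \<le> 1"
  by (auto simp: bump_def flat_exp_def)

lemma bump_pos_iff:
  assumes "r > 0"
  shows "0 < bump p r x \<longleftrightarrow> x \<in> ball p r"
proof -
  have "(norm (x - p) / r)\<^sup>2 < 1 \<longleftrightarrow> norm (x - p) / r < 1"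
    using assms by (simp add: abs_square_less_1)
  also have "\<dots> \<longleftrightarrow> x \<in> ball p r"
    using assms by (simp add: dist_norm norm_minus_commute)
  finally show ?thesis by (simp add: bump_def flat_exp_def)
qed

lemma bump_eq_0_iff: "r > 0 \<Longrightarrow> bump p r x = 0 \<longleftrightarrow> x \<notin> ball p r"
  using bump_pos_iff[of r p x] bump_nonneg[of p r x] by linarith

text \<open>On the half ball 1 - t^2 is at least 3/4, hence the exponent 4/3 that reappears in the
  later lower bounds.\<close>

lemma bump_half_ball:
  assumes "r > 0" "x \<in> ball p (r / 2)"
  shows "exp (- (4 / 3)) \<le> bump p r x"
proof -
  have "norm (x - p) / r \<le> 1 / 2" using assms by (auto simp: dist_norm norm_minus_commute)
  then have "(norm (x - p) / r)\<^sup>2 \<le> (1 / 2)\<^sup>2" using assms by (intro power_mono) auto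
  then have *: "1 - (norm (x - p) / r)\<^sup>2 \<ge> 3 / 4" by (simp add: power2_eq_square)
  then have "1 / (1 - (norm (x - p) / r)\<^sup>2) \<le> 1 / (3 / 4)" by (intro divide_left_mono) auto
  then show ?thesis using * by (simp add: bump_def flat_exp_def)
qed

lemma bump_rescale: "bump p r x = bump 0 1 ((1 / r) *\<^sub>R (x - p))"
  by (simp add: bump_def power_divide)

lemma bump_test_function:
  assumes "r > 0" "cball p r \<subseteq> \<Omega>"
  shows "bump p r \<in> test_functions \<Omega>"
proof -
  have "{x. bump p r x \<noteq> 0} = ball p r" using bump_eq_0_iff[OF assms(1), of p] by blast
  then have "closure {x. bump p r x \<noteq> 0} = cball p r" using assms(1) by simp
  then show ?thesis using assms(2) C_times_bump compact_cball[of p r]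
    unfolding test_functions_def mem_Collect_eq by metis
qed

text \<open>Records only what the operator uses of a C^2 function of compact support: a
  second-difference bound uniform in \<open>x\<close> and already capped for large
  \<open>z\<close>.\<close>

definition compact_C2 :: "('a::euclidean_space \<Rightarrow> real) \<Rightarrow> bool" where
  "compact_C2 \<phi> \<longleftrightarrow> continuous_on UNIV \<phi> \<and> (\<exists>R. \<forall>x. R < norm x \<longrightarrow> \<phi> x = 0) \<and>
     (\<exists>C. \<forall>x z. \<bar>2 * \<phi> x - \<phi> (x + z) - \<phi> (x - z)\<bar> \<le> C * min 1 ((norm z)\<^sup>2))"

lemma frechet_derivative_eq_0:
  assumes "open S" "x \<in> S" "\<And>y. y \<in> S \<Longrightarrow> f y = (0::real)"
  shows "frechet_derivative f (at x) b = 0"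
proof -
  have "(f has_derivative (\<lambda>_. 0)) (at x)"
    by (rule has_derivative_transform_within_open[of "\<lambda>_. 0" _ _ UNIV S]) (use assms in auto)
  then show ?thesis using frechet_derivative_at by metis
qed

lemma bounded_of_compact_support:
  fixes g :: "'a::euclidean_space \<Rightarrow> real"
  assumes "continuous_on UNIV g" "compact K" "\<And>x. x \<notin> K \<Longrightarrow> g x = 0"
  obtains A where "A \<ge> 0" "\<And>x. \<bar>g x\<bar> \<le> A"
proof -
  have "compact (g ` K)" using assms by (meson compact_continuous_image continuous_on_subset subset_UNIV)
  then obtain A where A: "\<And>x. x \<in> K \<Longrightarrow> \<bar>g x\<bar> \<le> A"
    using compact_imp_bounded bounded_real by (metis imageI)
  then have "\<bar>g x\<bar> \<le> max A 0" for x using assms(3)[of x] A[of x] by (cases "x \<in> K") fastforce+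
  then show ?thesis using that[of "max A 0"] by simp
qed

lemma frechet_derivative_Basis_sum:
  fixes f :: "'a::euclidean_space \<Rightarrow> real"
  assumes "(f has_derivative f') (at x)"
  shows "f' v = (\<Sum>b\<in>Basis. (v \<bullet> b) * f' b)"
proof -
  have l: "linear f'" using assms has_derivative_linear by blast
  have "f' v = f' (\<Sum>b\<in>Basis. (v \<bullet> b) *\<^sub>R b)" by (simp add: euclidean_representation)
  also have "\<dots> = (\<Sum>b\<in>Basis. (v \<bullet> b) * f' b)"
    by (simp add: linear_sum[OF l] linear_scale[OF l])
  finally show ?thesis .
qed

lemma C1_compact_support_lipschitz:
  fixes g :: "'a::euclidean_space \<Rightarrow> real"
  assumes g: "C_times 1 g" and K: "compact K" "\<And>x. x \<notin> K \<Longrightarrow> g x = 0"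
  obtains A where "A \<ge> 0" "\<And>x y. \<bar>g x - g y\<bar> \<le> A * norm (x - y)"
proof -
  have "\<forall>b\<in>Basis. \<exists>A\<ge>0. \<forall>x. \<bar>frechet_derivative g (at x) b\<bar> \<le> A"
  proof
    fix b :: 'a assume b: "b \<in> Basis"
    have c: "continuous_on UNIV (\<lambda>x. frechet_derivative g (at x) b)" using g b by simp
    have "frechet_derivative g (at x) b = 0" if "x \<notin> K" for x
      by (rule frechet_derivative_eq_0[of "- K"]) (use K that compact_imp_closed in auto)
    then obtain A where "A \<ge> 0" "\<And>x. \<bar>frechet_derivative g (at x) b\<bar> \<le> A"
      using bounded_of_compact_support[OF c K(1)] by blast
    then show "\<exists>A\<ge>0. \<forall>x. \<bar>frechet_derivative g (at x) b\<bar> \<le> A" by blast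
  qed
  then obtain A where A: "\<And>b. b \<in> Basis \<Longrightarrow> A b \<ge> 0"
    "\<And>b x. b \<in> Basis \<Longrightarrow> \<bar>frechet_derivative g (at x) b\<bar> \<le> A b" by metis
  have d: "(g has_derivative frechet_derivative g (at x)) (at x)" for x
    using C_times_derivative g by (metis One_nat_def)
  have "onorm (frechet_derivative g (at x)) \<le> (\<Sum>b\<in>Basis. A b)" for x
  proof (rule onorm_le)
    fix v :: 'a
    have "norm (frechet_derivative g (at x) v) = \<bar>\<Sum>b\<in>Basis. (v \<bullet> b) * frechet_derivative g (at x) b\<bar>"
      using frechet_derivative_Basis_sum[OF d] by (metis real_norm_def)
    also have "\<dots> \<le> (\<Sum>b\<in>Basis. \<bar>(v \<bullet> b) * frechet_derivative g (at x) b\<bar>)" by (rule sum_abs)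
    also have "\<dots> \<le> (\<Sum>b\<in>Basis. norm v * A b)"
      using A by (intro sum_mono) (auto simp: abs_mult intro!: mult_mono Basis_le_norm)
    finally show "norm (frechet_derivative g (at x) v) \<le> (\<Sum>b\<in>Basis. A b) * norm v"
      by (simp add: sum_distrib_left mult.commute)
  qed
  then have "\<bar>g x - g y\<bar> \<le> (\<Sum>b\<in>Basis. A b) * norm (x - y)" for x y
    using differentiable_bound[of UNIV g "\<lambda>x. frechet_derivative g (at x)"] d by simp
  moreover have "(\<Sum>b\<in>Basis. A b) \<ge> 0" using A by (simp add: sum_nonneg)
  ultimately show ?thesis using that by blast
qed

lemma compact_C2I:
  fixes f :: "'a::euclidean_space \<Rightarrow> real"
  assumes f: "C_times 2 f" and K: "compact K" "\<And>x. x \<notin> K \<Longrightarrow> f x = 0"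
  shows "compact_C2 f"
proof -
  let ?g = "\<lambda>b x. frechet_derivative f (at x) b"
  have cont: "continuous_on UNIV f" using C_times_continuous[OF f] .
  have d: "(f has_derivative frechet_derivative f (at x)) (at x)" for x
    using C_times_derivative f by (metis numeral_2_eq_2)
  have "\<forall>b\<in>Basis. \<exists>A\<ge>0. \<forall>x y. \<bar>?g b x - ?g b y\<bar> \<le> A * norm (x - y)"
  proof
    fix b :: 'a assume "b \<in> Basis"
    then have c: "C_times 1 (?g b)" using f by (simp add: numeral_2_eq_2)
    have "?g b x = 0" if "x \<notin> K" for x
      by (rule frechet_derivative_eq_0[of "- K"]) (use K that compact_imp_closed in auto)
    then obtain A where "A \<ge> 0" "\<And>x y. \<bar>?g b x - ?g b y\<bar> \<le> A * norm (x - y)"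
      using C1_compact_support_lipschitz[OF c K(1)] by blast
    then show "\<exists>A\<ge>0. \<forall>x y. \<bar>?g b x - ?g b y\<bar> \<le> A * norm (x - y)" by blast
  qed
  then obtain A where A: "\<And>b. b \<in> Basis \<Longrightarrow> A b \<ge> 0"
    "\<And>b x y. b \<in> Basis \<Longrightarrow> \<bar>?g b x - ?g b y\<bar> \<le> A b * norm (x - y)" by metis
  have quad: "\<bar>2 * f x - f (x + z) - f (x - z)\<bar> \<le> (\<Sum>b\<in>Basis. 2 * A b) * (norm z)\<^sup>2" for x z
  proof -
    \<comment> \<open>\<open>?G 1 - ?G 0\<close> is minus the second difference, and
      \<open>?G'\<close> compares first derivatives at two points 2 t |z| apart. The Lipschitz
      bounds \<open>A\<close> therefore yield the factor |z|^2.\<close>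
    let ?G = "\<lambda>t::real. f (x + t *\<^sub>R z) + f (x - t *\<^sub>R z)"
    let ?G' = "\<lambda>t h. h * (frechet_derivative f (at (x + t *\<^sub>R z)) z - frechet_derivative f (at (x - t *\<^sub>R z)) z)"
    have "\<bar>?G 1 - ?G 0\<bar> \<le> ((\<Sum>b\<in>Basis. 2 * A b) * (norm z)\<^sup>2) * norm (1 - 0 :: real)"
      unfolding real_norm_def[of "?G 1 - ?G 0", symmetric]
    proof (rule differentiable_bound[of "{0..1}" ?G ?G'])
      fix t :: real assume t: "t \<in> {0..1}"
      have l: "linear (frechet_derivative f (at y))" for y using d has_derivative_linear by blast
      have "((\<lambda>t. f (x + t *\<^sub>R z)) has_derivative (\<lambda>h. frechet_derivative f (at (x + t *\<^sub>R z)) (h *\<^sub>R z))) (at t)"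
        by (rule has_derivative_compose[OF _ d]) (auto intro!: derivative_eq_intros)
      moreover have "((\<lambda>t. f (x - t *\<^sub>R z)) has_derivative (\<lambda>h. frechet_derivative f (at (x - t *\<^sub>R z)) (- (h *\<^sub>R z)))) (at t)"
        by (rule has_derivative_compose[OF _ d]) (auto intro!: derivative_eq_intros)
      ultimately have "(?G has_derivative ?G' t) (at t)"
        by (rule has_derivative_eq_rhs[OF has_derivative_add])
          (simp add: linear_scale[OF l] linear_neg[OF l] fun_eq_iff algebra_simps)
      then show "(?G has_derivative ?G' t) (at t within {0..1})"
        by (rule has_derivative_at_withinI)
      show "onorm (?G' t) \<le> (\<Sum>b\<in>Basis. 2 * A b) * (norm z)\<^sup>2"
      proof (rule onorm_le)
        fix h :: real
        have "\<bar>frechet_derivative f (at (x + t *\<^sub>R z)) z - frechet_derivative f (at (x - t *\<^sub>R z)) z\<bar>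
            = \<bar>\<Sum>b\<in>Basis. (z \<bullet> b) * (?g b (x + t *\<^sub>R z) - ?g b (x - t *\<^sub>R z))\<bar>"
          by (subst (1 2) frechet_derivative_Basis_sum[OF d]) (simp add: sum_subtractf right_diff_distrib)
        also have "\<dots> \<le> (\<Sum>b\<in>Basis. \<bar>(z \<bullet> b) * (?g b (x + t *\<^sub>R z) - ?g b (x - t *\<^sub>R z))\<bar>)"
          by (rule sum_abs)
        also have "\<dots> \<le> (\<Sum>b\<in>Basis. norm z * (A b * (2 * norm z)))"
        proof (rule sum_mono)
          fix b :: 'a assume b: "b \<in> Basis"
          have "\<bar>?g b (x + t *\<^sub>R z) - ?g b (x - t *\<^sub>R z)\<bar> \<le> A b * norm ((x + t *\<^sub>R z) - (x - t *\<^sub>R z))"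
            using A b by blast
          also have "(x + t *\<^sub>R z) - (x - t *\<^sub>R z) = (2 * t) *\<^sub>R z"
            by (simp add: algebra_simps scaleR_2[symmetric])
          also have "A b * norm ((2 * t) *\<^sub>R z) \<le> A b * (2 * norm z)"
            using t A(1)[OF b] by (intro mult_left_mono) (auto simp: mult_left_le_one_le)
          finally show "\<bar>(z \<bullet> b) * (?g b (x + t *\<^sub>R z) - ?g b (x - t *\<^sub>R z))\<bar> \<le> norm z * (A b * (2 * norm z))"
            unfolding abs_mult using b by (intro mult_mono Basis_le_norm) auto
        qed
        also have "\<dots> = (\<Sum>b\<in>Basis. 2 * A b) * (norm z)\<^sup>2"
          by (simp add: sum_distrib_left sum_distrib_right power2_eq_square mult_ac)
        finally show "norm (?G' t h) \<le> (\<Sum>b\<in>Basis. 2 * A b) * (norm z)\<^sup>2 * norm h"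
          by (simp add: abs_mult mult.commute mult_left_mono)
      qed
    qed auto
    then show ?thesis by simp
  qed
  obtain B where B: "B \<ge> 0" "\<And>x. \<bar>f x\<bar> \<le> B" using bounded_of_compact_support[OF cont K] by blast
  \<comment> \<open>\<open>4 * B\<close> handles large \<open>z\<close>, the quadratic bound small
    \<open>z\<close>.\<close>
  define C where "C = max (4 * B) (\<Sum>b\<in>Basis. 2 * A b)"
  have "C \<ge> 0" using B by (simp add: C_def)
  have "\<bar>2 * f x - f (x + z) - f (x - z)\<bar> \<le> C * min 1 ((norm z)\<^sup>2)" for x z
  proof -
    have "\<bar>2 * f x - f (x + z) - f (x - z)\<bar> \<le> C * 1"
      using B(2)[of x] B(2)[of "x + z"] B(2)[of "x - z"] by (simp add: C_def)
    moreover have "\<bar>2 * f x - f (x + z) - f (x - z)\<bar> \<le> C * (norm z)\<^sup>2"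
      by (rule order_trans[OF quad]) (intro mult_right_mono, auto simp: C_def)
    ultimately show ?thesis unfolding min_def by (simp split: if_split)
  qed
  moreover obtain R where "\<And>x. x \<in> K \<Longrightarrow> norm x \<le> R"
    using compact_imp_bounded[OF K(1)] bounded_iff by metis
  ultimately show ?thesis unfolding compact_C2_def using cont K(2) by (metis not_less)
qed

lemma test_function_compact_C2:
  assumes "\<phi> \<in> test_functions \<Omega>"
  shows "compact_C2 \<phi>"
proof (rule compact_C2I)
  show "C_times 2 \<phi>" "compact (closure {x. \<phi> x \<noteq> 0})"
    using assms unfolding test_functions_def by blast+
  show "\<phi> x = 0" if "x \<notin> closure {x. \<phi> x \<noteq> 0}" for x
    using that closure_subset[of "{x. \<phi> x \<noteq> 0}"] by auto
qed

lemma bump_compact_C2: "r > 0 \<Longrightarrow> compact_C2 (bump p r)"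
  by (rule test_function_compact_C2[OF bump_test_function[OF _ subset_UNIV]])

subsection \<open>The truncated operator\<close>

text \<open>Bounded at every point, not almost everywhere: the comparison arguments take suprema and
  use pointwise inequalities.\<close>

definition bdd_borel :: "('a::euclidean_space \<Rightarrow> real) \<Rightarrow> bool" where
  "bdd_borel f \<longleftrightarrow> f \<in> borel_measurable borel \<and> (\<exists>B. \<forall>x. \<bar>f x\<bar> \<le> B)"

lemma bdd_borelI: "f \<in> borel_measurable borel \<Longrightarrow> (\<And>x. \<bar>f x\<bar> \<le> B) \<Longrightarrow> bdd_borel f"
  by (auto simp: bdd_borel_def)

lemma bdd_borelE:
  assumes "bdd_borel f"
  obtains B where "B \<ge> 0" "\<And>x. \<bar>f x\<bar> \<le> B"
  using assms unfolding bdd_borel_def by (meson abs_ge_zero order_trans)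

lemma bdd_borel_measurable [measurable_dest]: "bdd_borel f \<Longrightarrow> f \<in> borel_measurable borel"
  by (auto simp: bdd_borel_def)

lemma bdd_borel_const [simp]: "bdd_borel (\<lambda>x. c)"
  by (auto simp: bdd_borel_def)

lemma bdd_borel_add [intro]: "bdd_borel f \<Longrightarrow> bdd_borel g \<Longrightarrow> bdd_borel (\<lambda>x. f x + g x)"
proof -
  assume f: "bdd_borel f" and g: "bdd_borel g"
  obtain B where B: "\<And>x. \<bar>f x\<bar> \<le> B" using bdd_borelE[OF f] by blast
  obtain C where C: "\<And>x. \<bar>g x\<bar> \<le> C" using bdd_borelE[OF g] by blast
  show ?thesis
    by (rule bdd_borelI[of _ "B + C"])
      (use f g order_trans[OF abs_triangle_ineq add_mono[OF B C]] in \<open>auto simp: bdd_borel_def\<close>)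
qed

lemma bdd_borel_cmult [intro]: "bdd_borel f \<Longrightarrow> bdd_borel (\<lambda>x. c * f x)"
proof -
  assume f: "bdd_borel f"
  obtain B where B: "\<And>x. \<bar>f x\<bar> \<le> B" using bdd_borelE[OF f] by blast
  show ?thesis
    by (rule bdd_borelI[of _ "\<bar>c\<bar> * B"])
      (use f B in \<open>auto simp: bdd_borel_def abs_mult intro: mult_left_mono\<close>)
qed

lemma bdd_borel_diff [intro]: "bdd_borel f \<Longrightarrow> bdd_borel g \<Longrightarrow> bdd_borel (\<lambda>x. f x - g x)"
  using bdd_borel_add[of f "\<lambda>x. - 1 * g x"] bdd_borel_cmult[of g "- 1"] by simp

lemma bdd_borel_shift [intro]: "bdd_borel f \<Longrightarrow> bdd_borel (\<lambda>x. f (x + h))"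
  unfolding bdd_borel_def by auto

lemma bdd_borel_indicator [intro]: "A \<in> sets borel \<Longrightarrow> bdd_borel (indicator A)"
  by (rule bdd_borelI[of _ 1]) (auto simp: indicator_def)

lemma compact_C2_bdd_borel: "compact_C2 \<phi> \<Longrightarrow> bdd_borel \<phi>"
proof -
  assume "compact_C2 \<phi>"
  then obtain R where c: "continuous_on UNIV \<phi>" and R: "\<And>x. R < norm x \<Longrightarrow> \<phi> x = 0"
    by (auto simp: compact_C2_def)
  obtain B where "\<And>x. \<bar>\<phi> x\<bar> \<le> B"
    using bounded_of_compact_support[OF c compact_cball[of 0 R]] R by (metis mem_cball_0 not_le)
  then show ?thesis using c by (auto intro!: bdd_borelI borel_measurable_continuous_onI)
qed

lemma compact_C2_integrable:
  assumes "compact_C2 \<phi>"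
  shows "integrable lborel \<phi>"
proof -
  obtain R where R: "\<And>x. R < norm x \<Longrightarrow> \<phi> x = 0"
    using assms by (auto simp: compact_C2_def)
  have b: "bdd_borel \<phi>" using assms by (rule compact_C2_bdd_borel)
  obtain B where B: "B \<ge> 0" "\<And>x. \<bar>\<phi> x\<bar> \<le> B" using bdd_borelE[OF b] by blast
  have [measurable]: "\<phi> \<in> borel_measurable borel" using b by (simp add: bdd_borel_def)
  show ?thesis
  proof (rule Bochner_Integration.integrable_bound)
    show "integrable lborel (\<lambda>x. B * indicator (cball 0 R) x)"
      using emeasure_bounded_finite[OF bounded_cball]
      by (intro integrable_mult_right integrable_real_indicator) auto
    show "AE x in lborel. norm (\<phi> x) \<le> norm (B * indicator (cball 0 R) x)"
      using B R by (auto simp: indicator_def not_le)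
  qed simp
qed

text \<open>Symmetrising in \<open>z\<close> cancels the linear Taylor term and leaves order |z|^2
  for smooth functions; since alpha < 2, the principal value becomes an ordinary integral.\<close>

definition second_diff :: "('a::euclidean_space \<Rightarrow> real) \<Rightarrow> 'a \<Rightarrow> 'a \<Rightarrow> real" where
  "second_diff \<phi> x z = 2 * \<phi> x - \<phi> (x + z) - \<phi> (x - z)"

section \<open>Truncated operators and their limit as the truncation is removed\<close>

context frac_order
begin

lemma integrable_trunc_mult:
  fixes f :: "'a::euclidean_space \<Rightarrow> real"
  assumes e: "\<epsilon> > 0" and f: "bdd_borel f"
  shows "integrable lborel (\<lambda>z. trunc_kernel \<alpha> \<epsilon> z * f z)"
proof -
  obtain B where B: "B \<ge> 0" "\<And>x. \<bar>f x\<bar> \<le> B" using bdd_borelE[OF f] by blast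
  note [measurable] = bdd_borel_measurable[OF f]
  show ?thesis
  proof (rule Bochner_Integration.integrable_bound)
    show "integrable lborel (\<lambda>z::'a. B * trunc_kernel \<alpha> \<epsilon> z)"
      using integrable_trunc_kernel[OF e, where 'a='a] by simp
    show "AE z in lborel. norm (trunc_kernel \<alpha> \<epsilon> z * f z) \<le> norm (B * trunc_kernel \<alpha> \<epsilon> z)"
      using B by (auto simp: abs_mult mult.commute intro!: mult_right_mono)
  qed simp
qed

lemma integrable_trunc_shift:
  assumes "\<epsilon> > 0" "bdd_borel f"
  shows "integrable lborel (\<lambda>z. trunc_kernel \<alpha> \<epsilon> z * f (x + z))"
  using integrable_trunc_mult[OF assms(1) bdd_borel_shift[OF assms(2), of x]] by (simp add: add.commute)

text \<open>The truncated kernel is integrable, so the difference splits into mass times value minus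
  a mean of shifted values. Maximum principle, iteration and lower bounds start from this
  form.\<close>

lemma trunc_lap_eq:
  fixes f :: "'a::euclidean_space \<Rightarrow> real"
  assumes "\<epsilon> > 0" "bdd_borel f"
  shows "trunc_lap \<alpha> \<epsilon> f x =
    kernel_mass TYPE('a) \<epsilon> * f x - (LINT z|lborel. trunc_kernel \<alpha> \<epsilon> z * f (x + z))"
proof -
  have "trunc_lap \<alpha> \<epsilon> f x = (LINT z|lborel. trunc_kernel \<alpha> \<epsilon> z * f x - trunc_kernel \<alpha> \<epsilon> z * f (x + z))"
    unfolding trunc_lap_def by (simp only: right_diff_distrib)
  also have "\<dots> = (LINT (z::'a)|lborel. trunc_kernel \<alpha> \<epsilon> z * f x) - (LINT z|lborel. trunc_kernel \<alpha> \<epsilon> z * f (x + z))"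
    by (intro Bochner_Integration.integral_diff integrable_trunc_shift integrable_trunc_mult assms bdd_borel_const)
  finally show ?thesis by (simp add: kernel_mass_def)
qed

lemma trunc_lap_const [simp]: "trunc_lap \<alpha> \<epsilon> (\<lambda>x. c) x = 0"
  by (simp add: trunc_lap_def)

lemma trunc_lap_add:
  assumes "\<epsilon> > 0" "bdd_borel f" "bdd_borel g"
  shows "trunc_lap \<alpha> \<epsilon> (\<lambda>x. f x + g x) x = trunc_lap \<alpha> \<epsilon> f x + trunc_lap \<alpha> \<epsilon> g x"
proof -
  have "(LINT z|lborel. trunc_kernel \<alpha> \<epsilon> z * (f (x + z) + g (x + z)))
      = (LINT z|lborel. trunc_kernel \<alpha> \<epsilon> z * f (x + z)) + (LINT z|lborel. trunc_kernel \<alpha> \<epsilon> z * g (x + z))"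
    unfolding distrib_left by (intro Bochner_Integration.integral_add integrable_trunc_shift assms)
  then show ?thesis
    by (simp add: trunc_lap_eq[OF assms(1,2)] trunc_lap_eq[OF assms(1,3)]
        trunc_lap_eq[OF assms(1) bdd_borel_add[OF assms(2,3)]] distrib_left)
qed

lemma trunc_lap_cmult: "trunc_lap \<alpha> \<epsilon> (\<lambda>x. c * f x) x = c * trunc_lap \<alpha> \<epsilon> f x"
proof -
  have "trunc_kernel \<alpha> \<epsilon> z * (c * f x - c * f (x + z)) = c * (trunc_kernel \<alpha> \<epsilon> z * (f x - f (x + z)))" for z
    by (simp add: algebra_simps)
  then show ?thesis unfolding trunc_lap_def by (simp only: integral_mult_right_zero)
qed

lemma trunc_lap_diff:
  assumes "\<epsilon> > 0" "bdd_borel f" "bdd_borel g"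
  shows "trunc_lap \<alpha> \<epsilon> (\<lambda>x. f x - g x) x = trunc_lap \<alpha> \<epsilon> f x - trunc_lap \<alpha> \<epsilon> g x"
  using trunc_lap_add[OF assms(1,2), of "\<lambda>x. - 1 * g x" x] trunc_lap_cmult[of \<epsilon> "- 1" g x]
    bdd_borel_cmult[OF assms(3), of "- 1"] by simp

lemma trunc_lap_shift: "trunc_lap \<alpha> \<epsilon> (\<lambda>x. f (x + h)) x = trunc_lap \<alpha> \<epsilon> f (x + h)"
  by (simp add: trunc_lap_def add_ac)

text \<open>The kernel is even, so averaging over \<open>z\<close> and \<open>- z\<close> changes
  nothing; this makes bounds independent of \<epsilon> possible.\<close>

lemma trunc_lap_second_diff:
  assumes e: "\<epsilon> > 0" and f: "bdd_borel f"
  shows "trunc_lap \<alpha> \<epsilon> f x = (LINT z|lborel. trunc_kernel \<alpha> \<epsilon> z * second_diff f x z) / 2"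
proof -
  note [measurable] = bdd_borel_measurable[OF f]
  let ?g = "\<lambda>z. trunc_kernel \<alpha> \<epsilon> z * (f x - f (x + z))"
  have i: "integrable lborel ?g"
    unfolding right_diff_distrib
    by (intro Bochner_Integration.integrable_diff integrable_trunc_shift integrable_trunc_mult e f bdd_borel_const)
  then have i': "integrable lborel (\<lambda>z. ?g (- z))" by (subst lborel_integrable_minus) auto
  have "2 * trunc_lap \<alpha> \<epsilon> f x = (LINT z|lborel. ?g z) + (LINT z|lborel. ?g (- z))"
    by (subst lborel_integral_minus) (auto simp: trunc_lap_def)
  also have "\<dots> = (LINT z|lborel. ?g z + ?g (- z))" using i i' by simp
  also have "\<dots> = (LINT z|lborel. trunc_kernel \<alpha> \<epsilon> z * second_diff f x z)"
    by (intro Bochner_Integration.integral_cong) (auto simp: second_diff_def algebra_simps)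
  finally show ?thesis by simp
qed

lemma second_diff_measurable [measurable]:
  assumes "f \<in> borel_measurable borel"
  shows "second_diff f x \<in> borel_measurable borel"
  using assms unfolding second_diff_def by measurable

text \<open>The majorant uses the full kernel, so the bound holds for all truncations at
  once.\<close>

lemma trunc_lap_abs_le:
  assumes e: "\<epsilon> > 0" and f: "bdd_borel f"
    and F: "integrable lborel (\<lambda>z. frac_kernel \<alpha> z * F z)" "\<And>z. \<bar>second_diff f x z\<bar> \<le> F z"
  shows "\<bar>trunc_lap \<alpha> \<epsilon> f x\<bar> \<le> (LINT z|lborel. frac_kernel \<alpha> z * F z) / 2"
proof -
  note [measurable] = bdd_borel_measurable[OF f]
  have le: "\<bar>trunc_kernel \<alpha> \<epsilon> z * second_diff f x z\<bar> \<le> frac_kernel \<alpha> z * F z" for z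
    using F(2)[of z] order_trans[OF abs_ge_zero F(2)[of z]]
    by (auto simp: trunc_kernel_def abs_mult intro: mult_left_mono)
  have "integrable lborel (\<lambda>z. trunc_kernel \<alpha> \<epsilon> z * second_diff f x z)"
    by (rule Bochner_Integration.integrable_bound[OF F(1)])
      (auto intro!: always_eventually order_trans[OF le])
  then have "\<bar>LINT z|lborel. trunc_kernel \<alpha> \<epsilon> z * second_diff f x z\<bar> \<le> (LINT z|lborel. frac_kernel \<alpha> z * F z)"
    by (intro order_trans[OF integral_abs_bound] integral_mono le F(1)) auto
  then show ?thesis unfolding trunc_lap_second_diff[OF e f] by simp
qed

text \<open>The principal value up to its constant, for functions satisfying
  \<open>compact_C2\<close>, written as an absolutely convergent integral.\<close>

definition frac_lim :: "('a::euclidean_space \<Rightarrow> real) \<Rightarrow> 'a \<Rightarrow> real" where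
  "frac_lim \<phi> x = (LINT z|lborel. frac_kernel \<alpha> z * second_diff \<phi> x z) / 2"

lemma compact_C2_trunc_lap_bound:
  fixes \<phi> :: "'a::euclidean_space \<Rightarrow> real"
  assumes "compact_C2 \<phi>"
  obtains C where "C \<ge> 0" "\<And>\<epsilon> x. \<epsilon> > 0 \<Longrightarrow> \<bar>trunc_lap \<alpha> \<epsilon> \<phi> x\<bar> \<le> C"
proof -
  obtain C where C: "\<And>x z. \<bar>second_diff \<phi> x z\<bar> \<le> C * min 1 ((norm z)\<^sup>2)"
    using assms by (auto simp: compact_C2_def second_diff_def)
  have i: "integrable lborel (\<lambda>z::'a. frac_kernel \<alpha> z * (C * min 1 ((norm z)\<^sup>2)))"
    using integrable_mult_right[OF integrable_min_kernel[where 'a='a], of C] unfolding min_kernel_def by (simp only: mult_ac)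
  have "\<bar>trunc_lap \<alpha> \<epsilon> \<phi> x\<bar> \<le> (LINT (z::'a)|lborel. frac_kernel \<alpha> z * (C * min 1 ((norm z)\<^sup>2))) / 2"
    if "\<epsilon> > 0" for \<epsilon> x
    by (rule trunc_lap_abs_le[OF that compact_C2_bdd_borel[OF assms] i C])
  then show ?thesis using that by (meson abs_ge_zero order_trans zero_less_one)
qed

text \<open>Every bump is a rescaled translate of \<open>bump 0 1\<close>, so one constant serves
  all centres, radii and truncations, and homogeneity produces
  \<open>r powr (- \<alpha>)\<close>.\<close>

lemma bump_trunc_lap_bound:
  obtains C where "C > 0"
    "\<And>p r \<epsilon> x. \<epsilon> > 0 \<Longrightarrow> r > 0 \<Longrightarrow> \<bar>trunc_lap \<alpha> \<epsilon> (bump p r) (x::'a::euclidean_space)\<bar> \<le> C * r powr (- \<alpha>)"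
proof -
  have "compact_C2 (bump (0::'a) 1)" by (simp add: bump_compact_C2)
  then obtain C where C: "\<And>x z. \<bar>second_diff (bump (0::'a) 1) x z\<bar> \<le> C * min 1 ((norm z)\<^sup>2)"
    by (auto simp: compact_C2_def second_diff_def)
  define F :: "'a \<Rightarrow> real" where "F z = C * min 1 ((norm z)\<^sup>2)" for z
  have [measurable]: "F \<in> borel_measurable borel" unfolding F_def by measurable
  have i: "integrable lborel (\<lambda>z. frac_kernel \<alpha> z * F z)"
    using integrable_mult_right[OF integrable_min_kernel[where 'a='a], of C]
    unfolding min_kernel_def F_def by (simp only: mult_ac)
  define I where "I = (LINT z|lborel. frac_kernel \<alpha> z * F z) / 2"
  have "\<bar>trunc_lap \<alpha> \<epsilon> (bump p r) x\<bar> \<le> r powr (- \<alpha>) * I" if "\<epsilon> > 0" "r > 0" for p x :: 'a and r \<epsilon>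
  proof -
    have "\<bar>second_diff (bump p r) x z\<bar> \<le> F ((1 / r) *\<^sub>R z)" for z
    proof -
      have "second_diff (bump p r) x z = second_diff (bump 0 1) ((1 / r) *\<^sub>R (x - p)) ((1 / r) *\<^sub>R z)"
        unfolding second_diff_def bump_rescale[of p r] by (simp add: algebra_simps)
      then show ?thesis using C F_def by metis
    qed
    then have "\<bar>trunc_lap \<alpha> \<epsilon> (bump p r) x\<bar> \<le> (LINT z|lborel. frac_kernel \<alpha> z * F ((1 / r) *\<^sub>R z)) / 2"
      by (intro trunc_lap_abs_le that compact_C2_bdd_borel bump_compact_C2 integrable_frac_kernel_scale i) auto
    also have "\<dots> = r powr (- \<alpha>) * I"
      using integral_frac_kernel_scale[of F r] that by (simp add: I_def)
    finally show ?thesis .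
  qed
  \<comment> \<open>Adding 1 makes the constant strictly positive; it is divided by later.\<close>
  then have "\<bar>trunc_lap \<alpha> \<epsilon> (bump p r) x\<bar> \<le> (\<bar>I\<bar> + 1) * r powr (- \<alpha>)"
    if "\<epsilon> > 0" "r > 0" for p x :: 'a and r \<epsilon>
    by (rule order_trans) (use that in \<open>auto simp: mult.commute intro!: mult_left_mono\<close>)
  then show ?thesis by (intro that[of "\<bar>I\<bar> + 1"]) auto
qed

lemma trunc_lap_tendsto:
  fixes \<phi> :: "'a::euclidean_space \<Rightarrow> real"
  assumes \<phi>: "compact_C2 \<phi>" and e: "\<And>n. \<epsilon> n > 0" "\<epsilon> \<longlonglongrightarrow> 0"
  shows "(\<lambda>n. trunc_lap \<alpha> (\<epsilon> n) \<phi> x) \<longlonglongrightarrow> frac_lim \<phi> x"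
proof -
  note b = compact_C2_bdd_borel[OF \<phi>]
  note [measurable] = bdd_borel_measurable[OF b]
  obtain C where C: "\<And>x z. \<bar>second_diff \<phi> x z\<bar> \<le> C * min 1 ((norm z)\<^sup>2)"
    using \<phi> by (auto simp: compact_C2_def second_diff_def)
  have "(\<lambda>n. LINT z|lborel. trunc_kernel \<alpha> (\<epsilon> n) z * second_diff \<phi> x z)
      \<longlonglongrightarrow> (LINT z|lborel. frac_kernel \<alpha> z * second_diff \<phi> x z)"
  proof (rule integral_dominated_convergence)
    show "integrable lborel (\<lambda>z::'a. C * min_kernel z)" using integrable_min_kernel[where 'a='a] by simp
    show "AE z in lborel. (\<lambda>n. trunc_kernel \<alpha> (\<epsilon> n) z * second_diff \<phi> x z)
        \<longlonglongrightarrow> frac_kernel \<alpha> z * second_diff \<phi> x z"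
    proof (intro always_eventually allI)
      fix z :: 'a
      show "(\<lambda>n. trunc_kernel \<alpha> (\<epsilon> n) z * second_diff \<phi> x z) \<longlonglongrightarrow> frac_kernel \<alpha> z * second_diff \<phi> x z"
      \<comment> \<open>Away from 0 the sequence is eventually constant; at 0 the second difference
        vanishes.\<close>
      proof (cases "z = 0")
        case False
        then have "\<forall>\<^sub>F n in sequentially. \<epsilon> n < norm z"
          by (intro order_tendstoD(2)[OF e(2)]) auto
        then show ?thesis
          by (intro tendsto_eventually, elim eventually_mono) (simp add: trunc_kernel_def)
      qed (simp add: second_diff_def)
    qed
    have "\<bar>trunc_kernel \<alpha> (\<epsilon> n) z * second_diff \<phi> x z\<bar> \<le> frac_kernel \<alpha> z * (C * min 1 ((norm z)\<^sup>2))" for n z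
      unfolding abs_mult by (rule mult_mono[OF _ C]) (auto simp: trunc_kernel_def)
    then show "AE z in lborel. norm (trunc_kernel \<alpha> (\<epsilon> n) z * second_diff \<phi> x z) \<le> C * min_kernel z" for n
      by (simp add: min_kernel_def mult_ac)
  qed simp_all
  then show ?thesis unfolding frac_lim_def trunc_lap_second_diff[OF e(1) b]
    by (intro tendsto_divide) auto
qed

text \<open>\<open>Lim\<close> is a choice operator, so the limit must be shown to exist before the
  definition says anything; testing along sequences suffices.\<close>

lemma frac_lap_eq:
  fixes \<phi> :: "'a::euclidean_space \<Rightarrow> real"
  assumes "compact_C2 \<phi>"
  shows "frac_lap \<alpha> \<phi> x = frac_const DIM('a) \<alpha> * frac_lim \<phi> x"
proof -
  note [measurable] = bdd_borel_measurable[OF compact_C2_bdd_borel[OF assms]]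
  have eq: "(LINT y:{y. norm (x - y) > \<epsilon>}|lborel. (\<phi> x - \<phi> y) / norm (x - y) powr (real DIM('a) + \<alpha>))
      = trunc_lap \<alpha> \<epsilon> \<phi> x" for \<epsilon>
  proof -
    let ?f = "\<lambda>y. indicator {y. norm (x - y) > \<epsilon>} y *\<^sub>R ((\<phi> x - \<phi> y) / norm (x - y) powr (real DIM('a) + \<alpha>))"
    have "?f = (\<lambda>y. if norm (x - y) > \<epsilon> then (\<phi> x - \<phi> y) / norm (x - y) powr (real DIM('a) + \<alpha>) else 0)"
      by auto
    then have "?f \<in> borel_measurable borel" by simp
    then have "(LINT y|lborel. ?f y) = (LINT z|lborel. ?f (x + z))"
      by (rule lborel_integral_shift[symmetric])
    also have "\<dots> = trunc_lap \<alpha> \<epsilon> \<phi> x"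
      unfolding trunc_lap_def by (rule Bochner_Integration.integral_cong)
        (auto simp: trunc_kernel_def frac_kernel_def indicator_def)
    finally show ?thesis by (simp add: set_lebesgue_integral_def)
  qed
  have "((\<lambda>\<epsilon>. trunc_lap \<alpha> \<epsilon> \<phi> x) \<longlongrightarrow> frac_lim \<phi> x) (at_right 0)"
    unfolding tendsto_at_iff_sequentially
    using trunc_lap_tendsto[OF assms] by (auto simp: comp_def)
  then have "Lim (at_right 0) (\<lambda>\<epsilon>. trunc_lap \<alpha> \<epsilon> \<phi> x) = frac_lim \<phi> x"
    by (intro tendsto_Lim) auto
  then show ?thesis unfolding frac_lap_def eq by simp
qed

lemma frac_const_pos: "N > 0 \<Longrightarrow> frac_const N \<alpha> > 0"
  unfolding frac_const_def using alpha_pos alpha_less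
  by (intro divide_pos_pos mult_pos_pos Gamma_real_pos) auto

text \<open>The constant is positive, so it drops out and the later work concerns
  \<open>frac_lim\<close> alone.\<close>

lemma frac_lap_distr_eq_0_iff:
  fixes \<phi> :: "'a::euclidean_space \<Rightarrow> real"
  assumes "compact_C2 \<phi>"
  shows "frac_lap_distr \<alpha> u \<phi> = 0 \<longleftrightarrow> (LINT x|lborel. u x * frac_lim \<phi> x) = 0"
proof -
  have "u x * (frac_const DIM('a) \<alpha> * frac_lim \<phi> x) = frac_const DIM('a) \<alpha> * (u x * frac_lim \<phi> x)" for x
    by simp
  then have "frac_lap_distr \<alpha> u \<phi> = frac_const DIM('a) \<alpha> * (LINT x|lborel. u x * frac_lim \<phi> x)"
    unfolding frac_lap_distr_def frac_lap_eq[OF assms] by (simp only: integral_mult_right_zero)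
  then show ?thesis using frac_const_pos[of "DIM('a)"] by simp
qed

section \<open>Fubini and the symmetry of the truncated operator\<close>

lemma integrable_convolution_pair:
  fixes k h \<phi> :: "'a::euclidean_space \<Rightarrow> real"
  assumes k: "integrable lborel k" and h: "bdd_borel h"
    and \<phi>: "integrable lborel \<phi>" "\<phi> \<in> borel_measurable borel"
  shows "integrable (lborel \<Otimes>\<^sub>M lborel) (\<lambda>(z, x). k z * (h x * \<phi> (x + z)))"
    and "integrable (lborel \<Otimes>\<^sub>M lborel) (\<lambda>(z, x). k z * (\<phi> x * h (x + z)))"
proof -
  obtain B where B: "B \<ge> 0" "\<And>x. \<bar>h x\<bar> \<le> B" using bdd_borelE[OF h] by blast
  note [measurable] = bdd_borel_measurable[OF h] \<phi>(2)
  have [measurable]: "k \<in> borel_measurable borel" using k by auto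
  have sh: "integrable lborel (\<lambda>x. \<phi> (x + z))" "(LINT x|lborel. \<bar>\<phi> (x + z)\<bar>) = (LINT x|lborel. \<bar>\<phi> x\<bar>)" for z
    using lborel_integrable_shift[OF \<phi>(2), of z] \<phi>(1)
      lborel_integral_shift[of "\<lambda>x. \<bar>\<phi> x\<bar>" z] by (auto simp: add.commute)
  \<comment> \<open>Tonelli: all translates of \<open>\<phi>\<close> have the same L^1 norm, so the
    iterated integral is a product. The bounded factor \<open>h\<close> is put back by
    domination.\<close>
  have "integrable (lborel \<Otimes>\<^sub>M lborel) (\<lambda>p. k (fst p) * (\<phi> (snd p + fst p)))"
  proof (rule lborel_pair.Fubini_integrable)
    have "integrable lborel (\<lambda>z. \<bar>k z\<bar> * (LINT x|lborel. \<bar>\<phi> x\<bar>))" using k by simp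
    then show "integrable lborel (\<lambda>x. LINT y|lborel. norm (k (fst (x, y)) * (\<phi> (snd (x, y) + fst (x, y)))))"
      by (simp add: abs_mult sh)
    show "AE x in lborel. integrable lborel (\<lambda>y. k (fst (x, y)) * (\<phi> (snd (x, y) + fst (x, y))))"
      using sh by simp
  qed measurable
  then have "integrable (lborel \<Otimes>\<^sub>M lborel) (\<lambda>p. B * (k (fst p) * (\<phi> (snd p + fst p))))" by simp
  then show "integrable (lborel \<Otimes>\<^sub>M lborel) (\<lambda>(z, x). k z * (h x * \<phi> (x + z)))"
  proof (rule Bochner_Integration.integrable_bound)
    have "\<bar>k z\<bar> * (\<bar>h x\<bar> * \<bar>\<phi> (x + z)\<bar>) \<le> B * (\<bar>k z\<bar> * \<bar>\<phi> (x + z)\<bar>)" for x z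
      using mult_right_mono[OF B(2)[of x], of "\<bar>k z\<bar> * \<bar>\<phi> (x + z)\<bar>"] by (simp add: mult_ac)
    then show "AE x in lborel \<Otimes>\<^sub>M lborel. norm (case x of (z, x) \<Rightarrow> k z * (h x * \<phi> (x + z)))
        \<le> norm (B * (k (fst x) * \<phi> (snd x + fst x)))"
      using B(1) by (auto simp: abs_mult)
  qed measurable
  have "integrable (lborel \<Otimes>\<^sub>M lborel) (\<lambda>p. k (fst p) * (\<phi> (snd p)))"
  proof (rule lborel_pair.Fubini_integrable)
    have "integrable lborel (\<lambda>z. \<bar>k z\<bar> * (LINT x|lborel. \<bar>\<phi> x\<bar>))" using k by simp
    then show "integrable lborel (\<lambda>x. LINT y|lborel. norm (k (fst (x, y)) * (\<phi> (snd (x, y)))))"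
      by (simp add: abs_mult)
    show "AE x in lborel. integrable lborel (\<lambda>y. k (fst (x, y)) * (\<phi> (snd (x, y))))"
      using \<phi> by simp
  qed measurable
  then have "integrable (lborel \<Otimes>\<^sub>M lborel) (\<lambda>p. B * (k (fst p) * (\<phi> (snd p))))" by simp
  then show "integrable (lborel \<Otimes>\<^sub>M lborel) (\<lambda>(z, x). k z * (\<phi> x * h (x + z)))"
  proof (rule Bochner_Integration.integrable_bound)
    have "\<bar>k z\<bar> * (\<bar>\<phi> x\<bar> * \<bar>h (x + z)\<bar>) \<le> B * (\<bar>k z\<bar> * \<bar>\<phi> x\<bar>)" for x z
      using mult_right_mono[OF B(2)[of "x + z"], of "\<bar>k z\<bar> * \<bar>\<phi> x\<bar>"] by (simp add: mult_ac)
    then show "AE x in lborel \<Otimes>\<^sub>M lborel. norm (case x of (z, x) \<Rightarrow> k z * (\<phi> x * h (x + z)))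
        \<le> norm (B * (k (fst x) * \<phi> (snd x)))"
      using B(1) by (auto simp: abs_mult)
  qed measurable
qed

lemma
  fixes h \<phi> :: "'a::euclidean_space \<Rightarrow> real"
  assumes e: "\<epsilon> > 0" and h: "bdd_borel h" and \<phi>: "integrable lborel \<phi>" "\<phi> \<in> borel_measurable borel"
  shows convolution_swap: "(LINT x|lborel. h x * (LINT z|lborel. trunc_kernel \<alpha> \<epsilon> z * \<phi> (x + z)))
      = (LINT z|lborel. trunc_kernel \<alpha> \<epsilon> z * (LINT x|lborel. h x * \<phi> (x + z)))"
    and convolution_swap': "(LINT x|lborel. \<phi> x * (LINT z|lborel. trunc_kernel \<alpha> \<epsilon> z * h (x + z)))
      = (LINT z|lborel. trunc_kernel \<alpha> \<epsilon> z * (LINT x|lborel. \<phi> x * h (x + z)))"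
    and integrable_convolution: "integrable lborel (\<lambda>x. LINT z|lborel. trunc_kernel \<alpha> \<epsilon> z * \<phi> (x + z))"
proof -
  note p = integrable_convolution_pair[OF integrable_trunc_kernel[OF e] h \<phi>]
  show "(LINT x|lborel. h x * (LINT z|lborel. trunc_kernel \<alpha> \<epsilon> z * \<phi> (x + z)))
      = (LINT z|lborel. trunc_kernel \<alpha> \<epsilon> z * (LINT x|lborel. h x * \<phi> (x + z)))"
    using lborel_pair.Fubini_integral[OF p(1)]
    by (simp only: integral_mult_right_zero[symmetric] mult.left_commute[of "h _"])
  show "(LINT x|lborel. \<phi> x * (LINT z|lborel. trunc_kernel \<alpha> \<epsilon> z * h (x + z)))
      = (LINT z|lborel. trunc_kernel \<alpha> \<epsilon> z * (LINT x|lborel. \<phi> x * h (x + z)))"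
    using lborel_pair.Fubini_integral[OF p(2)]
    by (simp only: integral_mult_right_zero[symmetric] mult.left_commute[of "\<phi> _"])
  show "integrable lborel (\<lambda>x. LINT z|lborel. trunc_kernel \<alpha> \<epsilon> z * \<phi> (x + z))"
    using lborel_pair.integrable_snd[OF integrable_convolution_pair(1)[OF integrable_trunc_kernel[OF e] bdd_borel_const[of 1] \<phi>]]
    by simp
qed

lemma trunc_lap_symmetric:
  fixes f \<phi> :: "'a::euclidean_space \<Rightarrow> real"
  assumes e: "\<epsilon> > 0" and f: "bdd_borel f" and \<phi>: "integrable lborel \<phi>" "bdd_borel \<phi>"
  shows "(LINT x|lborel. f x * trunc_lap \<alpha> \<epsilon> \<phi> x) = (LINT x|lborel. \<phi> x * trunc_lap \<alpha> \<epsilon> f x)"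
proof -
  let ?k = "trunc_kernel \<alpha> \<epsilon> :: 'a \<Rightarrow> real"
  note m [measurable] = bdd_borel_measurable[OF f] bdd_borel_measurable[OF \<phi>(2)]
  have mult_int: "integrable lborel (\<lambda>x. h x * \<psi> x)"
    if h: "bdd_borel h" and psi: "integrable lborel \<psi>" for h \<psi> :: "'a \<Rightarrow> real"
  proof -
    obtain B where B: "B \<ge> 0" "\<And>x. \<bar>h x\<bar> \<le> B" using bdd_borelE[OF h] by blast
    note [measurable] = bdd_borel_measurable[OF h]
    show ?thesis
      by (rule Bochner_Integration.integrable_bound[OF integrable_mult_right[OF psi, of B]])
        (use B psi in \<open>auto simp: abs_mult intro!: mult_right_mono\<close>)
  qed
  have i1: "integrable lborel (\<lambda>x. f x * \<phi> x)" by (rule mult_int[OF f \<phi>(1)])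
  have i2: "integrable lborel (\<lambda>x. f x * (LINT z|lborel. ?k z * \<phi> (x + z)))"
    by (rule mult_int[OF f integrable_convolution[OF e f \<phi>(1) m(2)]])
  have i3: "integrable lborel (\<lambda>x. \<phi> x * (LINT z|lborel. ?k z * f (x + z)))"
    using lborel_pair.integrable_snd[OF integrable_convolution_pair(2)[OF integrable_trunc_kernel[OF e] f \<phi>(1) m(2)]]
    by (simp add: mult.left_commute[of "?k _"])
  have "(LINT x|lborel. f x * trunc_lap \<alpha> \<epsilon> \<phi> x) = kernel_mass TYPE('a) \<epsilon> * (LINT x|lborel. f x * \<phi> x)
      - (LINT x|lborel. f x * (LINT z|lborel. ?k z * \<phi> (x + z)))"
  proof -
    have "(LINT x|lborel. f x * trunc_lap \<alpha> \<epsilon> \<phi> x) = (LINT x|lborel. kernel_mass TYPE('a) \<epsilon> * (f x * \<phi> x)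
        - f x * (LINT z|lborel. ?k z * \<phi> (x + z)))"
      by (intro Bochner_Integration.integral_cong) (simp_all add: trunc_lap_eq[OF e \<phi>(2)] algebra_simps)
    then show ?thesis using i1 i2 by simp
  qed
  also have "(LINT x|lborel. f x * (LINT z|lborel. ?k z * \<phi> (x + z)))
      = (LINT z|lborel. ?k z * (LINT x|lborel. f x * \<phi> (x + z)))"
    by (rule convolution_swap[OF e f \<phi>(1) m(2)])
  \<comment> \<open>The reflection of \<open>z\<close> uses that the kernel is even; the shift of
    \<open>x\<close> by \<open>z\<close> then moves the translation from \<open>\<phi>\<close> to
    \<open>f\<close>.\<close>
  also have "(LINT z|lborel. ?k z * (LINT x|lborel. f x * \<phi> (x + z)))
      = (LINT z|lborel. ?k (- z) * (LINT x|lborel. f x * \<phi> (x + - z)))"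
    by (rule lborel_integral_minus[symmetric]) measurable
  also have "\<dots> = (LINT z|lborel. ?k z * (LINT x|lborel. \<phi> x * f (x + z)))"
  proof (rule Bochner_Integration.integral_cong[OF refl])
    fix z :: 'a
    have "(LINT x|lborel. f x * \<phi> (x + - z)) = (LINT x|lborel. f (z + x) * \<phi> (z + x + - z))"
      by (rule lborel_integral_shift[symmetric]) measurable
    then show "?k (- z) * (LINT x|lborel. f x * \<phi> (x + - z)) = ?k z * (LINT x|lborel. \<phi> x * f (x + z))"
      by (simp add: add.commute mult.commute)
  qed
  also have "\<dots> = (LINT x|lborel. \<phi> x * (LINT z|lborel. ?k z * f (x + z)))"
    by (rule convolution_swap'[OF e f \<phi>(1) m(2), symmetric])
  also have "kernel_mass TYPE('a) \<epsilon> * (LINT x|lborel. f x * \<phi> x) - \<dots> = (LINT x|lborel. \<phi> x * trunc_lap \<alpha> \<epsilon> f x)"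
  proof -
    have "(LINT x|lborel. \<phi> x * trunc_lap \<alpha> \<epsilon> f x) = (LINT x|lborel. kernel_mass TYPE('a) \<epsilon> * (f x * \<phi> x)
        - \<phi> x * (LINT z|lborel. ?k z * f (x + z)))"
      by (intro Bochner_Integration.integral_cong) (simp_all add: trunc_lap_eq[OF e f] algebra_simps)
    then show ?thesis using i1 i3 by simp
  qed
  finally show ?thesis .
qed

text \<open>Near the support the uniform bound \<open>C\<close> suffices. For |x| > R + 1,
  \<open>\<phi>\<close> vanishes at \<open>x\<close> and every contributing \<open>z\<close> has |z|
  > 1, so all truncations with \<epsilon> <= 1 act like the one at 1, whose convolution with
  |\<open>\<phi>\<close>| is integrable.\<close>

lemma trunc_lap_dominated:
  fixes \<phi> :: "'a::euclidean_space \<Rightarrow> real"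
  assumes \<phi>: "compact_C2 \<phi>"
  obtains w where "integrable lborel w" "\<And>\<epsilon> x. 0 < \<epsilon> \<Longrightarrow> \<epsilon> \<le> 1 \<Longrightarrow> \<bar>trunc_lap \<alpha> \<epsilon> \<phi> x\<bar> \<le> w x"
proof -
  note b = compact_C2_bdd_borel[OF \<phi>]
  note [measurable] = bdd_borel_measurable[OF b]
  obtain R where R: "\<And>x. R < norm x \<Longrightarrow> \<phi> x = 0" using \<phi> by (auto simp: compact_C2_def)
  obtain C where C: "C \<ge> 0" "\<And>\<epsilon> x. \<epsilon> > 0 \<Longrightarrow> \<bar>trunc_lap \<alpha> \<epsilon> \<phi> x\<bar> \<le> C"
    using compact_C2_trunc_lap_bound[OF \<phi>] by blast
  define w2 where "w2 x = (LINT z|lborel. trunc_kernel \<alpha> 1 z * \<bar>\<phi> (x + z)\<bar>)" for x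
  define w where "w x = C * indicator (cball 0 (R + 1)) x + w2 x" for x
  have b': "bdd_borel (\<lambda>x. \<bar>\<phi> x\<bar>)" using b by (auto simp: bdd_borel_def)
  have "integrable lborel w2" unfolding w2_def
    using compact_C2_integrable[OF \<phi>] by (intro integrable_convolution[OF _ bdd_borel_const[of 0]]) auto
  then have w: "integrable lborel w" unfolding w_def
    using emeasure_bounded_finite[OF bounded_cball]
    by (intro Bochner_Integration.integrable_add integrable_mult_right integrable_real_indicator) auto
  have "w2 x \<ge> 0" for x unfolding w2_def by (intro integral_nonneg_AE) auto
  moreover have "\<bar>trunc_lap \<alpha> \<epsilon> \<phi> x\<bar> \<le> w2 x" if e: "0 < \<epsilon>" "\<epsilon> \<le> 1" and x: "norm x > R + 1" for \<epsilon> x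
  proof -
    have "\<phi> x = 0" using R x by simp
    have eq: "trunc_kernel \<alpha> \<epsilon> z * (\<phi> x - \<phi> (x + z)) = - (trunc_kernel \<alpha> 1 z * \<phi> (x + z))" for z
    proof (cases "R < norm (x + z)")
      case False
      then have "norm z > 1" using norm_triangle_ineq4[of "x + z" z] x by auto
      then show ?thesis using e \<open>\<phi> x = 0\<close> by (simp add: trunc_kernel_def)
    qed (simp add: R \<open>\<phi> x = 0\<close>)
    have "\<bar>trunc_lap \<alpha> \<epsilon> \<phi> x\<bar> = \<bar>LINT z|lborel. trunc_kernel \<alpha> 1 z * \<phi> (x + z)\<bar>"
      by (simp add: trunc_lap_def eq)
    also have "\<dots> \<le> (LINT z|lborel. \<bar>trunc_kernel \<alpha> 1 z * \<phi> (x + z)\<bar>)" by (rule integral_abs_bound)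
    finally show ?thesis by (simp add: w2_def abs_mult)
  qed
  ultimately have "\<bar>trunc_lap \<alpha> \<epsilon> \<phi> x\<bar> \<le> w x" if "0 < \<epsilon>" "\<epsilon> \<le> 1" for \<epsilon> x
    using C(2)[of \<epsilon> x] C(1) that
    by (cases "norm x \<le> R + 1") (auto simp: w_def intro: add_increasing2 add_increasing)
  then show ?thesis using that w by blast
qed

text \<open>Function and truncation vary together, so that the existence proof can pass to the limit
  along solutions of the truncated problems; constant sequences serve the maximum
  principles.\<close>

lemma frac_lim_integral_tendsto:
  fixes \<phi> :: "'a::euclidean_space \<Rightarrow> real"
  assumes \<phi>: "compact_C2 \<phi>" and e: "\<And>n. 0 < \<epsilon> n" "\<And>n. \<epsilon> n \<le> 1" "\<epsilon> \<longlonglongrightarrow> 0"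
    and f: "\<And>n. f n \<in> borel_measurable borel" "\<And>n x. \<bar>f n x\<bar> \<le> B"
    and lim: "\<And>x. (\<lambda>n. f n x) \<longlonglongrightarrow> g x"
  shows "(\<lambda>n. LINT x|lborel. f n x * trunc_lap \<alpha> (\<epsilon> n) \<phi> x) \<longlonglongrightarrow> (LINT x|lborel. g x * frac_lim \<phi> x)"
proof -
  note [measurable] = bdd_borel_measurable[OF compact_C2_bdd_borel[OF \<phi>]] f(1)
  have [measurable]: "g \<in> borel_measurable borel"
    by (rule borel_measurable_LIMSEQ_real[OF lim]) simp
  have [measurable]: "frac_lim \<phi> \<in> borel_measurable borel"
    by (rule borel_measurable_LIMSEQ_real[OF trunc_lap_tendsto[OF \<phi> e(1) e(3)]]) simp
  obtain w where w: "integrable lborel w" "\<And>\<epsilon> x. 0 < \<epsilon> \<Longrightarrow> \<epsilon> \<le> 1 \<Longrightarrow> \<bar>trunc_lap \<alpha> \<epsilon> \<phi> x\<bar> \<le> w x"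
    using trunc_lap_dominated[OF \<phi>] by blast
  show ?thesis
  proof (rule integral_dominated_convergence)
    show "integrable lborel (\<lambda>x. B * w x)" using w by simp
    show "AE x in lborel. norm (f n x * trunc_lap \<alpha> (\<epsilon> n) \<phi> x) \<le> B * w x" for n
      using f(2) w(2)[OF e(1) e(2)]
      by (auto simp: abs_mult intro!: always_eventually mult_mono) (meson abs_ge_zero order_trans)
    show "AE x in lborel. (\<lambda>n. f n x * trunc_lap \<alpha> (\<epsilon> n) \<phi> x) \<longlonglongrightarrow> g x * frac_lim \<phi> x"
      using lim trunc_lap_tendsto[OF \<phi> e(1) e(3)] by (auto intro!: tendsto_mult)
  qed measurable
qed

subsection \<open>The Dirichlet problem for the truncated operator\<close>

text \<open>\<open>w\<close> need not attain its supremum M, so a quantitative gain replaces the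
  maximum point: from every point of \<open>U\<close> at least the mass \<open>d\<close> of the
  kernel lands outside \<open>U\<close>, where \<open>w\<close> is at most 0. On \<open>U\<close>
  the values thus stay below M (K - d) / K, which is less than M.\<close>

lemma trunc_max_principle:
  fixes w :: "'a::euclidean_space \<Rightarrow> real"
  assumes e: "\<epsilon> > 0" and w: "bdd_borel w" and U: "bounded U"
    and out: "\<And>x. x \<notin> U \<Longrightarrow> w x \<le> 0" and sub: "\<And>x. x \<in> U \<Longrightarrow> trunc_lap \<alpha> \<epsilon> w x \<le> 0"
  shows "w y \<le> 0"
proof (rule ccontr)
  assume "\<not> w y \<le> 0"
  obtain B where B: "\<And>x. \<bar>w x\<bar> \<le> B" using bdd_borelE[OF w] by blast
  define M where "M = (SUP x. w x)"
  have bdd: "bdd_above (range w)" using B by (intro bdd_aboveI[of _ B]) (auto simp: abs_le_iff)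
  have M: "w x \<le> M" for x unfolding M_def by (rule cSUP_upper[OF UNIV_I bdd])
  have "M > 0" using M[of y] \<open>\<not> w y \<le> 0\<close> by simp
  obtain R where R: "R > 0" "\<And>x. x \<in> U \<Longrightarrow> norm x \<le> R" using U bounded_pos by metis
  \<comment> \<open>From any point of \<open>U\<close>, jumps longer than 2 R leave the ball of
    radius R about 0; taking at least \<epsilon> makes the tail a part of the truncated
    kernel.\<close>
  define \<rho> where "\<rho> = max \<epsilon> (2 * R)"
  have rho: "\<rho> > 0" "\<epsilon> \<le> \<rho>" using e by (auto simp: \<rho>_def)
  define K where "K = kernel_mass TYPE('a) \<epsilon>"
  define d where "d = kernel_mass TYPE('a) \<rho>"
  have K: "K > 0" "d > 0" using kernel_mass_pos[where 'a='a] e rho by (auto simp: K_def d_def)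
  have "w x \<le> max 0 (M * (K - d) / K)" for x
  proof (cases "x \<in> U")
    case True
    have "K * w x \<le> (LINT z|lborel. trunc_kernel \<alpha> \<epsilon> z * w (x + z))"
      using sub[OF True] trunc_lap_eq[OF e w, of x] by (simp add: K_def)
    also have "\<dots> \<le> (LINT (z::'a)|lborel. M * (trunc_kernel \<alpha> \<epsilon> z - trunc_kernel \<alpha> \<rho> z))"
    proof (rule integral_mono[OF integrable_trunc_shift[OF e w]])
      show "integrable lborel (\<lambda>z::'a. M * (trunc_kernel \<alpha> \<epsilon> z - trunc_kernel \<alpha> \<rho> z))"
        by (intro integrable_mult_right Bochner_Integration.integrable_diff integrable_trunc_kernel e rho)
      fix z :: 'a
      show "trunc_kernel \<alpha> \<epsilon> z * w (x + z) \<le> M * (trunc_kernel \<alpha> \<epsilon> z - trunc_kernel \<alpha> \<rho> z)"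
      proof (cases "norm z > \<rho>")
        case True
        then have "norm z > 2 * R" by (simp add: \<rho>_def)
        then have "norm (x + z) > R"
          using R(2)[OF \<open>x \<in> U\<close>] norm_triangle_ineq2[of z "- x"] by (simp add: add.commute)
        then have "w (x + z) \<le> 0" using R(2) out by (meson not_le)
        then show ?thesis using True rho by (simp add: trunc_kernel_def mult_nonneg_nonpos)
      next
        case False
        then have "trunc_kernel \<alpha> \<rho> z = 0" by (simp add: trunc_kernel_def)
        then show ?thesis
          using mult_left_mono[OF M[of "x + z"] trunc_kernel_nonneg[of \<alpha> \<epsilon> z]] by (simp add: mult.commute)
      qed
    qed
    also have "\<dots> = M * (K - d)"
      using integrable_trunc_kernel[OF e, where 'a='a] integrable_trunc_kernel[OF rho(1), where 'a='a]
      by (simp add: K_def d_def kernel_mass_def)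
    finally show ?thesis using K by (simp add: field_simps max.coboundedI2)
  next
    case False
    then show ?thesis using out by (simp add: max.coboundedI1)
  qed
  then have "M \<le> max 0 (M * (K - d) / K)" unfolding M_def by (intro cSUP_least) auto
  moreover have "M * (K - d) / K < M" using K \<open>M > 0\<close> by (simp add: field_simps)
  ultimately show False using \<open>M > 0\<close> by simp
qed

lemma trunc_comparison:
  fixes f V :: "'a::euclidean_space \<Rightarrow> real"
  assumes e: "\<epsilon> > 0" and f: "bdd_borel f" and V: "bdd_borel V" and U: "bounded U"
    and out: "\<And>x. x \<notin> U \<Longrightarrow> f x \<le> V x"
    and sub: "\<And>x. x \<in> U \<Longrightarrow> trunc_lap \<alpha> \<epsilon> f x \<le> trunc_lap \<alpha> \<epsilon> V x"
  shows "f x \<le> V x"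
proof -
  have "f x - V x \<le> 0"
    by (rule trunc_max_principle[OF e bdd_borel_diff[OF f V] U])
      (use out sub in \<open>simp_all add: trunc_lap_diff[OF e f V]\<close>)
  then show ?thesis by simp
qed

text \<open>On the domain, a zero of the operator is a fixed point of the averaging map
  \<open>T\<close>, which is monotone and preserves the bounds 0 and 1.\<close>

lemma trunc_dirichlet:
  fixes g :: "'a::euclidean_space \<Rightarrow> real"
  assumes e: "\<epsilon> > 0" and \<Omega> [measurable]: "\<Omega> \<in> sets borel"
    and g [measurable]: "g \<in> borel_measurable borel" and g01: "\<And>x. 0 \<le> g x" "\<And>x. g x \<le> 1"
  obtains u where "u \<in> borel_measurable borel" "\<And>x. 0 \<le> u x" "\<And>x. u x \<le> 1"
    "\<And>x. x \<notin> \<Omega> \<Longrightarrow> u x = g x" "\<And>x. x \<in> \<Omega> \<Longrightarrow> trunc_lap \<alpha> \<epsilon> u x = 0"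
proof -
  let ?k = "trunc_kernel \<alpha> \<epsilon> :: 'a \<Rightarrow> real"
  define K where "K = kernel_mass TYPE('a) \<epsilon>"
  have K: "K > 0" using kernel_mass_pos[where 'a='a] e by (auto simp: K_def)
  define T where "T u x = (if x \<in> \<Omega> then (LINT z|lborel. ?k z * u (x + z)) / K else g x)" for u x
  define P where "P u \<longleftrightarrow> u \<in> borel_measurable borel \<and> (\<forall>x. 0 \<le> u x \<and> u x \<le> 1)" for u :: "'a \<Rightarrow> real"
  have Pb: "bdd_borel u" if "P u" for u
    using that by (auto simp: P_def intro!: bdd_borelI[of _ 1])
  have Tmono: "T u x \<le> T v x" if "P u" "P v" "\<And>x. u x \<le> v x" for u v x
    unfolding T_def using K that
    by (auto intro!: divide_right_mono integral_mono integrable_trunc_shift e Pb mult_left_mono)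
  have T0: "T (\<lambda>x. 0) x \<ge> 0" and T1: "T (\<lambda>x. 1) x \<le> 1" for x
    using K g01 by (auto simp: T_def K_def kernel_mass_def)
  have P01: "P (\<lambda>x. 0)" "P (\<lambda>x. 1)" by (auto simp: P_def)
  have PT: "P (T u)" if "P u" for u
  proof -
    have [measurable]: "u \<in> borel_measurable borel" using that by (simp add: P_def)
    have "(\<lambda>x. LINT z|lborel. ?k z * u (x + z)) \<in> borel_measurable lborel"
      by (rule lborel.borel_measurable_lebesgue_integral) measurable
    then have [measurable]: "(\<lambda>x. LINT z|lborel. ?k z * u (x + z)) \<in> borel_measurable borel" by simp
    have "T u \<in> borel_measurable borel" unfolding T_def[abs_def] by measurable
    moreover have "0 \<le> T u x" "T u x \<le> 1" for x
      using Tmono[OF P01(1) that, of x] Tmono[OF that P01(2), of x] T0[of x] T1[of x] that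
      by (auto simp: P_def intro: order_trans)
    ultimately show ?thesis by (simp add: P_def)
  qed
  \<comment> \<open>The data extended by 0 lie below their image under \<open>T\<close>, so the
    iterates increase; their pointwise limit is a fixed point by dominated convergence.\<close>
  define w where "w n = (T ^^ n) (\<lambda>x. if x \<in> \<Omega> then 0 else g x)" for n
  have w0: "w 0 = (\<lambda>x. if x \<in> \<Omega> then 0 else g x)" and wS: "w (Suc n) = T (w n)" for n
    by (simp_all add: w_def)
  have Pw: "P (w n)" for n
  proof (induction n)
    case 0
    show ?case unfolding w0 P_def using g01 by auto
  qed (simp add: wS PT)
  have step: "w n x \<le> w (Suc n) x" for n x
  proof (induction n arbitrary: x)
    case 0
    have "(LINT z|lborel. ?k z * w 0 (x + z)) \<ge> 0"
      by (intro integral_nonneg_AE) (use Pw[of 0] in \<open>auto simp: P_def\<close>)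
    then show ?case using K by (auto simp: wS T_def) (auto simp: w0)
  next
    case (Suc n)
    then show ?case using Tmono[OF Pw Pw, of n "Suc n" x] by (simp only: wS)
  qed
  have "convergent (\<lambda>n. w n x)" for x
    by (rule Bseq_mono_convergent)
      (use Pw lift_Suc_mono_le[of "\<lambda>n. w n x", OF step] in \<open>auto simp: P_def intro!: BseqI'[of _ 1]\<close>)
  then have lim: "(\<lambda>n. w n x) \<longlonglongrightarrow> lim (\<lambda>n. w n x)" for x by (simp add: convergent_LIMSEQ_iff)
  define u where "u x = lim (\<lambda>n. w n x)" for x
  have lim: "(\<lambda>n. w n x) \<longlonglongrightarrow> u x" for x unfolding u_def by (rule lim)
  have um [measurable]: "u \<in> borel_measurable borel"
    by (rule borel_measurable_LIMSEQ_real[OF lim]) (use Pw in \<open>auto simp: P_def\<close>)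
  have u01: "0 \<le> u x" "u x \<le> 1" for x
    using Pw by (auto simp: P_def intro: LIMSEQ_le_const[OF lim] LIMSEQ_le_const2[OF lim])
  have "(\<lambda>n. T (w n) x) \<longlonglongrightarrow> T u x" for x
  proof (cases "x \<in> \<Omega>")
    case True
    have "(\<lambda>n. LINT z|lborel. ?k z * w n (x + z)) \<longlonglongrightarrow> (LINT z|lborel. ?k z * u (x + z))"
    proof (rule integral_dominated_convergence)
      show "integrable lborel ?k" by (rule integrable_trunc_kernel[OF e])
      show "(\<lambda>z. ?k z * w n (x + z)) \<in> borel_measurable lborel" for n
        using Pw[of n] by (auto simp: P_def)
      show "AE z in lborel. norm (?k z * w n (x + z)) \<le> ?k z" for n
        using Pw[of n] by (auto simp: P_def abs_mult intro!: mult_left_le)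
    qed (auto intro!: tendsto_mult lim)
    then show ?thesis using True K by (auto simp: T_def intro!: tendsto_divide)
  qed (simp add: T_def)
  moreover have "(\<lambda>n. T (w n) x) \<longlonglongrightarrow> u x" for x
    using LIMSEQ_Suc[OF lim[of x]] by (simp add: wS)
  ultimately have Tu: "T u x = u x" for x by (rule LIMSEQ_unique)
  show ?thesis
  proof (rule that[OF um u01])
    show "u x = g x" if "x \<notin> \<Omega>" for x using Tu[of x] that by (simp add: T_def)
    have "bdd_borel u" using um u01 by (auto intro!: bdd_borelI[of _ 1])
    then show "trunc_lap \<alpha> \<epsilon> u x = 0" if "x \<in> \<Omega>" for x
      using Tu[of x] that K by (simp add: T_def trunc_lap_eq[OF e] K_def[symmetric] field_simps)
  qed
qed

subsection \<open>Boundary regularity, uniformly in the truncation\<close>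

text \<open>The comparison function is a constant, lowered by a small bump and by a step on the ball of
  the complement, where \<open>f\<close> vanishes, and raised far away, where only \<open>f \<le> 1\<close> is known.
  The gain from the step beats the losses from the bump and the tail.\<close>

lemma growth_step:
  fixes f :: "'a::euclidean_space \<Rightarrow> real"
  assumes C: "\<And>p r \<epsilon> x. \<epsilon> > 0 \<Longrightarrow> r > 0 \<Longrightarrow> \<bar>trunc_lap \<alpha> \<epsilon> (bump p r) (x::'a)\<bar> \<le> C * r powr (- \<alpha>)"
    and c0: "0 < c0"
    and c2: "c2 = 1 / 2 powr (real DIM('a) + \<alpha>) * (unit_ball_vol DIM('a) * (c0 / 2) ^ DIM('a))"
    and \<eta>: "0 < \<eta>" "\<eta> \<le> 1 / 2" "\<eta> * C \<le> c2 / 4"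
    and \<Lambda>: "\<Lambda> \<ge> 2" "(\<Lambda> / 2) powr (- \<alpha>) * kernel_mass TYPE('a) 1 \<le> M * c2 / 4"
    and M: "0 < M" "M \<le> 1"
    and r: "0 < r" "\<Lambda> * r \<le> R" and e: "0 < \<epsilon>" "\<epsilon> < c0 * r / 2"
    and f: "bdd_borel f" "\<And>x. 0 \<le> f x" "\<And>x. f x \<le> 1" "\<And>x. x \<in> ball p R \<Longrightarrow> f x \<le> M"
    and q: "ball q (c0 * r) \<subseteq> ball p r" "ball q (c0 * r) \<inter> \<Omega> = {}"
    and f0: "\<And>x. x \<in> ball p r \<Longrightarrow> x \<notin> \<Omega> \<Longrightarrow> f x = 0"
    and sub: "\<And>x. x \<in> \<Omega> \<Longrightarrow> x \<in> ball p r \<Longrightarrow> trunc_lap \<alpha> \<epsilon> f x \<le> 0"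
    and x: "x \<in> ball p (r / 2)"
  shows "f x \<le> (1 - \<eta> * exp (- (4 / 3))) * M"
proof -
  let ?Q = "ball q (c0 * r)" and ?b = "real DIM('a) + \<alpha>"
  define U where "U = \<Omega> \<inter> ball p r"
  define A where "A = bump p r"
  define D where "D = (indicator ?Q :: 'a \<Rightarrow> real)"
  define E where "E = (indicator (- ball p R) :: 'a \<Rightarrow> real)"
  \<comment> \<open>On \<open>?Q\<close> the value is M \<eta> (1 - A) >= 0, so the step can be
    almost as deep as M; outside the large ball the value is M + 1, which dominates f <= 1.\<close>
  define V where "V y = (M + - (M * \<eta>) * A y) + (- (M * (1 - \<eta>)) * D y + E y)" for y
  have b: "?b > 0" using alpha_pos by simp
  have R: "r \<le> R / 2" using r mult_right_mono[OF \<Lambda>(1), of r] by linarith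
  have bA: "bdd_borel A" and bD: "bdd_borel D" and bE: "bdd_borel E"
    using r by (auto simp: A_def D_def E_def intro: compact_C2_bdd_borel bump_compact_C2)
  have bA1: "bdd_borel (\<lambda>y. M + - (M * \<eta>) * A y)"
    by (intro bdd_borel_add bdd_borel_cmult bA bdd_borel_const)
  have bD1: "bdd_borel (\<lambda>y. - (M * (1 - \<eta>)) * D y)" by (intro bdd_borel_cmult bD)
  have bV: "bdd_borel V" unfolding V_def[abs_def] by (intro bdd_borel_add bA1 bD1 bE)
  have A01: "0 \<le> A y" "A y \<le> 1" for y by (simp_all add: A_def bump_nonneg bump_le_1)
  have "f x \<le> V x"
  proof (rule trunc_comparison[OF e(1) f(1) bV])
    show "bounded U" by (simp add: U_def bounded_Int)
    fix y assume y: "y \<notin> U"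
    show "f y \<le> V y"
    proof (cases "y \<in> ball p r")
      case True
      then have "f y = 0" using f0 y by (auto simp: U_def)
      moreover have "0 \<le> M * \<eta> * (1 - A y)" using M \<eta> A01 by simp
      moreover have "M * (1 - \<eta>) * D y \<le> M * (1 - \<eta>) * 1"
        using M \<eta> by (intro mult_left_mono) (auto simp: D_def)
      moreover have "0 \<le> E y" by (simp add: E_def)
      ultimately show ?thesis by (simp add: V_def algebra_simps)
    next
      case False
      then have "A y = 0" using r by (simp add: A_def bump_eq_0_iff)
      moreover have "y \<notin> ?Q" using False q(1) by blast
      then have "D y = 0" by (simp add: D_def)
      ultimately have "A y = 0" "D y = 0" by auto
      then show ?thesis using f(3)[of y] f(4)[of y] M by (auto simp: V_def E_def indicator_def)
    qed
  next
    fix y assume y: "y \<in> U"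
    then have yp: "y \<in> ball p r" "y \<notin> ?Q" using q(2) by (auto simp: U_def)
    have "trunc_lap \<alpha> \<epsilon> V y = - (M * \<eta>) * trunc_lap \<alpha> \<epsilon> A y
        + (- (M * (1 - \<eta>)) * trunc_lap \<alpha> \<epsilon> D y + trunc_lap \<alpha> \<epsilon> E y)"
      unfolding V_def[abs_def]
      by (simp only: trunc_lap_add[OF e(1) bA1 bdd_borel_add[OF bD1 bE]] trunc_lap_add[OF e(1) bD1 bE]
          trunc_lap_add[OF e(1) bdd_borel_const bdd_borel_cmult[OF bA]] trunc_lap_cmult trunc_lap_const add_0)
    \<comment> \<open>The budget in units of M r^(-alpha): the bump costs at most c2 / 4, the step
      gains at least c2 / 2, the tail costs at most c2 / 4.\<close>
    moreover have "M * \<eta> * trunc_lap \<alpha> \<epsilon> A y \<le> M * (c2 / 4) * r powr (- \<alpha>)"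
    proof -
      have "M * \<eta> * trunc_lap \<alpha> \<epsilon> A y \<le> M * \<eta> * (C * r powr (- \<alpha>))"
        using C[OF e(1) r(1), of p y] M \<eta> by (intro mult_left_mono) (auto simp: A_def)
      also have "\<dots> = M * (\<eta> * C) * r powr (- \<alpha>)" by simp
      also have "\<dots> \<le> M * (c2 / 4) * r powr (- \<alpha>)"
        using M \<eta> by (intro mult_right_mono mult_left_mono) auto
      finally show ?thesis .
    qed
    moreover have "M * (c2 / 2) * r powr (- \<alpha>) \<le> - (M * (1 - \<eta>)) * trunc_lap \<alpha> \<epsilon> D y"
    proof -
      \<comment> \<open>\<open>y\<close> lies outside \<open>?Q\<close>, so the concentric half ball
        is farther than \<epsilon> from it and escapes the truncation; both points lie in
        \<open>ball p r\<close>, hence |z| < 2 r.\<close>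
      have "1 / (2 * r) powr ?b * (unit_ball_vol DIM('a) * (c0 * r / 2) ^ DIM('a))
          \<le> (LINT z|lborel. trunc_kernel \<alpha> \<epsilon> z * D (y + z))"
      proof (rule integral_ge_on_ball)
        fix z assume "z \<in> ball (q - y) (c0 * r / 2)"
        then have z: "dist q (y + z) < c0 * r / 2" by (simp add: dist_norm algebra_simps)
        have "c0 * r > 0" using c0 r(1) by simp
        then have zQ: "y + z \<in> ?Q" using z unfolding mem_ball by linarith
        then have "y + z \<in> ball p r" using q(1) by blast
        then have "norm z < 2 * r"
          using yp(1) dist_triangle[of y "y + z" p] by (simp add: dist_commute dist_norm[of y "y + z"])
        moreover have "dist q y \<ge> c0 * r" using yp(2) by simp
        then have "norm z > \<epsilon>"
          using z dist_triangle[of q y "y + z"] e(2) by (simp add: dist_norm[of "y + z" y])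
        ultimately show "1 / (2 * r) powr ?b \<le> trunc_kernel \<alpha> \<epsilon> z * D (y + z)"
          using zQ b e(1) by (auto simp: trunc_kernel_def D_def frac_kernel_def
              intro!: divide_left_mono powr_mono2 mult_pos_pos)
      next
        show "integrable lborel (\<lambda>z. trunc_kernel \<alpha> \<epsilon> z * D (y + z))"
          by (rule integrable_trunc_shift[OF e(1) bD])
      qed (use c0 r in \<open>auto simp: D_def\<close>)
      also have "(LINT z|lborel. trunc_kernel \<alpha> \<epsilon> z * D (y + z)) = - trunc_lap \<alpha> \<epsilon> D y"
        using yp(2) trunc_lap_eq[OF e(1) bD, of y] by (simp add: D_def)
      also have "1 / (2 * r) powr ?b * (unit_ball_vol DIM('a) * (c0 * r / 2) ^ DIM('a)) = c2 * r powr (- \<alpha>)"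
      proof -
        have "(2 * r) powr ?b = 2 powr ?b * r powr ?b" using r(1) by (simp add: powr_mult)
        moreover have "r powr ?b = r ^ DIM('a) * r powr \<alpha>" using r(1) by (simp add: powr_add powr_realpow)
        moreover have "(c0 * r / 2) ^ DIM('a) = (c0 / 2) ^ DIM('a) * r ^ DIM('a)"
          by (simp add: power_mult_distrib[symmetric])
        ultimately show ?thesis
          using r(1) by (simp only: c2 powr_minus_divide) (simp add: divide_simps)
      qed
      finally have le: "c2 * r powr (- \<alpha>) \<le> - trunc_lap \<alpha> \<epsilon> D y" .
      have "c2 \<ge> 0" using c0 by (simp add: c2)
      then have "M * (1 / 2) * (c2 * r powr (- \<alpha>)) \<le> M * (1 - \<eta>) * (- trunc_lap \<alpha> \<epsilon> D y)"
        using M \<eta> le by (intro mult_mono) auto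
      then show ?thesis by simp
    qed
    \<comment> \<open>\<open>y\<close> is within R / 2 of \<open>p\<close>, so only jumps longer
      than R / 2 reach the far region, and their mass scales like (R / 2)^(-alpha).\<close>
    moreover have "- (M * (c2 / 4) * r powr (- \<alpha>)) \<le> trunc_lap \<alpha> \<epsilon> E y"
    proof -
      have "y \<in> ball p R" using yp(1) R r(1) by auto
      then have "- trunc_lap \<alpha> \<epsilon> E y = (LINT z|lborel. trunc_kernel \<alpha> \<epsilon> z * E (y + z))"
        using trunc_lap_eq[OF e(1) bE, of y] by (simp add: E_def)
      also have "\<dots> \<le> (LINT (z::'a)|lborel. trunc_kernel \<alpha> (R / 2) z)"
      proof (rule integral_mono[OF integrable_trunc_shift[OF e(1) bE]])
        show "integrable lborel (trunc_kernel \<alpha> (R / 2) :: 'a \<Rightarrow> real)"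
          using R r by (intro integrable_trunc_kernel) auto
        fix z
        show "trunc_kernel \<alpha> \<epsilon> z * E (y + z) \<le> trunc_kernel \<alpha> (R / 2) z"
        proof (cases "y + z \<in> ball p R")
          case False
          then have "norm z > R / 2"
            using dist_triangle[of p "y + z" y] yp(1) R by (simp add: dist_norm[of y "y + z"])
          then show ?thesis using False by (simp add: E_def trunc_kernel_def)
        qed (simp add: E_def)
      qed
      also have "\<dots> = (R / 2) powr (- \<alpha>) * kernel_mass TYPE('a) 1"
        using kernel_mass_eq[where 'a='a, of "R / 2"] R r by (simp add: kernel_mass_def)
      also have "\<dots> \<le> (\<Lambda> / 2 * r) powr (- \<alpha>) * kernel_mass TYPE('a) 1"
        using r \<Lambda>(1) alpha_pos kernel_mass_pos[where 'a='a, of 1]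
        by (intro mult_right_mono powr_mono2') auto
      also have "\<dots> = (\<Lambda> / 2) powr (- \<alpha>) * kernel_mass TYPE('a) 1 * r powr (- \<alpha>)"
      proof -
        have "(\<Lambda> / 2 * r) powr (- \<alpha>) = (\<Lambda> / 2) powr (- \<alpha>) * r powr (- \<alpha>)"
          by (rule powr_mult)
        then show ?thesis by (simp only: mult_ac)
      qed
      also have "\<dots> \<le> M * c2 / 4 * r powr (- \<alpha>)"
        by (rule mult_right_mono[OF \<Lambda>(2)]) simp
      finally show ?thesis by simp
    qed
    ultimately have "trunc_lap \<alpha> \<epsilon> V y \<ge> 0" by (simp add: algebra_simps)
    then show "trunc_lap \<alpha> \<epsilon> f y \<le> trunc_lap \<alpha> \<epsilon> V y"
      using sub[of y] y by (auto simp: U_def)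
  qed
  \<comment> \<open>On the half ball the bump alone lowers the bound by at least M \<eta>
    exp(-4/3).\<close>
  moreover have "exp (- (4 / 3)) \<le> A x" using bump_half_ball[OF r(1) x] by (simp add: A_def)
  then have "M * \<eta> * exp (- (4 / 3)) \<le> M * \<eta> * A x" using M \<eta> by (intro mult_left_mono) auto
  moreover have "E x = 0" using x R r by (auto simp: E_def)
  moreover have "0 \<le> M * (1 - \<eta>) * D x" using M \<eta> by (simp add: D_def)
  ultimately show ?thesis by (simp add: V_def algebra_simps)
qed

end

text \<open>The cone enters only as \<open>corkscrew\<close>, a ball in the complement of size
  comparable to the scale. By \<open>g_locally_const\<close>, with one scale \<open>d0\<close> for
  all points, the exterior value near a boundary point is a single constant.\<close>

locale dirichlet_data = frac_order \<alpha> for \<alpha> :: real +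
  fixes \<Omega> :: "'a::euclidean_space set" and g :: "'a \<Rightarrow> real" and c0 r0 d0 :: real
  assumes open_dom: "open \<Omega>" and bounded_dom: "bounded \<Omega>"
    and g_measurable: "g \<in> borel_measurable borel"
    and g01: "g x = 0 \<or> g x = 1"
    and d0: "0 < d0" and g_locally_const: "x \<notin> \<Omega> \<Longrightarrow> y \<notin> \<Omega> \<Longrightarrow> dist x y < d0 \<Longrightarrow> g x = g y"
    and c0: "0 < c0" and r0: "0 < r0"
    and corkscrew: "p \<in> frontier \<Omega> \<Longrightarrow> 0 < r \<Longrightarrow> r \<le> r0 \<Longrightarrow>
      \<exists>q. ball q (c0 * r) \<subseteq> ball p r \<and> ball q (c0 * r) \<inter> \<Omega> = {}"
begin

definition trunc_sol :: "real \<Rightarrow> ('a \<Rightarrow> real) \<Rightarrow> bool" where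
  "trunc_sol \<epsilon> u \<longleftrightarrow> bdd_borel u \<and> (\<forall>x. 0 \<le> u x \<and> u x \<le> 1) \<and> (\<forall>x. x \<notin> \<Omega> \<longrightarrow> u x = g x) \<and>
     (\<forall>x\<in>\<Omega>. trunc_lap \<alpha> \<epsilon> u x = 0)"

lemma trunc_sol_exists: "\<epsilon> > 0 \<Longrightarrow> \<exists>u. trunc_sol \<epsilon> u"
proof -
  assume e: "\<epsilon> > 0"
  have g: "0 \<le> g x" "g x \<le> 1" for x using g01[of x] by auto
  have O: "\<Omega> \<in> sets borel" using open_dom by simp
  obtain u where u: "u \<in> borel_measurable borel" "\<And>x. 0 \<le> u x" "\<And>x. u x \<le> 1"
    "\<And>x. x \<notin> \<Omega> \<Longrightarrow> u x = g x" "\<And>x. x \<in> \<Omega> \<Longrightarrow> trunc_lap \<alpha> \<epsilon> u x = 0"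
    using trunc_dirichlet[OF e O g_measurable g] by blast
  then have "bdd_borel u" by (auto intro!: bdd_borelI[of _ 1])
  then show ?thesis using u by (auto simp: trunc_sol_def)
qed

text \<open>Radius and truncation threshold are chosen before \<epsilon>, \<open>u\<close> and
  \<open>p\<close>; this order of quantifiers is the uniformity that equicontinuity needs.\<close>

definition boundary_bound :: "real \<Rightarrow> bool" where
  "boundary_bound M \<longleftrightarrow> (\<exists>r>0. \<exists>\<epsilon>0>0. \<forall>\<epsilon> u p x. 0 < \<epsilon> \<longrightarrow> \<epsilon> < \<epsilon>0 \<longrightarrow> trunc_sol \<epsilon> u \<longrightarrow>
     p \<in> frontier \<Omega> \<longrightarrow> x \<in> ball p r \<longrightarrow> \<bar>u x - g p\<bar> \<le> M)"

lemma boundary_bound_mono: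
  assumes "boundary_bound M" "M \<le> M'"
  shows "boundary_bound M'"
proof -
  obtain r \<epsilon>0 where r: "r > 0" "\<epsilon>0 > 0"
    "\<And>\<epsilon> u p x. 0 < \<epsilon> \<Longrightarrow> \<epsilon> < \<epsilon>0 \<Longrightarrow> trunc_sol \<epsilon> u \<Longrightarrow> p \<in> frontier \<Omega> \<Longrightarrow> x \<in> ball p r \<Longrightarrow> \<bar>u x - g p\<bar> \<le> M"
    using assms(1) unfolding boundary_bound_def by blast
  then show ?thesis
    unfolding boundary_bound_def using order_trans[OF r(3) assms(2)] by blast
qed

text \<open>The factor is the same for every \<open>M\<close>, but the ratio \<Lambda> of scales
  depends on \<open>M\<close>: far away only the bound 1 is known, and this tail must be beaten by a
  gain proportional to \<open>M\<close>.\<close>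

lemma boundary_bound_step:
  obtains \<theta> where "0 < \<theta>" "\<theta> < 1" "\<And>M. 0 < M \<Longrightarrow> M \<le> 1 \<Longrightarrow> boundary_bound M \<Longrightarrow> boundary_bound ((1 - \<theta>) * M)"
proof -
  obtain C where C: "C > 0"
    "\<And>p r \<epsilon> x. \<epsilon> > 0 \<Longrightarrow> r > 0 \<Longrightarrow> \<bar>trunc_lap \<alpha> \<epsilon> (bump p r) (x::'a)\<bar> \<le> C * r powr (- \<alpha>)"
    using bump_trunc_lap_bound[where 'a='a] by blast
  define c2 where "c2 = 1 / 2 powr (real DIM('a) + \<alpha>) * (unit_ball_vol DIM('a) * (c0 / 2) ^ DIM('a))"
  have c2: "c2 > 0" using c0 by (simp add: c2_def)
  \<comment> \<open>1 / 2 preserves half of the step; c2 / (4 C) limits the cost of the bump to c2 /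
    4.\<close>
  define \<eta> where "\<eta> = min (1 / 2) (c2 / (4 * C))"
  have \<eta>: "0 < \<eta>" "\<eta> \<le> 1 / 2" "\<eta> * C \<le> c2 / 4"
    using C(1) c2 min.cobounded2[of "1/2" "c2 / (4 * C)"]
    by (auto simp: \<eta>_def pos_le_divide_eq min_def field_simps)
  have "boundary_bound ((1 - \<eta> * exp (- (4 / 3))) * M)" if M: "0 < M" "M \<le> 1" and B: "boundary_bound M" for M
  proof -
    let ?m = "kernel_mass TYPE('a) 1"
    have m: "?m > 0" by (simp add: kernel_mass_pos)
    have "filterlim (\<lambda>t::real. 1 / 2 * t) at_top at_top"
      by (intro filterlim_tendsto_pos_mult_at_top[OF tendsto_const] filterlim_ident) simp
    then have "((\<lambda>t. (t / 2) powr (- \<alpha>) * ?m) \<longlongrightarrow> 0 * ?m) at_top"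
      using alpha_pos by (intro tendsto_mult_right tendsto_neg_powr) (simp_all add: mult.commute)
    moreover have "M * c2 / 4 > 0" using M c2 by simp
    ultimately have "\<forall>\<^sub>F t in at_top. (t / 2) powr (- \<alpha>) * ?m < M * c2 / 4"
      using order_tendstoD(2) by fastforce
    then obtain \<Lambda> where \<Lambda>: "\<Lambda> \<ge> 2" "(\<Lambda> / 2) powr (- \<alpha>) * ?m \<le> M * c2 / 4"
      by (metis (no_types, lifting) eventually_at_top_linorder less_imp_le linorder_linear order_refl)
    obtain R \<epsilon>0 where R: "R > 0" "\<epsilon>0 > 0"
      "\<And>\<epsilon> u p x. 0 < \<epsilon> \<Longrightarrow> \<epsilon> < \<epsilon>0 \<Longrightarrow> trunc_sol \<epsilon> u \<Longrightarrow> p \<in> frontier \<Omega> \<Longrightarrow> x \<in> ball p R \<Longrightarrow> \<bar>u x - g p\<bar> \<le> M"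
      using B unfolding boundary_bound_def by blast
    \<comment> \<open>\<open>r0\<close> admits the exterior ball, \<open>d0\<close> forces the
      exterior value \<open>g p\<close> in the ball, and R / \<Lambda> leaves room for the
      tail.\<close>
    define r where "r = min (min r0 d0) (R / \<Lambda>)"
    have r: "0 < r" "r \<le> r0" "r \<le> d0"
      using r0 d0 R(1) \<Lambda>(1) by (auto simp: r_def)
    have "r \<le> R / \<Lambda>" by (simp add: r_def)
    then have rR: "\<Lambda> * r \<le> R" using \<Lambda>(1) by (simp add: pos_le_divide_eq mult.commute)
    have "\<bar>u x - g p\<bar> \<le> (1 - \<eta> * exp (- (4 / 3))) * M"
      if e: "0 < \<epsilon>" "\<epsilon> < min \<epsilon>0 (c0 * r / 2)" and u: "trunc_sol \<epsilon> u"
        and p: "p \<in> frontier \<Omega>" and x: "x \<in> ball p (r / 2)" for \<epsilon> u p x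
    proof -
      obtain q where q: "ball q (c0 * r) \<subseteq> ball p r" "ball q (c0 * r) \<inter> \<Omega> = {}"
        using corkscrew[OF p r(1,2)] by blast
      have p': "p \<notin> \<Omega>" using p open_dom by (simp add: frontier_def interior_open)
      \<comment> \<open>This is \<open>u\<close> if \<open>g p\<close> is 0 and \<open>1 - u\<close>
        if it is 1, so both kinds of boundary point lead to a function vanishing on the nearby
        complement.\<close>
      define f where "f = (\<lambda>y. g p + (1 - 2 * g p) * u y)"
      have fabs: "f y = \<bar>u y - g p\<bar>" "0 \<le> f y" "f y \<le> 1" for y
        using u g01[of p] by (auto simp: f_def trunc_sol_def)
      have ub: "bdd_borel u" using u by (simp add: trunc_sol_def)
      have fb: "bdd_borel f" unfolding f_def by (intro bdd_borel_add bdd_borel_cmult ub bdd_borel_const)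
      have "f x \<le> (1 - \<eta> * exp (- (4 / 3))) * M"
      proof (rule growth_step[OF C(2) c0 c2_def \<eta> \<Lambda> M r(1) rR e(1) _ fb fabs(2,3) _ q _ _ x])
        show "\<epsilon> < c0 * r / 2" using e by simp
        show "f y \<le> M" if "y \<in> ball p R" for y
          using R(3)[OF e(1) _ u p that] e fabs(1) by simp
        show "f y = 0" if "y \<in> ball p r" "y \<notin> \<Omega>" for y
          using g_locally_const[OF p' that(2)] that u r(3) by (auto simp: fabs(1) trunc_sol_def)
        show "trunc_lap \<alpha> \<epsilon> f y \<le> 0" if "y \<in> \<Omega>" for y
          using u that unfolding f_def
          by (subst trunc_lap_add[OF e(1) bdd_borel_const bdd_borel_cmult[OF ub]])
            (simp add: trunc_lap_cmult trunc_sol_def)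
      qed
      then show ?thesis by (simp only: fabs(1))
    qed
    moreover have "min \<epsilon>0 (c0 * r / 2) > 0" "r / 2 > 0" using R c0 r by auto
    ultimately show ?thesis unfolding boundary_bound_def by blast
  qed
  moreover have "\<eta> * exp (- (4 / 3)) < 1" "0 < \<eta> * exp (- (4 / 3))"
  proof -
    have "\<eta> * exp (- (4 / 3)) \<le> 1 / 2 * 1" using \<eta> by (intro mult_mono) auto
    then show "\<eta> * exp (- (4 / 3)) < 1" by linarith
  qed (use \<eta> in simp)
  ultimately show ?thesis using that by blast
qed

text \<open>The bound 1 is trivial because solution and data lie between 0 and 1; iterating the
  fixed factor reaches every positive bound.\<close>

lemma boundary_bound: "M > 0 \<Longrightarrow> boundary_bound M"
proof -
  assume M: "M > 0"
  obtain \<theta> where \<theta>: "0 < \<theta>" "\<theta> < 1"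
    "\<And>M. 0 < M \<Longrightarrow> M \<le> 1 \<Longrightarrow> boundary_bound M \<Longrightarrow> boundary_bound ((1 - \<theta>) * M)"
    using boundary_bound_step by blast
  have "boundary_bound ((1 - \<theta>) ^ n)" for n
  proof (induction n)
    case 0
    have "\<bar>u x - g p\<bar> \<le> 1" if "trunc_sol \<epsilon> u" for \<epsilon> u x p
      using that g01[of p] by (auto simp: trunc_sol_def abs_le_iff intro: order_trans[of _ 1])
        (smt (verit))+
    then show ?case unfolding boundary_bound_def power_0 using zero_less_one by blast
  next
    case (Suc n)
    then show ?case using \<theta> by (auto intro!: \<theta>(3) power_le_one)
  qed
  moreover obtain n where "(1 - \<theta>) ^ n < M" using real_arch_pow_inv[OF M, of "1 - \<theta>"] \<theta> by auto
  ultimately show ?thesis using boundary_bound_mono less_imp_le by blast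
qed

lemma trunc_sol_equicontinuous:
  assumes "\<eta> > 0"
  obtains \<delta> \<epsilon>0 where "\<delta> > 0" "\<epsilon>0 > 0"
    "\<And>\<epsilon> u x y. 0 < \<epsilon> \<Longrightarrow> \<epsilon> < \<epsilon>0 \<Longrightarrow> trunc_sol \<epsilon> u \<Longrightarrow> dist x y < \<delta> \<Longrightarrow> \<bar>u x - u y\<bar> \<le> \<eta>"
proof -
  obtain r \<epsilon>0 where r: "r > 0" "\<epsilon>0 > 0"
    "\<And>\<epsilon> u p x. 0 < \<epsilon> \<Longrightarrow> \<epsilon> < \<epsilon>0 \<Longrightarrow> trunc_sol \<epsilon> u \<Longrightarrow> p \<in> frontier \<Omega> \<Longrightarrow> x \<in> ball p r \<Longrightarrow> \<bar>u x - g p\<bar> \<le> \<eta>"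
    using boundary_bound[OF assms] unfolding boundary_bound_def by blast
  define \<delta> where "\<delta> = min r d0"
  have one_sided: "u (x + h) - u x \<le> \<eta>" if e: "0 < \<epsilon>" "\<epsilon> < \<epsilon>0" and u: "trunc_sol \<epsilon> u" and h: "norm h < \<delta>"
    for \<epsilon> u x h
  proof -
    have ub: "bdd_borel u" using u by (simp add: trunc_sol_def)
    have mixed: "\<bar>u y - u x\<bar> \<le> \<eta>" if "x \<notin> \<Omega>" "y \<in> \<Omega>" "dist x y < \<delta>" for x y
    proof -
      \<comment> \<open>A segment from outside to inside meets the frontier at a point
        \<open>p\<close> close to both ends; local constancy gives the value at the outer end, the
        boundary bound the one at the inner end.\<close>
      have "closed_segment x y \<inter> frontier \<Omega> \<noteq> {}"
        by (rule connected_Int_frontier) (use that in auto)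
      then obtain p where p: "p \<in> closed_segment x y" "p \<in> frontier \<Omega>" by blast
      have d: "dist p x < \<delta>" "dist p y < \<delta>"
        using dist_in_closed_segment[OF p(1)] that(3) by (auto simp: dist_commute)
      have "p \<notin> \<Omega>" using p open_dom by (simp add: frontier_def interior_open)
      then have "g x = g p" using g_locally_const[of p x] d that(1) by (auto simp: \<delta>_def)
      then have "u x = g p" using u that(1) by (simp add: trunc_sol_def)
      moreover have "\<bar>u y - g p\<bar> \<le> \<eta>" using r(3)[OF e u p(2), of y] d by (simp add: \<delta>_def)
      ultimately show ?thesis by simp
    qed
    show ?thesis
    proof (rule trunc_comparison[OF e(1) bdd_borel_diff[OF bdd_borel_shift[OF ub] ub] bdd_borel_const])
      \<comment> \<open>On this set both \<open>u\<close> and its translate solve the equation; off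
        it at least one of the two points carries exterior data.\<close>
      show "bounded {x \<in> \<Omega>. x + h \<in> \<Omega>}" by (rule bounded_subset[OF bounded_dom]) auto
      fix y assume "y \<notin> {x \<in> \<Omega>. x + h \<in> \<Omega>}"
      then consider "y \<notin> \<Omega>" "y + h \<notin> \<Omega>" | "y \<notin> \<Omega>" "y + h \<in> \<Omega>" | "y \<in> \<Omega>" "y + h \<notin> \<Omega>" by blast
      then show "u (y + h) - u y \<le> \<eta>"
      proof cases
        case 1
        then have "g y = g (y + h)" using g_locally_const[OF 1] h by (simp add: \<delta>_def dist_norm)
        then show ?thesis using 1 u assms by (simp add: trunc_sol_def)
      next
        case 2
        then show ?thesis using mixed[of y "y + h"] h by (simp add: dist_norm abs_le_iff)
      next
        case 3
        then show ?thesis using mixed[of "y + h" y] h by (simp add: dist_norm abs_le_iff)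
      qed
    next
      fix y assume y: "y \<in> {x \<in> \<Omega>. x + h \<in> \<Omega>}"
      then show "trunc_lap \<alpha> \<epsilon> (\<lambda>x. u (x + h) - u x) y \<le> trunc_lap \<alpha> \<epsilon> (\<lambda>x. \<eta>) y"
        using u by (simp add: trunc_lap_diff[OF e(1) bdd_borel_shift[OF ub] ub] trunc_lap_shift trunc_sol_def)
    qed
  qed
  show ?thesis
  proof (rule that[of \<delta> \<epsilon>0])
    show "\<delta> > 0" using r d0 by (simp add: \<delta>_def)
    show "\<bar>u x - u y\<bar> \<le> \<eta>" if "0 < \<epsilon>" "\<epsilon> < \<epsilon>0" "trunc_sol \<epsilon> u" "dist x y < \<delta>" for \<epsilon> u x y
      using one_sided[OF that(1-3), of "x - y" y] one_sided[OF that(1-3), of "y - x" x] that(4)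
      by (simp add: dist_norm norm_minus_commute abs_le_iff)
  qed (rule r)
qed

text \<open>Diagonal extraction on a countable dense set; asymptotic equicontinuity does the rest.\<close>

theorem dirichlet_solution_exists:
  obtains v where "continuous_on UNIV v" "\<And>x. 0 \<le> v x" "\<And>x. v x \<le> 1" "\<And>x. x \<notin> \<Omega> \<Longrightarrow> v x = g x"
    "\<And>\<phi>. \<phi> \<in> test_functions \<Omega> \<Longrightarrow> (LINT x|lborel. v x * frac_lim \<phi> x) = 0"
proof -
  define \<epsilon> where "\<epsilon> n = inverse (real (Suc n))" for n
  have \<epsilon>: "0 < \<epsilon> n" "\<epsilon> n \<le> 1" for n by (simp_all add: \<epsilon>_def divide_simps)
  have \<epsilon>0: "\<epsilon> \<longlonglongrightarrow> 0" unfolding \<epsilon>_def by (rule LIMSEQ_inverse_real_of_nat)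
  define w where "w n = (SOME u. trunc_sol (\<epsilon> n) u)" for n
  have w: "trunc_sol (\<epsilon> n) (w n)" for n
    unfolding w_def by (rule someI_ex[OF trunc_sol_exists[OF \<epsilon>(1)]])
  obtain D :: "'a set" where D: "countable D" "\<And>X. open X \<Longrightarrow> X \<noteq> {} \<Longrightarrow> \<exists>d\<in>D. d \<in> X"
    using countable_dense_exists by blast
  have "norm (w n x) \<le> 1" for n x using w[of n] by (simp add: trunc_sol_def)
  then obtain k :: "nat \<Rightarrow> nat" where k: "strict_mono k" "\<And>x. x \<in> D \<Longrightarrow> \<exists>l. (\<lambda>n. w (k n) x) \<longlonglongrightarrow> l"
    using function_convergent_subsequence[OF D(1), of w 1] by blast
  have \<epsilon>k: "(\<lambda>n. \<epsilon> (k n)) \<longlonglongrightarrow> 0" using LIMSEQ_subseq_LIMSEQ[OF \<epsilon>0 k(1)] by (simp add: comp_def)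
  have "convergent (\<lambda>n. w (k n) x)" for x
  proof -
    have "Cauchy (\<lambda>n. w (k n) x)"
    proof (rule metric_CauchyI)
      fix e :: real assume e: "e > 0"
      then have "e / 4 > 0" by simp
      then obtain \<delta> \<epsilon>1 where d: "\<delta> > 0" "\<epsilon>1 > 0"
        "\<And>\<epsilon> u x y. 0 < \<epsilon> \<Longrightarrow> \<epsilon> < \<epsilon>1 \<Longrightarrow> trunc_sol \<epsilon> u \<Longrightarrow> dist x y < \<delta> \<Longrightarrow> \<bar>u x - u y\<bar> \<le> e / 4"
        using trunc_sol_equicontinuous by blast
      obtain q where q: "q \<in> D" "dist x q < \<delta>" using D(2)[of "ball x \<delta>"] d(1) by auto
      have "Cauchy (\<lambda>n. w (k n) q)" using k(2)[OF q(1)] by (auto intro: LIMSEQ_imp_Cauchy)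
      then obtain N1 where N1: "\<And>m n. m \<ge> N1 \<Longrightarrow> n \<ge> N1 \<Longrightarrow> dist (w (k m) q) (w (k n) q) < e / 4"
        using \<open>e / 4 > 0\<close> unfolding Cauchy_def by blast
      \<comment> \<open>Equicontinuity holds only below the threshold \<open>\<epsilon>1\<close>, so
        finitely many terms are discarded.\<close>
      obtain N2 where N2: "\<And>n. n \<ge> N2 \<Longrightarrow> \<epsilon> (k n) < \<epsilon>1"
        using order_tendstoD(2)[OF \<epsilon>k d(2)] unfolding eventually_sequentially by blast
      have "dist (w (k m) x) (w (k n) x) < e" if "m \<ge> max N1 N2" "n \<ge> max N1 N2" for m n
      proof -
        have "\<bar>w (k m) x - w (k m) q\<bar> \<le> e / 4" "\<bar>w (k n) x - w (k n) q\<bar> \<le> e / 4"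
          using d(3)[OF \<epsilon>(1) N2 w q(2)] that by auto
        moreover have "\<bar>w (k m) q - w (k n) q\<bar> < e / 4" using N1[of m n] that by (simp add: dist_real_def)
        ultimately show ?thesis using e unfolding dist_real_def by linarith
      qed
      then show "\<exists>M. \<forall>m\<ge>M. \<forall>n\<ge>M. dist (w (k m) x) (w (k n) x) < e" by blast
    qed
    then show ?thesis by (simp add: Cauchy_convergent)
  qed
  then obtain v where v: "\<And>x. (\<lambda>n. w (k n) x) \<longlonglongrightarrow> v x" unfolding convergent_def by metis
  show ?thesis
  proof (rule that[of v])
    show "0 \<le> v x" "v x \<le> 1" for x
      using w by (auto simp: trunc_sol_def intro: LIMSEQ_le_const[OF v] LIMSEQ_le_const2[OF v])
    show "v x = g x" if "x \<notin> \<Omega>" for x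
      using LIMSEQ_unique[OF v[of x], of "g x"] w that by (simp add: trunc_sol_def)
    show "continuous_on UNIV v"
    proof (rule uniformly_continuous_imp_continuous, unfold uniformly_continuous_on_def, intro allI impI)
      fix e :: real assume "e > 0"
      then have "e / 2 > 0" by simp
      then obtain \<delta> \<epsilon>1 where d: "\<delta> > 0" "\<epsilon>1 > 0"
        "\<And>\<epsilon> u x y. 0 < \<epsilon> \<Longrightarrow> \<epsilon> < \<epsilon>1 \<Longrightarrow> trunc_sol \<epsilon> u \<Longrightarrow> dist x y < \<delta> \<Longrightarrow> \<bar>u x - u y\<bar> \<le> e / 2"
        using trunc_sol_equicontinuous by blast
      have "\<bar>v x - v y\<bar> \<le> e / 2" if "dist x y < \<delta>" for x y
      proof (rule LIMSEQ_le_const2)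
        show "(\<lambda>n. \<bar>w (k n) x - w (k n) y\<bar>) \<longlonglongrightarrow> \<bar>v x - v y\<bar>"
          by (intro tendsto_intros v)
        obtain N2 where "\<And>n. n \<ge> N2 \<Longrightarrow> \<epsilon> (k n) < \<epsilon>1"
          using order_tendstoD(2)[OF \<epsilon>k d(2)] unfolding eventually_sequentially by blast
        then show "\<exists>N. \<forall>n\<ge>N. \<bar>w (k n) x - w (k n) y\<bar> \<le> e / 2"
          using d(3)[OF \<epsilon>(1) _ w that] by blast
      qed
      then have "dist (v x') (v x) < e" if "dist x' x < \<delta>" for x x'
        using that \<open>e > 0\<close> unfolding dist_real_def by fastforce
      then show "\<exists>d>0. \<forall>x\<in>UNIV. \<forall>x'\<in>UNIV. dist x' x < d \<longrightarrow> dist (v x') (v x) < e"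
        using d(1) by blast
    qed
    fix \<phi> assume \<phi>: "\<phi> \<in> test_functions \<Omega>"
    then have C2: "compact_C2 \<phi>" by (rule test_function_compact_C2)
    have "(\<lambda>n. LINT x|lborel. w (k n) x * trunc_lap \<alpha> (\<epsilon> (k n)) \<phi> x) \<longlonglongrightarrow> (LINT x|lborel. v x * frac_lim \<phi> x)"
      by (rule frac_lim_integral_tendsto[OF C2 \<epsilon> \<epsilon>k _ _ v, where B = 1])
        (use w in \<open>auto simp: trunc_sol_def bdd_borel_def\<close>)
    \<comment> \<open>Once the operator is moved onto \<open>w (k n)\<close> the integrand vanishes
      everywhere: \<open>\<phi>\<close> is 0 off the domain, the operator on it.\<close>
    moreover have "(LINT x|lborel. w (k n) x * trunc_lap \<alpha> (\<epsilon> (k n)) \<phi> x) = 0" for n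
    proof -
      have "\<phi> x = 0" if "x \<notin> \<Omega>" for x
        using \<phi> that closure_subset[of "{x. \<phi> x \<noteq> 0}"] by (auto simp: test_functions_def)
      then have 0: "\<phi> x * trunc_lap \<alpha> (\<epsilon> (k n)) (w (k n)) x = 0" for x
        using w[of "k n"] by (cases "x \<in> \<Omega>") (auto simp: trunc_sol_def)
      have "(LINT x|lborel. w (k n) x * trunc_lap \<alpha> (\<epsilon> (k n)) \<phi> x)
          = (LINT x|lborel. \<phi> x * trunc_lap \<alpha> (\<epsilon> (k n)) (w (k n)) x)"
        using w[of "k n"]
        by (intro trunc_lap_symmetric[OF \<epsilon>(1) _ compact_C2_integrable[OF C2] compact_C2_bdd_borel[OF C2]])
          (simp add: trunc_sol_def)
      then show ?thesis by (simp add: 0)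
    qed
    ultimately show "(LINT x|lborel. v x * frac_lim \<phi> x) = 0"
      by (simp add: LIMSEQ_const_iff)
  qed
qed

end

subsection \<open>The maximum principle for distributional solutions\<close>

lemma uniformly_continuous_compact_support:
  fixes f :: "'a::euclidean_space \<Rightarrow> real"
  assumes f: "continuous_on UNIV f" and R: "\<And>x. R < norm x \<Longrightarrow> f x = 0"
  shows "uniformly_continuous_on UNIV f"
  unfolding uniformly_continuous_on_def
proof (intro allI impI)
  fix e :: real assume e: "e > 0"
  \<comment> \<open>With the margin 1, two close points are either both in the enlarged ball or both
    where \<open>f\<close> vanishes.\<close>
  have "uniformly_continuous_on (cball 0 (R + 1)) f"
    by (rule compact_uniformly_continuous) (use f in \<open>auto intro: continuous_on_subset\<close>)
  then obtain d where d: "d > 0"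
    "\<And>x y. norm x \<le> R + 1 \<Longrightarrow> norm y \<le> R + 1 \<Longrightarrow> dist y x < d \<Longrightarrow> dist (f y) (f x) < e"
    unfolding uniformly_continuous_on_def using e by (metis mem_cball_0)
  have "dist (f y) (f x) < e" if "dist y x < min d 1" for x y
  proof (cases "norm x \<le> R + 1 \<and> norm y \<le> R + 1")
    case False
    have "norm x < norm y + 1" "norm y < norm x + 1"
      using that norm_triangle_ineq2[of x y] norm_triangle_ineq2[of y x]
      by (auto simp: dist_norm norm_minus_commute)
    then have "R < norm x" "R < norm y" using False by auto
    then show ?thesis using R e by simp
  qed (use d that in auto)
  then show "\<exists>d>0. \<forall>x\<in>UNIV. \<forall>x'\<in>UNIV. dist x' x < d \<longrightarrow> dist (f x') (f x) < e"
    using d(1) by (intro exI[of _ "min d 1"]) auto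
qed

lemma bump_shift: "bump (p - h) r x = bump p r (x + h)"
  by (simp add: bump_def algebra_simps)

text \<open>The set where \<open>F\<close> is at least \<open>F y\<close> is closed and contained in
  the bounded set \<open>U\<close>, hence compact.\<close>

lemma continuous_attains_max:
  fixes F :: "'a::euclidean_space \<Rightarrow> real"
  assumes F: "continuous_on UNIV F" and U: "bounded U" and out: "\<And>x. x \<notin> U \<Longrightarrow> F x < F y"
  obtains x0 where "\<And>x. F x \<le> F x0"
proof -
  let ?K = "{x. F y \<le> F x}"
  have "?K \<subseteq> U" using out by force
  moreover have "closed ?K" using F by (intro closed_Collect_le) auto
  ultimately have "compact ?K" using U bounded_subset compact_eq_bounded_closed by blast
  moreover have "continuous_on ?K F" using F continuous_on_subset by blast
  ultimately obtain x0 where "x0 \<in> ?K" "\<forall>x\<in>?K. F x \<le> F x0"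
    using continuous_attains_sup[of ?K F] by auto
  then have "F x \<le> F x0" for x by (cases "F y \<le> F x") auto
  then show ?thesis using that by blast
qed

context frac_order
begin

text \<open>The integrable majorant of the truncated operators survives the limit.\<close>

lemma frac_lim_integrable:
  fixes \<phi> :: "'a::euclidean_space \<Rightarrow> real"
  assumes \<phi>: "compact_C2 \<phi>" and f: "bdd_borel f"
  shows "integrable lborel (\<lambda>x. f x * frac_lim \<phi> x)"
proof -
  note [measurable] = bdd_borel_measurable[OF compact_C2_bdd_borel[OF \<phi>]] bdd_borel_measurable[OF f]
  obtain B where B: "B \<ge> 0" "\<And>x. \<bar>f x\<bar> \<le> B" using bdd_borelE[OF f] by blast
  obtain w where w: "integrable lborel w" "\<And>\<epsilon> x. 0 < \<epsilon> \<Longrightarrow> \<epsilon> \<le> 1 \<Longrightarrow> \<bar>trunc_lap \<alpha> \<epsilon> \<phi> x\<bar> \<le> w x"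
    using trunc_lap_dominated[OF \<phi>] by blast
  define \<epsilon> where "\<epsilon> n = inverse (real (Suc n))" for n
  have \<epsilon>: "0 < \<epsilon> n" "\<epsilon> n \<le> 1" for n by (simp_all add: \<epsilon>_def divide_simps)
  have \<epsilon>0: "\<epsilon> \<longlonglongrightarrow> 0" unfolding \<epsilon>_def by (rule LIMSEQ_inverse_real_of_nat)
  note lim = trunc_lap_tendsto[OF \<phi> \<epsilon>(1) \<epsilon>0]
  have [measurable]: "frac_lim \<phi> \<in> borel_measurable borel"
    by (rule borel_measurable_LIMSEQ_real[OF lim]) simp
  have le: "\<bar>frac_lim \<phi> x\<bar> \<le> w x" for x
    by (rule LIMSEQ_le_const2[OF tendsto_rabs[OF lim]]) (use w(2) \<epsilon> in blast)
  show ?thesis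
  proof (rule Bochner_Integration.integrable_bound)
    show "integrable lborel (\<lambda>x. B * w x)" using w by simp
    have "\<bar>f x * frac_lim \<phi> x\<bar> \<le> \<bar>B * w x\<bar>" for x
      unfolding abs_mult using B le[of x] by (intro mult_mono) auto
    then show "AE x in lborel. norm (f x * frac_lim \<phi> x) \<le> norm (B * w x)" by simp
  qed simp
qed

text \<open>\<open>f\<close> is mollified; the mollification \<open>F\<close> attains its maximum at some \<open>x1\<close>, and the bump at
  \<open>x1\<close> is an admissible test function.\<close>

lemma distr_max_principle:
  fixes f :: "'a::euclidean_space \<Rightarrow> real"
  assumes f: "uniformly_continuous_on UNIV f" "\<And>x. \<bar>f x\<bar> \<le> B"
    and U: "bounded U" and out: "\<And>x. x \<notin> U \<Longrightarrow> f x \<le> 0"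
    and sub: "\<And>\<phi>. \<phi> \<in> test_functions U \<Longrightarrow> (\<And>x. 0 \<le> \<phi> x) \<Longrightarrow> (LINT x|lborel. f x * frac_lim \<phi> x) \<le> 0"
  shows "f y \<le> 0"
proof (rule ccontr)
  assume "\<not> f y \<le> 0"
  have fc: "continuous_on UNIV f" using f(1) by (rule uniformly_continuous_imp_continuous)
  have fb: "bdd_borel f" using fc f(2) by (auto intro!: bdd_borelI borel_measurable_continuous_onI)
  note fm [measurable] = bdd_borel_measurable[OF fb]
  have "f x < f y" if "x \<notin> U" for x using out[OF that] \<open>\<not> f y \<le> 0\<close> by simp
  then obtain x0 where x0: "\<And>x. f x \<le> f x0" using continuous_attains_max[OF fc U] by blast
  define M where "M = f x0"
  have M: "M > 0" using x0[of y] \<open>\<not> f y \<le> 0\<close> by (simp add: M_def)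
  \<comment> \<open>Oscillation below M / 4 at the mollification scale leaves a definite gap:
    \<open>F\<close> is at least 3/4 M I at \<open>x0\<close> and at most M I / 4 off
    \<open>U\<close>.\<close>
  obtain \<delta> where \<delta>: "\<delta> > 0" "\<And>x y. dist x y < \<delta> \<Longrightarrow> \<bar>f x - f y\<bar> < M / 4"
    using f(1) M unfolding uniformly_continuous_on_def dist_real_def
    by (metis UNIV_I zero_less_divide_iff zero_less_numeral)
  define r where "r = \<delta> / 2"
  have r: "r > 0" "r < \<delta>" using \<delta> by (auto simp: r_def)
  define I where "I = (LINT y|lborel. bump (0::'a) r y)"
  have b: "bdd_borel (bump p r)" and bi: "integrable lborel (bump p r)" for p :: 'a
    using bump_compact_C2[OF r(1), of p] by (auto intro: compact_C2_bdd_borel compact_C2_integrable)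
  note [measurable] = bdd_borel_measurable[OF b]
  have bI: "(LINT y|lborel. bump p r y) = I" for p :: 'a
    using lborel_integral_shift[of "bump 0 r" "- p"] bump_shift[of 0 "- p" r]
    by (simp add: I_def add.commute)
  have I: "I > 0"
  proof -
    have "exp (- (4 / 3)) * (unit_ball_vol DIM('a) * (r / 2) ^ DIM('a)) \<le> I"
      unfolding I_def
    proof (rule integral_ge_on_ball[OF bi bump_nonneg])
      show "exp (- (4 / 3)) \<le> bump 0 r x" if "x \<in> ball 0 (r / 2)" for x :: 'a
        by (rule bump_half_ball[OF r(1) that])
    qed (use r in simp)
    moreover have "exp (- (4 / 3)) * (unit_ball_vol DIM('a) * (r / 2) ^ DIM('a)) > 0" using r by simp
    ultimately show ?thesis by linarith
  qed
  have mi: "integrable lborel (\<lambda>y. h y * bump p r y)" if h: "bdd_borel h" for h :: "'a \<Rightarrow> real" and p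
  proof -
    obtain C where C: "C \<ge> 0" "\<And>x. \<bar>h x\<bar> \<le> C" using bdd_borelE[OF h] by blast
    note [measurable] = bdd_borel_measurable[OF h]
    show ?thesis
      by (rule Bochner_Integration.integrable_bound[OF integrable_mult_right[OF bi[of p], of C]])
        (use C in \<open>auto simp: abs_mult intro!: mult_right_mono\<close>)
  qed
  \<comment> \<open>The mollifier is not normalised; its mass \<open>I\<close> is carried through
    all bounds.\<close>
  define F where "F x = (LINT y|lborel. f y * bump x r y)" for x
  have close: "\<bar>F x - f z * I\<bar> \<le> e * I" if e: "\<And>y. y \<in> ball x r \<Longrightarrow> \<bar>f y - f z\<bar> \<le> e" for x z e
  proof -
    have i: "integrable lborel (\<lambda>y. (f y - f z) * bump x r y)"
      by (intro mi bdd_borel_diff fb bdd_borel_const)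
    have "F x - f z * I = (LINT y|lborel. f y * bump x r y) - (LINT y|lborel. f z * bump x r y)"
      using bI[of x] by (simp add: F_def)
    also have "\<dots> = (LINT y|lborel. f y * bump x r y - f z * bump x r y)"
      by (intro Bochner_Integration.integral_diff[symmetric] mi fb bdd_borel_const)
    also have "\<dots> = (LINT y|lborel. (f y - f z) * bump x r y)" by (simp add: left_diff_distrib)
    finally have "\<bar>F x - f z * I\<bar> \<le> (LINT y|lborel. \<bar>(f y - f z) * bump x r y\<bar>)"
      using integral_abs_bound[of lborel "\<lambda>y. (f y - f z) * bump x r y"] by simp
    also have "\<dots> \<le> (LINT y|lborel. e * bump x r y)"
    proof (rule integral_mono)
      fix y
      show "\<bar>(f y - f z) * bump x r y\<bar> \<le> e * bump x r y"
      proof (cases "y \<in> ball x r")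
        case True
        then show ?thesis using e[OF True] bump_nonneg[of x r y] by (simp add: abs_mult mult_right_mono)
      next
        case False
        then have "bump x r y = 0" using bump_eq_0_iff[OF r(1)] by blast
        then show ?thesis by simp
      qed
    qed (use i bi in auto)
    finally show ?thesis using bI[of x] by simp
  qed
  have near: "\<bar>F x - f x * I\<bar> \<le> M / 4 * I" for x
    by (rule close) (use \<delta>(2) r in \<open>fastforce simp: dist_commute intro: less_imp_le\<close>)
  have F': "F x = (LINT y|lborel. f (x + y) * bump 0 r y)" for x
  proof -
    have "F x = (LINT y|lborel. f (x + y) * bump x r (x + y))"
      unfolding F_def by (rule lborel_integral_shift[symmetric]) simp
    then show ?thesis using bump_shift[of x x r] by (simp add: add.commute)
  qed
  have Fc: "continuous_on UNIV F"
  proof (rule uniformly_continuous_imp_continuous, unfold uniformly_continuous_on_def, intro allI impI)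
    fix e :: real assume "e > 0"
    then have "e / (2 * I) > 0" using I by simp
    then obtain d where d: "d > 0" "\<And>x y. dist x y < d \<Longrightarrow> \<bar>f x - f y\<bar> < e / (2 * I)"
      using f(1) unfolding uniformly_continuous_on_def dist_real_def by (metis UNIV_I)
    have "dist (F x') (F x) < e" if "dist x' x < d" for x x'
    proof -
      have sh: "bdd_borel (\<lambda>y. f (z + y))" for z using bdd_borel_shift[OF fb, of z] by (simp add: add.commute)
      have "F x' - F x = (LINT y|lborel. (f (x' + y) - f (x + y)) * bump 0 r y)"
        unfolding F' left_diff_distrib
        by (intro Bochner_Integration.integral_diff[symmetric] mi sh)
      then have "\<bar>F x' - F x\<bar> \<le> (LINT y|lborel. \<bar>(f (x' + y) - f (x + y)) * bump 0 r y\<bar>)"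
        using integral_abs_bound[of lborel "\<lambda>y. (f (x' + y) - f (x + y)) * bump 0 r y"] by simp
      also have "\<dots> \<le> (LINT (y::'a)|lborel. e / (2 * I) * bump 0 r y)"
      proof (rule integral_mono)
        show "integrable lborel (\<lambda>y. \<bar>(f (x' + y) - f (x + y)) * bump 0 r y\<bar>)"
          by (intro integrable_abs mi bdd_borel_diff sh)
        fix y :: 'a
        have "\<bar>f (x' + y) - f (x + y)\<bar> \<le> e / (2 * I)"
          using d(2)[of "x' + y" "x + y"] that by (simp add: dist_norm)
        then show "\<bar>(f (x' + y) - f (x + y)) * bump 0 r y\<bar> \<le> e / (2 * I) * bump 0 r y"
          unfolding abs_mult abs_of_nonneg[OF bump_nonneg] by (rule mult_right_mono[OF _ bump_nonneg])
      qed (use bi in auto)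
      also have "\<dots> = e / 2" using I bI[of 0] by simp
      finally show ?thesis using \<open>e > 0\<close> by (simp add: dist_real_def)
    qed
    then show "\<exists>d>0. \<forall>x\<in>UNIV. \<forall>x'\<in>UNIV. dist x' x < d \<longrightarrow> dist (F x') (F x) < e"
      using d(1) by blast
  qed
  have Fx0: "F x0 \<ge> 3 / 4 * M * I" using abs_le_D2[OF near[of x0]] unfolding M_def by linarith
  have Fout: "F x \<le> M / 4 * I" if "x \<notin> U" for x
    using abs_le_D1[OF near[of x]] mult_nonpos_nonneg[OF out[OF that] less_imp_le[OF I]] by linarith
  have MI: "M * I > 0" using M I by simp
  have "F x < F x0" if "x \<notin> U" for x using Fout[OF that] Fx0 MI by linarith
  then obtain x1 where x1: "\<And>x. F x \<le> F x1" using continuous_attains_max[OF Fc U] by blast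
  have Fx1: "F x1 \<ge> 3 / 4 * M * I" using x1[of x0] Fx0 by simp
  have "f x1 * I \<ge> (1 / 2 * M) * I" using abs_le_D1[OF near[of x1]] Fx1 by linarith
  then have fx1: "f x1 \<ge> 1 / 2 * M" using I by (simp only: mult_le_cancel_right_pos)
  \<comment> \<open>\<open>f x1\<close> is at least M / 2 and \<open>f\<close> varies by less than M
    / 4 over this ball, so it stays positive there, which is impossible off
    \<open>U\<close>.\<close>
  have "cball x1 r \<subseteq> U"
  proof
    fix x assume "x \<in> cball x1 r"
    then have "\<bar>f x1 - f x\<bar> < M / 4" using \<delta>(2) r by simp
    then have "f x > 0" using fx1 M by linarith
    then show "x \<in> U" using out by (meson not_le)
  qed
  then have test: "bump x1 r \<in> test_functions U" using bump_test_function[OF r(1)] by blast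
  have C2: "compact_C2 (bump x1 r)" using r by (simp add: bump_compact_C2)
  obtain R where R: "R > 0" "\<And>x. x \<in> U \<Longrightarrow> norm x \<le> R" using U bounded_pos by metis
  \<comment> \<open>A jump from \<open>x1\<close> longer than this leaves \<open>U\<close>, where
    \<open>F\<close> is below its maximum by at least M I / 2.\<close>
  define R' where "R' = R + norm x1"
  have R': "R' > 0" using R(1) by (simp add: R'_def add_pos_nonneg)
  \<comment> \<open>The pairing equals the truncated operator of \<open>F\<close> at its maximum, an
    integral of a nonnegative function. The jumps beyond \<open>R'\<close> alone give a positive
    lower bound independent of \<epsilon>, which in the limit contradicts
    \<open>sub\<close>.\<close>
  have key: "1 / 2 * M * I * kernel_mass TYPE('a) R' \<le> (LINT x|lborel. f x * trunc_lap \<alpha> \<epsilon> (bump x1 r) x)"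
    if e: "0 < \<epsilon>" "\<epsilon> \<le> R'" for \<epsilon>
  proof -
    let ?k = "trunc_kernel \<alpha> \<epsilon> :: 'a \<Rightarrow> real" and ?b = "bump x1 r"
    have bm: "?b \<in> borel_measurable borel" by simp
    have Fz: "(LINT x|lborel. f x * ?b (x + z)) = F (x1 - z)" for z
      by (simp add: F_def bump_shift)
    have Fb: "bdd_borel (\<lambda>z. F (x1 - z))"
    proof (rule bdd_borelI)
      have "continuous_on UNIV (\<lambda>z. F (x1 - z))"
        by (rule continuous_on_compose2[OF Fc]) (auto intro!: continuous_intros)
      then show "(\<lambda>z. F (x1 - z)) \<in> borel_measurable borel" by (rule borel_measurable_continuous_onI)
      have "\<bar>f x\<bar> * I \<le> B * I" for x using f(2)[of x] I by (intro mult_right_mono) auto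
      then have fI: "\<bar>f x * I\<bar> \<le> B * I" for x using I by (simp add: abs_mult)
      show "\<bar>F (x1 - z)\<bar> \<le> B * I + M / 4 * I" for z
        using near[of "x1 - z"] fI[of "x1 - z"] by linarith
    qed
    have i1: "integrable lborel (\<lambda>x. f x * ?b x)" by (rule mi[OF fb])
    have i2: "integrable lborel (\<lambda>x. f x * (LINT z|lborel. ?k z * ?b (x + z)))"
      using lborel_pair.integrable_snd[OF integrable_convolution_pair(1)[OF integrable_trunc_kernel[OF e(1)] fb bi bm]]
      by (simp add: mult.left_commute[of "?k _"])
    have "(LINT x|lborel. f x * trunc_lap \<alpha> \<epsilon> ?b x) = (LINT x|lborel. kernel_mass TYPE('a) \<epsilon> * (f x * ?b x)
        - f x * (LINT z|lborel. ?k z * ?b (x + z)))"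
      by (intro Bochner_Integration.integral_cong) (simp_all add: trunc_lap_eq[OF e(1) b] algebra_simps)
    also have "\<dots> = kernel_mass TYPE('a) \<epsilon> * F x1 - (LINT x|lborel. f x * (LINT z|lborel. ?k z * ?b (x + z)))"
      using i1 i2 by (simp add: F_def)
    also have "(LINT x|lborel. f x * (LINT z|lborel. ?k z * ?b (x + z))) = (LINT z|lborel. ?k z * F (x1 - z))"
      unfolding convolution_swap[OF e(1) fb bi bm] Fz ..
    also have "kernel_mass TYPE('a) \<epsilon> * F x1 - (LINT z|lborel. ?k z * F (x1 - z))
        = (LINT z|lborel. ?k z * F x1) - (LINT z|lborel. ?k z * F (x1 - z))"
      by (simp add: kernel_mass_def)
    also have "\<dots> = (LINT z|lborel. ?k z * F x1 - ?k z * F (x1 - z))"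
      by (intro Bochner_Integration.integral_diff[symmetric] integrable_trunc_mult e(1) bdd_borel_const Fb)
    finally have eq: "(LINT x|lborel. f x * trunc_lap \<alpha> \<epsilon> ?b x) = (LINT z|lborel. ?k z * F x1 - ?k z * F (x1 - z))" .
    have "1 / 2 * M * I * kernel_mass TYPE('a) R' = (LINT (z::'a)|lborel. 1 / 2 * M * I * trunc_kernel \<alpha> R' z)"
      by (simp add: kernel_mass_def)
    also have "\<dots> \<le> (LINT z|lborel. ?k z * F x1 - ?k z * F (x1 - z))"
    proof (rule integral_mono)
      show "integrable lborel (\<lambda>z::'a. 1 / 2 * M * I * trunc_kernel \<alpha> R' z)"
        by (intro integrable_mult_right integrable_trunc_kernel R')
      show "integrable lborel (\<lambda>z. ?k z * F x1 - ?k z * F (x1 - z))"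
        by (intro Bochner_Integration.integrable_diff integrable_trunc_mult e(1) bdd_borel_const Fb)
      fix z :: 'a
      show "1 / 2 * M * I * trunc_kernel \<alpha> R' z \<le> ?k z * F x1 - ?k z * F (x1 - z)"
      proof (cases "norm z > R'")
        case True
        have "norm z \<le> norm x1 + norm (x1 - z)" using norm_triangle_ineq4[of x1 "x1 - z"] by simp
        then have "x1 - z \<notin> U" using R(2)[of "x1 - z"] True by (auto simp: R'_def)
        then have "1 / 2 * M * I \<le> F x1 - F (x1 - z)" using Fout Fx1 by fastforce
        then have "frac_kernel \<alpha> z * (1 / 2 * M * I) \<le> frac_kernel \<alpha> z * (F x1 - F (x1 - z))"
          by (intro mult_left_mono) auto
        then show ?thesis using True e by (simp add: trunc_kernel_def algebra_simps)
      next
        case False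
        have "0 \<le> ?k z * (F x1 - F (x1 - z))" using x1 by simp
        then show ?thesis using False by (simp add: trunc_kernel_def[of \<alpha> R'] right_diff_distrib)
      qed
    qed
    finally show ?thesis by (simp only: eq)
  qed
  define \<epsilon> where "\<epsilon> n = min 1 R' * inverse (real (Suc n))" for n
  have inv: "inverse (real (Suc n)) \<le> 1" for n by (simp add: divide_simps)
  have \<epsilon>: "0 < \<epsilon> n" for n using R' by (simp add: \<epsilon>_def)
  have \<epsilon>1: "\<epsilon> n \<le> 1" "\<epsilon> n \<le> R'" for n
    using mult_left_mono[OF inv[of n], of "min 1 R'"] R' by (auto simp: \<epsilon>_def)
  have "(\<lambda>n. min 1 R' * inverse (real (Suc n))) \<longlonglongrightarrow> min 1 R' * 0"
    by (intro tendsto_mult tendsto_const LIMSEQ_inverse_real_of_nat)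
  then have \<epsilon>0: "\<epsilon> \<longlonglongrightarrow> 0" by (simp add: \<epsilon>_def[abs_def])
  have "(\<lambda>n. LINT x|lborel. f x * trunc_lap \<alpha> (\<epsilon> n) (bump x1 r) x) \<longlonglongrightarrow> (LINT x|lborel. f x * frac_lim (bump x1 r) x)"
    by (rule frac_lim_integral_tendsto[OF C2 \<epsilon> \<epsilon>1(1) \<epsilon>0 fm f(2)]) simp
  then have "1 / 2 * M * I * kernel_mass TYPE('a) R' \<le> (LINT x|lborel. f x * frac_lim (bump x1 r) x)"
    by (rule LIMSEQ_le_const) (use key[OF \<epsilon> \<epsilon>1(2)] in blast)
  moreover have "1 / 2 * M * I * kernel_mass TYPE('a) R' > 0"
    using M I kernel_mass_pos[OF R', where 'a='a] by simp
  ultimately show False using sub[OF test bump_nonneg] by linarith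
qed

text \<open>Symmetry puts the truncated operator on \<open>v\<close>, where its sign is known for
  small \<epsilon>, and the sign survives the limit. This turns explicit subsolutions into
  distributional ones.\<close>

lemma frac_lim_integral_nonpos:
  fixes v :: "'a::euclidean_space \<Rightarrow> real"
  assumes v: "bdd_borel v" and \<phi>: "\<phi> \<in> test_functions U" "\<And>x. 0 \<le> \<phi> x"
    and d: "d > 0" and sub: "\<And>\<epsilon> x. 0 < \<epsilon> \<Longrightarrow> \<epsilon> < d \<Longrightarrow> x \<in> U \<Longrightarrow> trunc_lap \<alpha> \<epsilon> v x \<le> 0"
  shows "(LINT x|lborel. v x * frac_lim \<phi> x) \<le> 0"
proof -
  have C2: "compact_C2 \<phi>" using \<phi>(1) by (rule test_function_compact_C2)
  obtain B where B: "\<And>x. \<bar>v x\<bar> \<le> B" using bdd_borelE[OF v] by blast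
  define \<epsilon> where "\<epsilon> n = min 1 (d / 2) * inverse (real (Suc n))" for n
  have inv: "inverse (real (Suc n)) \<le> 1" for n by (simp add: divide_simps)
  have \<epsilon>: "0 < \<epsilon> n" for n using d by (simp add: \<epsilon>_def)
  have "\<epsilon> n \<le> min 1 (d / 2)" for n
    using mult_left_mono[OF inv[of n], of "min 1 (d / 2)"] d by (simp add: \<epsilon>_def)
  then have \<epsilon>1: "\<epsilon> n \<le> 1" "\<epsilon> n < d" for n using d by (smt (verit) min_def field_sum_of_halves)+
  have "(\<lambda>n. min 1 (d / 2) * inverse (real (Suc n))) \<longlonglongrightarrow> min 1 (d / 2) * 0"
    by (intro tendsto_mult tendsto_const LIMSEQ_inverse_real_of_nat)
  then have \<epsilon>0: "\<epsilon> \<longlonglongrightarrow> 0" by (simp add: \<epsilon>_def[abs_def])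
  have "(\<lambda>n. LINT x|lborel. v x * trunc_lap \<alpha> (\<epsilon> n) \<phi> x) \<longlonglongrightarrow> (LINT x|lborel. v x * frac_lim \<phi> x)"
    by (rule frac_lim_integral_tendsto[OF C2 \<epsilon> \<epsilon>1(1) \<epsilon>0 bdd_borel_measurable[OF v] B]) simp
  then show ?thesis
  proof (rule LIMSEQ_le_const2, intro exI[of _ 0] allI impI)
    fix n
    have "(LINT x|lborel. v x * trunc_lap \<alpha> (\<epsilon> n) \<phi> x) = (LINT x|lborel. \<phi> x * trunc_lap \<alpha> (\<epsilon> n) v x)"
      by (rule trunc_lap_symmetric[OF \<epsilon> v compact_C2_integrable[OF C2] compact_C2_bdd_borel[OF C2]])
    also have "\<dots> \<le> 0"
    proof -
      have "\<phi> x = 0" if "x \<notin> U" for x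
        using \<phi>(1) that closure_subset[of "{x. \<phi> x \<noteq> 0}"] by (auto simp: test_functions_def)
      then have "\<phi> x * trunc_lap \<alpha> (\<epsilon> n) v x \<le> 0" for x
        using sub[OF \<epsilon> \<epsilon>1(2)] \<phi>(2)[of x] by (cases "x \<in> U") (auto intro: mult_nonneg_nonpos)
      then have "0 \<le> (LINT x|lborel. - (\<phi> x * trunc_lap \<alpha> (\<epsilon> n) v x))"
        by (intro integral_nonneg_AE) simp
      then show ?thesis by simp
    qed
    finally show "(LINT x|lborel. v x * trunc_lap \<alpha> (\<epsilon> n) \<phi> x) \<le> 0" .
  qed
qed

text \<open>Symmetry moves the truncated operator onto the constant, which it annihilates. Needed to
  pass from \<open>u\<close> to \<open>1 - u\<close>.\<close>

lemma frac_lim_integral_const: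
  fixes \<phi> :: "'a::euclidean_space \<Rightarrow> real"
  assumes \<phi>: "compact_C2 \<phi>"
  shows "(LINT x|lborel. c * frac_lim \<phi> x) = 0"
proof -
  define \<epsilon> where "\<epsilon> n = inverse (real (Suc n))" for n
  have \<epsilon>: "0 < \<epsilon> n" "\<epsilon> n \<le> 1" for n by (simp_all add: \<epsilon>_def divide_simps)
  have \<epsilon>0: "\<epsilon> \<longlonglongrightarrow> 0" unfolding \<epsilon>_def by (rule LIMSEQ_inverse_real_of_nat)
  have "(\<lambda>n. LINT x|lborel. c * trunc_lap \<alpha> (\<epsilon> n) \<phi> x) \<longlonglongrightarrow> (LINT x|lborel. c * frac_lim \<phi> x)"
    by (rule frac_lim_integral_tendsto[OF \<phi> \<epsilon> \<epsilon>0, where B = "\<bar>c\<bar>"]) auto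
  moreover have "(LINT x|lborel. c * trunc_lap \<alpha> (\<epsilon> n) \<phi> x) = 0" for n
    using trunc_lap_symmetric[OF \<epsilon>(1)[of n] bdd_borel_const[of c] compact_C2_integrable[OF \<phi>] compact_C2_bdd_borel[OF \<phi>]]
    by simp
  ultimately show ?thesis by (simp only: LIMSEQ_const_iff)
qed

text \<open>The subsolution is a bump at \<open>p\<close> plus a large multiple of a bump at \<open>q\<close>, which pulls the
  operator below zero near \<open>p\<close>.\<close>

lemma distr_strong_max_principle:
  fixes f :: "'a::euclidean_space \<Rightarrow> real"
  assumes f: "uniformly_continuous_on UNIV f" "\<And>x. \<bar>f x\<bar> \<le> B" "\<And>x. 0 \<le> f x"
    and V: "open V" "p \<in> V" "q \<notin> V" "f q > 0"
    and harm: "\<And>\<phi>. \<phi> \<in> test_functions V \<Longrightarrow> (LINT x|lborel. f x * frac_lim \<phi> x) = 0"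
  shows "f p > 0"
proof -
  have fc: "continuous_on UNIV f" using f(1) by (rule uniformly_continuous_imp_continuous)
  have fb: "bdd_borel f" using fc f(2) by (auto intro!: bdd_borelI borel_measurable_continuous_onI)
  define d where "d = dist p q"
  have d: "d > 0" using V by (auto simp: d_def)
  obtain r0 where r0: "r0 > 0" "cball p r0 \<subseteq> V" using V(1,2) open_contains_cball by blast
  \<comment> \<open>Radii of at most a quarter of the distance keep the balls at \<open>p\<close>
    and \<open>q\<close> at least d / 2 apart, so truncations below d / 2 do not cut their
    interaction.\<close>
  define r where "r = min r0 (d / 4)"
  have r: "r > 0" "r \<le> d / 4" "cball p r \<subseteq> V" using r0 d by (auto simp: r_def)
  define c where "c = f q / 2"
  have c: "c > 0" using V by (simp add: c_def)
  obtain s0 where s0: "s0 > 0" "\<And>x. dist x q < s0 \<Longrightarrow> \<bar>f x - f q\<bar> < c"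
    using f(1) c unfolding uniformly_continuous_on_def dist_real_def by (metis UNIV_I)
  define s where "s = min s0 (d / 4)"
  have s: "s > 0" "s \<le> d / 4" using s0 d by (auto simp: s_def)
  have fs: "f x \<ge> c" if "x \<in> ball q s" for x
  proof -
    have "\<bar>f x - f q\<bar> < c" using s0(2)[of x] that by (simp add: s_def dist_commute)
    then show ?thesis unfolding c_def by linarith
  qed
  define A where "A = bump p r"
  define Q where "Q = bump q s"
  have A: "compact_C2 A" and Q: "compact_C2 Q" using r s by (simp_all add: A_def Q_def bump_compact_C2)
  note bA = compact_C2_bdd_borel[OF A] and bQ = compact_C2_bdd_borel[OF Q]
  obtain C where C: "C \<ge> 0" "\<And>\<epsilon> x. \<epsilon> > 0 \<Longrightarrow> \<bar>trunc_lap \<alpha> \<epsilon> A x\<bar> \<le> C"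
    using compact_C2_trunc_lap_bound[OF A] by blast
  let ?b = "real DIM('a) + \<alpha>"
  have b: "?b > 0" using alpha_pos by simp
  \<comment> \<open>The kernel at distance 2 d, times the bump height, times the volume of the half
    ball: a lower bound for the pull of \<open>Q\<close> at points near \<open>p\<close>.\<close>
  define c3 where "c3 = 1 / (2 * d) powr ?b * exp (- (4 / 3)) * (unit_ball_vol DIM('a) * (s / 2) ^ DIM('a))"
  have c3: "c3 > 0" using d s by (simp add: c3_def)
  have disj: "x \<notin> ball q s" if "x \<in> ball p r" for x
  proof
    assume "x \<in> ball q s"
    then have "dist p x < r" "dist q x < s" using that by auto
    moreover have "d \<le> dist p x + dist q x"
      using dist_triangle[of p q x] by (simp add: d_def dist_commute)
    ultimately show False using r(2) s(2) d by linarith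
  qed
  have lapQ: "trunc_lap \<alpha> \<epsilon> Q x \<le> - c3" if e: "0 < \<epsilon>" "\<epsilon> < d / 2" and x: "x \<in> ball p r" for \<epsilon> x
  proof -
    have "c3 \<le> (LINT z|lborel. trunc_kernel \<alpha> \<epsilon> z * Q (x + z))"
      unfolding c3_def
    proof (rule integral_ge_on_ball[OF integrable_trunc_shift[OF e(1) bQ]])
      fix z assume "z \<in> ball (q - x) (s / 2)"
      then have z: "x + z \<in> ball q (s / 2)" by (simp add: dist_norm algebra_simps)
      have "dist q (x + z) < s / 2" "dist p x < r" using z x by auto
      moreover have "d \<le> dist p x + dist x (x + z) + dist q (x + z)"
        using dist_triangle[of p q x] dist_triangle[of x q "x + z"] by (simp add: d_def dist_commute)
      moreover have "dist x (x + z) \<le> dist p x + d + dist q (x + z)"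
        using dist_triangle[of x "x + z" p] dist_triangle[of p "x + z" q] by (simp add: d_def dist_commute)
      moreover have "dist x (x + z) = norm z" by (simp add: dist_norm)
      ultimately have n: "\<epsilon> < norm z" "norm z \<le> 2 * d" using r(2) s e(2) d by auto
      have "1 / (2 * d) powr ?b \<le> trunc_kernel \<alpha> \<epsilon> z"
        using n b e(1) d by (auto simp: trunc_kernel_def frac_kernel_def
            intro!: divide_left_mono powr_mono2 mult_pos_pos)
      moreover have "exp (- (4 / 3)) \<le> Q (x + z)" unfolding Q_def by (rule bump_half_ball[OF s(1) z])
      ultimately show "1 / (2 * d) powr ?b * exp (- (4 / 3)) \<le> trunc_kernel \<alpha> \<epsilon> z * Q (x + z)"
        by (intro mult_mono) auto
    qed (use s in \<open>auto simp: Q_def bump_nonneg\<close>)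
    moreover have "Q x = 0" using disj[OF x] s by (simp add: Q_def bump_eq_0_iff)
    ultimately show ?thesis by (simp add: trunc_lap_eq[OF e(1) bQ])
  qed
  \<comment> \<open>The pull \<open>K * c3\<close> of the distant bump cancels the worst value
    \<open>C\<close> of the operator on \<open>A\<close>.\<close>
  define K where "K = C / c3"
  have K: "K \<ge> 0" "K * c3 = C" using C c3 by (auto simp: K_def)
  \<comment> \<open>Scaled so that \<open>v\<close> stays below \<open>c\<close>, hence below
    \<open>f\<close>, on the ball at \<open>q\<close>.\<close>
  define \<eta> where "\<eta> = c / (1 + K)"
  have \<eta>: "\<eta> > 0" "\<eta> * K \<le> c" using c K(1) by (auto simp: \<eta>_def field_simps)
  define v where "v x = \<eta> * (A x + K * Q x)" for x
  have bv: "bdd_borel v" unfolding v_def[abs_def] by (intro bdd_borel_cmult bdd_borel_add bA bQ)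
  have lapv: "trunc_lap \<alpha> \<epsilon> v x \<le> 0" if e: "0 < \<epsilon>" "\<epsilon> < d / 2" and x: "x \<in> ball p r" for \<epsilon> x
  proof -
    have "K * trunc_lap \<alpha> \<epsilon> Q x \<le> K * (- c3)" by (rule mult_left_mono[OF lapQ[OF that] K(1)])
    then have "trunc_lap \<alpha> \<epsilon> A x + K * trunc_lap \<alpha> \<epsilon> Q x \<le> 0"
      using C(2)[OF e(1), of x] K(2) by (simp add: abs_le_iff)
    then show ?thesis unfolding v_def[abs_def] using \<eta>(1)
      by (simp add: trunc_lap_cmult trunc_lap_add[OF e(1) bA bdd_borel_cmult[OF bQ]] mult_nonneg_nonpos)
  qed
  obtain RA where RA: "\<And>x. RA < norm x \<Longrightarrow> A x = 0" using A by (auto simp: compact_C2_def)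
  obtain RQ where RQ: "\<And>x. RQ < norm x \<Longrightarrow> Q x = 0" using Q by (auto simp: compact_C2_def)
  have uv: "uniformly_continuous_on UNIV v"
  proof (rule uniformly_continuous_compact_support)
    show "continuous_on UNIV v" unfolding v_def[abs_def]
      using A Q by (auto simp: compact_C2_def intro!: continuous_intros)
    show "v x = 0" if "max RA RQ < norm x" for x using RA[of x] RQ[of x] that by (simp add: v_def)
  qed
  obtain Bv where Bv: "\<And>x. \<bar>v x\<bar> \<le> Bv" using bdd_borelE[OF bv] by blast
  \<comment> \<open>The comparison takes place on \<open>ball p r\<close> only; outside it
    \<open>v\<close> is absorbed by the positivity of \<open>f\<close> near \<open>q\<close> and
    vanishes elsewhere.\<close>
  have "v p - f p \<le> 0"
  proof (rule distr_max_principle[where f = "\<lambda>x. v x - f x" and U = "ball p r"])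
    show "uniformly_continuous_on UNIV (\<lambda>x. v x - f x)"
      by (intro uniformly_continuous_on_diff uv f(1))
    show "\<bar>v x - f x\<bar> \<le> Bv + B" for x using Bv[of x] f(2)[of x] by linarith
    show "v x - f x \<le> 0" if "x \<notin> ball p r" for x
    proof (cases "x \<in> ball q s")
      case True
      have "A x = 0" using that r by (simp add: A_def bump_eq_0_iff)
      then have "v x = \<eta> * K * Q x" by (simp add: v_def)
      also have "\<dots> \<le> \<eta> * K * 1" using \<eta> K by (intro mult_left_mono) (auto simp: Q_def bump_le_1)
      finally show ?thesis using fs[OF True] \<eta>(2) by simp
    next
      case False
      then have "A x = 0" "Q x = 0" using that r s by (simp_all add: A_def Q_def bump_eq_0_iff)
      then show ?thesis using f(3)[of x] by (simp add: v_def)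
    qed
    fix \<phi> :: "'a \<Rightarrow> real" assume \<phi>: "\<phi> \<in> test_functions (ball p r)" "\<And>x. 0 \<le> \<phi> x"
    have C2: "compact_C2 \<phi>" using \<phi>(1) by (rule test_function_compact_C2)
    have "\<phi> \<in> test_functions V"
      using \<phi>(1) r(3) ball_subset_cball[of p r] unfolding test_functions_def by blast
    then have "(LINT x|lborel. f x * frac_lim \<phi> x) = 0" by (rule harm)
    moreover have "(LINT x|lborel. (v x - f x) * frac_lim \<phi> x)
        = (LINT x|lborel. v x * frac_lim \<phi> x) - (LINT x|lborel. f x * frac_lim \<phi> x)"
      unfolding left_diff_distrib
      by (intro Bochner_Integration.integral_diff frac_lim_integrable C2 bv fb)
    moreover have "(LINT x|lborel. v x * frac_lim \<phi> x) \<le> 0"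
      by (rule frac_lim_integral_nonpos[OF bv \<phi>, of "d / 2"]) (use d lapv in auto)
    ultimately show "(LINT x|lborel. (v x - f x) * frac_lim \<phi> x) \<le> 0" by simp
  qed simp
  moreover have "A p > 0" using r by (simp add: A_def bump_pos_iff)
  then have "v p > 0" using \<eta> K by (auto simp: v_def Q_def bump_nonneg intro!: mult_pos_pos add_pos_nonneg)
  ultimately show ?thesis by simp
qed

section \<open>Dilations of harmonic functions\<close>

lemma frac_lim_scale:
  fixes \<phi> :: "'a::euclidean_space \<Rightarrow> real"
  assumes \<phi>: "compact_C2 \<phi>" and s: "s > 0"
  shows "frac_lim (\<lambda>x. \<phi> ((1 / s) *\<^sub>R x)) y = s powr (- \<alpha>) * frac_lim \<phi> ((1 / s) *\<^sub>R y)"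
proof -
  note [measurable] = bdd_borel_measurable[OF compact_C2_bdd_borel[OF \<phi>]]
  have "second_diff (\<lambda>x. \<phi> ((1 / s) *\<^sub>R x)) y z = second_diff \<phi> ((1 / s) *\<^sub>R y) ((1 / s) *\<^sub>R z)" for z
    by (simp add: second_diff_def scaleR_add_right scaleR_diff_right)
  then show ?thesis unfolding frac_lim_def
    using integral_frac_kernel_scale[of "second_diff \<phi> ((1 / s) *\<^sub>R y)" s] s by simp
qed

lemma test_function_scale:
  fixes \<phi> :: "'a::euclidean_space \<Rightarrow> real"
  assumes \<phi>: "\<phi> \<in> test_functions {x. s *\<^sub>R x \<in> \<Omega>}" and s: "s > 0"
  shows "(\<lambda>x. \<phi> ((1 / s) *\<^sub>R x)) \<in> test_functions \<Omega>"
proof -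
  have "{x. \<phi> ((1 / s) *\<^sub>R x) \<noteq> 0} = (\<lambda>x. s *\<^sub>R x) ` {x. \<phi> x \<noteq> 0}"
  proof (intro set_eqI iffI)
    fix x assume "x \<in> {x. \<phi> ((1 / s) *\<^sub>R x) \<noteq> 0}"
    then show "x \<in> (\<lambda>x. s *\<^sub>R x) ` {x. \<phi> x \<noteq> 0}"
      using s by (intro image_eqI[of _ _ "(1 / s) *\<^sub>R x"]) auto
  qed (use s in auto)
  then have cl: "closure {x. \<phi> ((1 / s) *\<^sub>R x) \<noteq> 0} = (\<lambda>x. s *\<^sub>R x) ` closure {x. \<phi> x \<noteq> 0}"
    by (simp add: closure_scaleR)
  have C: "\<forall>k. C_times k \<phi>" and c: "compact (closure {x. \<phi> x \<noteq> 0})"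
    and sub: "closure {x. \<phi> x \<noteq> 0} \<subseteq> {x. s *\<^sub>R x \<in> \<Omega>}"
    using \<phi> unfolding test_functions_def by blast+
  show ?thesis unfolding test_functions_def mem_Collect_eq cl
    using C c sub by (auto intro!: C_times_scale compact_scaling)
qed

text \<open>The dilation is moved onto the test function, where homogeneity of the kernel produces
  only the factor \<open>s powr \<alpha>\<close>.\<close>

lemma frac_harmonic_rescale:
  fixes u :: "'a::euclidean_space \<Rightarrow> real"
  assumes u: "bdd_borel u" and s: "s > 0"
    and harm: "\<And>\<phi>. \<phi> \<in> test_functions \<Omega> \<Longrightarrow> (LINT x|lborel. u x * frac_lim \<phi> x) = 0"
    and \<phi>: "\<phi> \<in> test_functions {x. s *\<^sub>R x \<in> \<Omega>}"
  shows "(LINT x|lborel. u (s *\<^sub>R x) * frac_lim \<phi> x) = 0"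
proof -
  let ?\<psi> = "\<lambda>x. \<phi> ((1 / s) *\<^sub>R x)"
  note \<psi> = test_function_scale[OF \<phi> s]
  have C2: "compact_C2 \<phi>" using \<phi> by (rule test_function_compact_C2)
  note [measurable] = bdd_borel_measurable[OF u]
  have [measurable]: "frac_lim ?\<psi> \<in> borel_measurable borel"
    using frac_lim_integrable[OF test_function_compact_C2[OF \<psi>] bdd_borel_const[of 1]] by simp
  have "u (s *\<^sub>R x) * frac_lim \<phi> x = s powr \<alpha> * (u (0 + s *\<^sub>R x) * frac_lim ?\<psi> (0 + s *\<^sub>R x))" for x
    using frac_lim_scale[OF C2 s, of "s *\<^sub>R x"] s by (simp add: powr_minus field_simps)
  then have "(LINT x|lborel. u (s *\<^sub>R x) * frac_lim \<phi> x)
      = s powr \<alpha> * (LINT x|lborel. u (0 + s *\<^sub>R x) * frac_lim ?\<psi> (0 + s *\<^sub>R x))"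
    by (simp only: integral_mult_right_zero)
  moreover have "(LINT x|lborel. u (0 + s *\<^sub>R x) * frac_lim ?\<psi> (0 + s *\<^sub>R x)) * \<bar>s\<bar> ^ DIM('a) = 0"
    using lborel_integral_affine[of "\<lambda>x. u x * frac_lim ?\<psi> x" s 0] s harm[OF \<psi>] by simp
  ultimately show ?thesis using s by simp
qed

end

subsection \<open>The problem (P)\<close>

lemma finite_cone_ball:
  fixes p e :: "'a::euclidean_space"
  assumes e: "norm e = 1" and \<theta>: "0 < \<theta>" "\<theta> < pi / 2" and t: "0 < t" "2 * t \<le> h"
  shows "ball (p + t *\<^sub>R e) (t * ((1 - cos \<theta>) / (1 + cos \<theta>))) \<subseteq> finite_cone p e \<theta> h"
proof
  define c where "c = cos \<theta>"
  \<comment> \<open>Chosen so that (1 + s) c = 1 - s: on the ball the norm is at most t (1 + s) and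
    the axial part at least t (1 - s), which is exactly the cone inequality.\<close>
  define s where "s = (1 - c) / (1 + c)"
  have c: "0 < c" "c < 1"
    using \<theta> cos_gt_zero_pi[of \<theta>] cos_monotone_0_pi[of 0 \<theta>] by (auto simp: c_def)
  have s: "0 < s" "s < 1" and cs: "(1 + s) * c \<le> 1 - s" using c by (auto simp: s_def field_simps)
  fix x assume "x \<in> ball (p + t *\<^sub>R e) (t * ((1 - cos \<theta>) / (1 + cos \<theta>)))"
  then have x: "norm (x - p - t *\<^sub>R e) \<le> t * s"
    by (simp add: dist_norm norm_minus_commute s_def c_def algebra_simps)
  define z where "z = x - p"
  have "\<bar>(z - t *\<^sub>R e) \<bullet> e\<bar> \<le> t * s"
    using Cauchy_Schwarz_ineq2[of "z - t *\<^sub>R e" e] x e by (simp add: z_def)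
  moreover have "(z - t *\<^sub>R e) \<bullet> e = z \<bullet> e - t"
    using e by (simp add: inner_diff_left norm_eq_1)
  ultimately have ze: "t * (1 - s) \<le> z \<bullet> e" "z \<bullet> e \<le> t * (1 + s)" by (auto simp: algebra_simps abs_le_iff)
  have "norm z \<le> t * (1 + s)"
    using norm_triangle_ineq[of "z - t *\<^sub>R e" "t *\<^sub>R e"] x e t by (simp add: z_def algebra_simps)
  then have "norm z * c \<le> t * (1 + s) * c" using c by (intro mult_right_mono) auto
  also have "\<dots> \<le> t * (1 - s)" using cs t by (simp add: mult.assoc)
  finally have "norm z * cos \<theta> \<le> z \<bullet> e" using ze by (simp add: c_def)
  moreover have "t * (1 + s) \<le> t * 2" using s t by (intro mult_left_mono) auto
  then have "z \<bullet> e \<le> h" using ze t by linarith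
  ultimately show "x \<in> finite_cone p e \<theta> h"
    unfolding finite_cone_def by (intro CollectI exI[of _ z]) (simp add: z_def)
qed

lemma uniform_exterior_cone_corkscrew:
  fixes \<Omega> :: "'a::euclidean_space set"
  assumes "uniform_exterior_cone \<Omega>" "open \<Omega>"
  obtains c0 r0 where "0 < c0" "0 < r0" "\<And>p r. p \<in> frontier \<Omega> \<Longrightarrow> 0 < r \<Longrightarrow> r \<le> r0 \<Longrightarrow>
      \<exists>q. ball q (c0 * r) \<subseteq> ball p r \<and> ball q (c0 * r) \<inter> \<Omega> = {}"
proof -
  obtain \<theta> h where th: "0 < \<theta>" "\<theta> < pi / 2" "0 < h"
    "\<And>p. p \<in> frontier \<Omega> \<Longrightarrow> \<exists>e. norm e = 1 \<and> finite_cone p e \<theta> h \<inter> closure \<Omega> = {p}"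
    using assms(1) unfolding uniform_exterior_cone_def by blast
  define s where "s = (1 - cos \<theta>) / (1 + cos \<theta>)"
  have "0 < cos \<theta>" "cos \<theta> < 1"
    using th cos_gt_zero_pi[of \<theta>] cos_monotone_0_pi[of 0 \<theta>] by auto
  then have s: "0 < s" "s < 1" by (auto simp: s_def)
  have "\<exists>q. ball q (s / 2 * r) \<subseteq> ball p r \<and> ball q (s / 2 * r) \<inter> \<Omega> = {}"
    if p: "p \<in> frontier \<Omega>" and r: "0 < r" "r \<le> h" for p r
  proof -
    obtain e where e: "norm e = 1" "finite_cone p e \<theta> h \<inter> closure \<Omega> = {p}" using th(4)[OF p] by blast
    \<comment> \<open>Height r / 2 keeps the ball inside \<open>ball p r\<close> and, since r <= h,
      below the top of the cone. The cone meets the closure only at \<open>p\<close>, which the open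
      set does not contain.\<close>
    let ?q = "p + (r / 2) *\<^sub>R e"
    have "ball ?q (r / 2 * s) \<subseteq> finite_cone p e \<theta> h"
      unfolding s_def by (rule finite_cone_ball[OF e(1) th(1,2)]) (use r in auto)
    then have "ball ?q (r / 2 * s) \<inter> \<Omega> \<subseteq> finite_cone p e \<theta> h \<inter> closure \<Omega>"
      using closure_subset[of \<Omega>] by blast
    then have "ball ?q (r / 2 * s) \<inter> \<Omega> \<subseteq> {p}" by (simp only: e(2))
    moreover have "p \<notin> \<Omega>" using p assms(2) by (simp add: frontier_def interior_open)
    ultimately have "ball ?q (r / 2 * s) \<inter> \<Omega> = {}" by blast
    moreover have "ball ?q (r / 2 * s) \<subseteq> ball p r"
    proof
      fix x assume "x \<in> ball ?q (r / 2 * s)"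
      then have "dist ?q x < r / 2 * s" by simp
      also have "\<dots> < r / 2 * 1" using s r by (intro mult_strict_left_mono) auto
      finally have "dist ?q x < r / 2" by simp
      moreover have "dist p ?q = r / 2" using e r by (simp add: dist_norm)
      ultimately show "x \<in> ball p r" using dist_triangle[of p x ?q] by simp
    qed
    ultimately show ?thesis by (intro exI[of _ ?q]) (simp add: mult.commute)
  qed
  then show ?thesis using s(1) th(3) by (intro that[of "s / 2" h]) auto
qed

section \<open>Existence of a solution of (P)\<close>

locale problem_P = frac_order \<alpha> for \<alpha> :: real +
  fixes D0 D1 :: "'a::euclidean_space set"
  assumes bounded_D0: "bounded D0" and open_D0: "open D0" and star_D0: "starshaped D0"
    and star_D1: "starshaped D1" and open_D1: "open D1" and zero_D1: "0 \<in> D1"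
    and D1_D0: "closure D1 \<subseteq> D0"
    and cone: "uniform_exterior_cone (D0 - closure D1)"
begin

abbreviation "\<Omega> \<equiv> D0 - closure D1"

lemma open_annulus: "open \<Omega>" and bounded_annulus: "bounded \<Omega>"
  using open_D0 bounded_D0 by (auto intro: bounded_subset)

text \<open>Continuity and vanishing off the bounded set \<open>D0\<close> give boundedness and
  weighted integrability, so of the distributional condition only the equation tested with
  \<open>frac_lim\<close> remains.\<close>

lemma solution_iff:
  "solves_P \<alpha> D0 D1 u \<longleftrightarrow> continuous_on UNIV u \<and> (\<forall>x. x \<notin> D0 \<longrightarrow> u x = 0) \<and> (\<forall>x\<in>closure D1. u x = 1) \<and>
     (\<forall>\<phi>\<in>test_functions \<Omega>. (LINT x|lborel. u x * frac_lim \<phi> x) = 0)"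
  (is "_ \<longleftrightarrow> ?R")
proof
  assume "solves_P \<alpha> D0 D1 u"
  then show ?R
    unfolding solves_P_def frac_harmonic_on_def
    using frac_lap_distr_eq_0_iff[OF test_function_compact_C2] by blast
next
  assume R: ?R
  obtain r where r: "\<And>x. x \<in> D0 \<Longrightarrow> norm x \<le> r" using bounded_D0 bounded_iff by blast
  have "\<forall>x. x \<notin> cball 0 r \<longrightarrow> u x = 0" using R r by auto
  then obtain B where B: "B \<ge> 0" "\<And>x. \<bar>u x\<bar> \<le> B"
    using bounded_of_compact_support[of u "cball 0 r"] R by auto
  have um: "u \<in> borel_measurable borel" using R by (auto intro: borel_measurable_continuous_onI)
  have "integrable lborel (\<lambda>x. \<bar>u x\<bar> / (1 + norm x) powr (real DIM('a) + \<alpha>))"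
  proof (rule Bochner_Integration.integrable_bound)
    show "integrable lborel (\<lambda>x::'a. B * indicator (cball 0 r) x)"
      using emeasure_bounded_finite[OF bounded_cball]
      by (intro integrable_mult_right integrable_real_indicator) auto
    show "(\<lambda>x. \<bar>u x\<bar> / (1 + norm x) powr (real DIM('a) + \<alpha>)) \<in> borel_measurable lborel"
      using um by simp
    have "\<bar>u x\<bar> / (1 + norm x) powr (real DIM('a) + \<alpha>) \<le> B * indicator (cball 0 r) x" for x
    proof (cases "x \<in> cball 0 r")
      case True
      have "1 \<le> (1 + norm x) powr (real DIM('a) + \<alpha>)" using alpha_pos by (intro ge_one_powr_ge_zero) auto
      then have "\<bar>u x\<bar> / (1 + norm x) powr (real DIM('a) + \<alpha>) \<le> \<bar>u x\<bar> / 1"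
        by (intro divide_left_mono) auto
      also have "\<dots> \<le> B * indicator (cball 0 r) x" using B(2)[of x] True by simp
      finally show ?thesis .
    next
      case False
      then have "x \<notin> D0" using r[of x] by auto
      then show ?thesis using R False by simp
    qed
    then show "AE x in lborel. norm (\<bar>u x\<bar> / (1 + norm x) powr (real DIM('a) + \<alpha>))
        \<le> norm (B * indicator (cball 0 r) x)" using B(1) by (simp add: abs_mult)
  qed
  then have "u \<in> L1_weighted \<alpha>" using um by (simp add: L1_weighted_def)
  moreover have "bounded (range u)" using B(2) by (auto simp: bounded_iff)
  ultimately show "solves_P \<alpha> D0 D1 u"
    unfolding solves_P_def frac_harmonic_on_def
    using R frac_lap_distr_eq_0_iff[OF test_function_compact_C2] by blast
qed

lemma solution_exists: "\<exists>u. solves_P \<alpha> D0 D1 u"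
proof -
  have "compact (closure D1)" using D1_D0 bounded_D0 bounded_subset compact_eq_bounded_closed by blast
  moreover have "closed (- D0)" using open_D0 by blast
  moreover have "closure D1 \<inter> - D0 = {}" using D1_D0 by blast
  \<comment> \<open>The exterior data jump from 1 to 0 only across this positive distance, so they
    are locally constant at scale \<open>d0\<close>.\<close>
  ultimately obtain d0 where d0: "d0 > 0" "\<And>x y. x \<in> closure D1 \<Longrightarrow> y \<in> - D0 \<Longrightarrow> d0 \<le> dist x y"
    using separate_compact_closed by metis
  obtain c0 r0 where c0: "0 < c0" "0 < r0" "\<And>p r. p \<in> frontier \<Omega> \<Longrightarrow> 0 < r \<Longrightarrow> r \<le> r0 \<Longrightarrow>
      \<exists>q. ball q (c0 * r) \<subseteq> ball p r \<and> ball q (c0 * r) \<inter> \<Omega> = {}"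
    using uniform_exterior_cone_corkscrew[OF cone open_annulus] by blast
  interpret dirichlet_data \<alpha> \<Omega> "indicator (closure D1)" c0 r0 d0
  proof
    show "indicator (closure D1) x = (indicator (closure D1) y :: real)"
      if "x \<notin> \<Omega>" "y \<notin> \<Omega>" "dist x y < d0" for x y
      using that d0(2)[of x y] d0(2)[of y x] by (auto simp: indicator_def dist_commute)
  qed (use open_annulus bounded_annulus d0 c0 in \<open>auto simp: indicator_def\<close>)
  show ?thesis
  proof (rule dirichlet_solution_exists)
    fix v assume "continuous_on UNIV v" "\<And>x. x \<notin> \<Omega> \<Longrightarrow> v x = indicator (closure D1) x"
      "\<And>\<phi>. \<phi> \<in> test_functions \<Omega> \<Longrightarrow> (LINT x|lborel. v x * frac_lim \<phi> x) = 0"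
    then have "solves_P \<alpha> D0 D1 v" unfolding solution_iff using D1_D0 by (auto simp: indicator_def)
    then show ?thesis by blast
  qed
qed

section \<open>Bounds for an arbitrary solution\<close>

context
  fixes u assumes u: "solves_P \<alpha> D0 D1 u"
begin

lemma u_cont: "continuous_on UNIV u" and u_out: "x \<notin> D0 \<Longrightarrow> u x = 0"
  and u_in: "x \<in> closure D1 \<Longrightarrow> u x = 1"
  and u_harm: "\<phi> \<in> test_functions \<Omega> \<Longrightarrow> (LINT x|lborel. u x * frac_lim \<phi> x) = 0"
  using u unfolding solution_iff by blast+

lemma u_uniformly_continuous: "uniformly_continuous_on UNIV u"
proof -
  obtain r where "\<And>x. x \<in> D0 \<Longrightarrow> norm x \<le> r" using bounded_D0 bounded_iff by blast
  then show ?thesis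
    using uniformly_continuous_compact_support[OF u_cont, of r] u_out by (meson not_le)
qed

lemma u_bounded: obtains B where "\<And>x. \<bar>u x\<bar> \<le> B"
  using u unfolding solves_P_def bounded_iff by auto

lemma u_bdd_borel: "bdd_borel u"
proof -
  obtain B where "\<And>x. \<bar>u x\<bar> \<le> B" using u_bounded by blast
  then show ?thesis using u_cont by (auto intro!: bdd_borelI borel_measurable_continuous_onI)
qed

lemma u_nonneg: "0 \<le> u x"
proof -
  obtain B where B: "\<And>x. \<bar>u x\<bar> \<le> B" using u_bounded by blast
  have "- u x \<le> 0"
  proof (rule distr_max_principle[OF _ _ bounded_annulus])
    show "uniformly_continuous_on UNIV (\<lambda>x. - u x)"
      using u_uniformly_continuous by (rule uniformly_continuous_on_minus)
    show "\<bar>- u x\<bar> \<le> B" for x using B by simp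
    show "- u x \<le> 0" if "x \<notin> \<Omega>" for x using that u_in[of x] u_out[of x] by (cases "x \<in> D0") auto
    show "(LINT x|lborel. - u x * frac_lim \<phi> x) \<le> 0" if "\<phi> \<in> test_functions \<Omega>" for \<phi>
      using u_harm[OF that] by simp
  qed
  then show ?thesis by simp
qed

lemma one_minus_u_harm:
  assumes "\<phi> \<in> test_functions \<Omega>"
  shows "(LINT x|lborel. (1 - u x) * frac_lim \<phi> x) = 0"
proof -
  have C2: "compact_C2 \<phi>" using assms by (rule test_function_compact_C2)
  have "(LINT x|lborel. (1 - u x) * frac_lim \<phi> x)
      = (LINT x|lborel. 1 * frac_lim \<phi> x) - (LINT x|lborel. u x * frac_lim \<phi> x)"
    unfolding left_diff_distrib
    by (intro Bochner_Integration.integral_diff frac_lim_integrable C2 bdd_borel_const u_bdd_borel)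
  then show ?thesis using frac_lim_integral_const[OF C2, of 1] u_harm[OF assms] by simp
qed

lemma one_minus_u_uniformly_continuous: "uniformly_continuous_on UNIV (\<lambda>x. 1 - u x)"
  by (intro uniformly_continuous_on_diff uniformly_continuous_on_const u_uniformly_continuous)

lemma u_le_1: "u x \<le> 1"
proof -
  obtain B where B: "\<And>x. \<bar>u x\<bar> \<le> B" using u_bounded by blast
  have "u x - 1 \<le> 0"
  proof (rule distr_max_principle[OF _ _ bounded_annulus])
    show "uniformly_continuous_on UNIV (\<lambda>x. u x - 1)"
      by (intro uniformly_continuous_on_diff uniformly_continuous_on_const u_uniformly_continuous)
    show "\<bar>u x - 1\<bar> \<le> B + 1" for x using B[of x] by linarith
    show "u x - 1 \<le> 0" if "x \<notin> \<Omega>" for x using that u_in[of x] u_out[of x] by (cases "x \<in> D0") auto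
    show "(LINT x|lborel. (u x - 1) * frac_lim \<phi> x) \<le> 0" if "\<phi> \<in> test_functions \<Omega>" for \<phi>
    proof -
      have "(u x - 1) * frac_lim \<phi> x = - ((1 - u x) * frac_lim \<phi> x)" for x by (simp add: algebra_simps)
      then have "(LINT x|lborel. (u x - 1) * frac_lim \<phi> x) = - (LINT x|lborel. (1 - u x) * frac_lim \<phi> x)"
        by (simp only: integral_minus)
      then show ?thesis using one_minus_u_harm[OF that] by simp
    qed
  qed
  then show ?thesis by simp
qed

lemma zero_closure_D1: "0 \<in> closure D1"
  using zero_D1 closure_subset by blast

lemma D0_not_UNIV: obtains q where "q \<notin> D0"
  using bounded_D0 not_bounded_UNIV by (metis UNIV_eq_I)

text \<open>The reference point of the strong principle is 0, where \<open>u\<close> is 1;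
  nonlocality lets it act on every component of the annulus.\<close>

lemma u_pos:
  assumes "p \<in> D0" shows "0 < u p"
proof (cases "p \<in> closure D1")
  case False
  show ?thesis
  proof (rule distr_strong_max_principle[OF u_uniformly_continuous _ u_nonneg open_annulus _ _ _ u_harm, of 1 p 0])
    show "\<bar>u x\<bar> \<le> 1" for x using u_nonneg[of x] u_le_1[of x] by simp
  qed (use assms False zero_closure_D1 u_in[OF zero_closure_D1] in auto)
qed (simp add: u_in)

text \<open>The strong principle for \<open>1 - u\<close>, with any point outside \<open>D0\<close>
  as reference.\<close>

lemma u_less_1:
  assumes "p \<in> \<Omega>" shows "u p < 1"
proof -
  obtain q where q: "q \<notin> D0" using D0_not_UNIV by blast
  have "1 - u p > 0"
  proof (rule distr_strong_max_principle[OF one_minus_u_uniformly_continuous _ _ open_annulus assms _ _ one_minus_u_harm, of 1 q])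
    show "\<bar>1 - u x\<bar> \<le> 1" "0 \<le> 1 - u x" for x using u_nonneg[of x] u_le_1[of x] by auto
  qed (use q u_out[OF q] in auto)
  then show ?thesis by simp
qed

section \<open>Comparison of a solution with its dilates\<close>

context
  fixes s :: real assumes s: "0 < s" "s < 1"
begin

lemma scale_D0: "x \<in> D0 \<Longrightarrow> s *\<^sub>R x \<in> D0" and scale_D1: "x \<in> closure D1 \<Longrightarrow> s *\<^sub>R x \<in> closure D1"
proof -
  show "s *\<^sub>R x \<in> D0" if "x \<in> D0"
  proof -
    have "s \<in> {0..1}" using s by simp
    then show ?thesis using star_D0 that unfolding starshaped_def by blast
  qed
  show "s *\<^sub>R x \<in> closure D1" if "x \<in> closure D1"
  proof -
    have "s \<in> {0..1}" using s by simp
    then have "(\<lambda>x. s *\<^sub>R x) ` D1 \<subseteq> D1" using star_D1 unfolding starshaped_def by blast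
    then have "(\<lambda>x. s *\<^sub>R x) ` closure D1 \<subseteq> closure D1" using closure_mono closure_scaleR by metis
    then show ?thesis using that by blast
  qed
qed

definition "common = \<Omega> \<inter> {x. s *\<^sub>R x \<in> \<Omega>}"

lemma open_common: "open common"
proof -
  have "open ((\<lambda>x. s *\<^sub>R x) -` \<Omega>)"
    by (rule open_vimage[OF open_annulus]) (intro continuous_intros)
  then show ?thesis using open_annulus by (simp add: common_def vimage_def open_Int)
qed

lemma diff_uniformly_continuous: "uniformly_continuous_on UNIV (\<lambda>x. u (s *\<^sub>R x) - u x)"
proof -
  have "uniformly_continuous_on UNIV (\<lambda>x. u (s *\<^sub>R x))"
    unfolding uniformly_continuous_on_def
  proof (intro allI impI)
    fix e :: real assume "e > 0"
    then obtain d where d: "d > 0" "\<And>x y. dist y x < d \<Longrightarrow> dist (u y) (u x) < e"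
      using u_uniformly_continuous unfolding uniformly_continuous_on_def by (metis UNIV_I)
    have "dist (u (s *\<^sub>R y)) (u (s *\<^sub>R x)) < e" if "dist y x < d" for x y
    proof (rule d(2))
      have "dist (s *\<^sub>R y) (s *\<^sub>R x) = s * dist y x"
        using s by (simp add: dist_norm scaleR_diff_right[symmetric])
      also have "\<dots> \<le> dist y x" using s by (simp add: mult_left_le_one_le)
      finally show "dist (s *\<^sub>R y) (s *\<^sub>R x) < d" using that by simp
    qed
    then show "\<exists>d>0. \<forall>x\<in>UNIV. \<forall>x'\<in>UNIV. dist x' x < d \<longrightarrow> dist (u (s *\<^sub>R x')) (u (s *\<^sub>R x)) < e"
      using d(1) by blast
  qed
  then show ?thesis by (intro uniformly_continuous_on_diff u_uniformly_continuous)
qed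

lemma diff_harm:
  assumes "\<phi> \<in> test_functions common"
  shows "(LINT x|lborel. (u (s *\<^sub>R x) - u x) * frac_lim \<phi> x) = 0"
proof -
  have t: "\<phi> \<in> test_functions \<Omega>" "\<phi> \<in> test_functions {x. s *\<^sub>R x \<in> \<Omega>}"
    using assms unfolding test_functions_def common_def by blast+
  have C2: "compact_C2 \<phi>" using assms by (rule test_function_compact_C2)
  have "bdd_borel (\<lambda>x. u (s *\<^sub>R x))" using u_bdd_borel unfolding bdd_borel_def by auto
  then have "(LINT x|lborel. (u (s *\<^sub>R x) - u x) * frac_lim \<phi> x)
      = (LINT x|lborel. u (s *\<^sub>R x) * frac_lim \<phi> x) - (LINT x|lborel. u x * frac_lim \<phi> x)"
    unfolding left_diff_distrib
    by (intro Bochner_Integration.integral_diff frac_lim_integrable C2 u_bdd_borel)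
  then show ?thesis
    using u_harm[OF t(1)] frac_harmonic_rescale[OF u_bdd_borel s(1) u_harm t(2)] by simp
qed

lemma u_scale_ge: "u x \<le> u (s *\<^sub>R x)"
proof -
  have "- (u (s *\<^sub>R x) - u x) \<le> 0"
  proof (rule distr_max_principle[where U = common and B = 1])
    show "uniformly_continuous_on UNIV (\<lambda>x. - (u (s *\<^sub>R x) - u x))"
      using diff_uniformly_continuous by (rule uniformly_continuous_on_minus)
    show "\<bar>- (u (s *\<^sub>R x) - u x)\<bar> \<le> 1" for x
      using u_nonneg[of x] u_le_1[of x] u_nonneg[of "s *\<^sub>R x"] u_le_1[of "s *\<^sub>R x"] by linarith
    show "bounded common" unfolding common_def using bounded_annulus by blast
    show "- (u (s *\<^sub>R x) - u x) \<le> 0" if x: "x \<notin> common" for x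
    proof -
      \<comment> \<open>Starshapedness of both sets leaves only these cases: either the value at
        \<open>x\<close> is 0 or the value at the contracted point is 1.\<close>
      consider "x \<notin> D0" | "s *\<^sub>R x \<in> closure D1"
        using x scale_D0[of x] scale_D1[of x] unfolding common_def by blast
      then show ?thesis using u_out[of x] u_in[of "s *\<^sub>R x"] u_nonneg[of "s *\<^sub>R x"] u_le_1[of x] by cases auto
    qed
    show "(LINT x|lborel. - (u (s *\<^sub>R x) - u x) * frac_lim \<phi> x) \<le> 0" if "\<phi> \<in> test_functions common" for \<phi>
      unfolding mult_minus_left using diff_harm[OF that] by simp
  qed
  then show ?thesis by simp
qed

lemma u_scale_greater:
  assumes "p \<in> \<Omega>" shows "u p < u (s *\<^sub>R p)"
proof (cases "s *\<^sub>R p \<in> closure D1")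
  case True
  then show ?thesis using u_in u_less_1[OF assms] by simp
next
  case False
  then have p: "p \<in> common" using assms scale_D0[of p] by (simp add: common_def)
  \<comment> \<open>Without such a point \<open>D0\<close> would be invariant under expansion by 1 /
    s, and the expansions of \<open>p\<close> would make it unbounded.\<close>
  have "\<exists>q. q \<notin> D0 \<and> s *\<^sub>R q \<in> D0"
  proof (rule ccontr)
    assume "\<nexists>q. q \<notin> D0 \<and> s *\<^sub>R q \<in> D0"
    then have step: "q \<in> D0" if "s *\<^sub>R q \<in> D0" for q using that by blast
    have "inverse s ^ n *\<^sub>R p \<in> D0" for n
    proof (induction n)
      case (Suc n)
      have "s *\<^sub>R (inverse s ^ Suc n *\<^sub>R p) = inverse s ^ n *\<^sub>R p" using s by simp
      then show ?case using step Suc by metis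
    qed (use assms in simp)
    moreover obtain r where r: "\<And>x. x \<in> D0 \<Longrightarrow> norm x \<le> r" using bounded_D0 bounded_iff by blast
    ultimately have le: "inverse s ^ n * norm p \<le> r" for n using s by (metis norm_scaleR abs_of_nonneg
        inverse_nonnegative_iff_nonnegative less_imp_le zero_le_power)
    have "p \<noteq> 0" using assms zero_closure_D1 by auto
    moreover have "inverse s > 1" using s by (simp add: one_less_inverse)
    then obtain n where "r / norm p < inverse s ^ n" using real_arch_pow by blast
    ultimately show False using le[of n] by (simp add: pos_divide_less_eq)
  qed
  then obtain q where q: "q \<notin> D0" "s *\<^sub>R q \<in> D0" by blast
  have "0 < u (s *\<^sub>R p) - u p"
  proof (rule distr_strong_max_principle[OF diff_uniformly_continuous _ _ open_common p _ _ diff_harm, of 1 q])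
    show "\<bar>u (s *\<^sub>R x) - u x\<bar> \<le> 1" for x
      using u_nonneg[of x] u_le_1[of x] u_nonneg[of "s *\<^sub>R x"] u_le_1[of "s *\<^sub>R x"] by linarith
    show "0 \<le> u (s *\<^sub>R x) - u x" for x using u_scale_ge[of x] by simp
    show "q \<notin> common" using q by (simp add: common_def)
    show "0 < u (s *\<^sub>R q) - u q" using u_pos[OF q(2)] u_out[OF q(1)] by simp
  qed
  then show ?thesis by simp
qed

end

section \<open>Superlevel sets\<close>

lemma superlevel_starshaped:
  assumes "l < 1"
  shows "starshaped {x. u x \<ge> l}"
  unfolding starshaped_def
proof (intro ballI image_subsetI)
  fix s :: real and x assume s: "s \<in> {0..1}" and x: "x \<in> {x. u x \<ge> l}"
  consider "s = 0" | "s = 1" | "0 < s" "s < 1" using s by fastforce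
  then show "s *\<^sub>R x \<in> {x. u x \<ge> l}"
  proof cases
    \<comment> \<open>The origin belongs to the set because \<open>u\<close> is 1 there and l <
      1.\<close>
    case 1
    then show ?thesis using u_in[OF zero_closure_D1] assms by simp
  next
    case 3
    then show ?thesis using u_scale_ge[OF 3, of x] x by simp
  qed (use x in simp)
qed

lemma frontier_superlevel: "x \<in> frontier {x. u x \<ge> l} \<Longrightarrow> u x = l"
proof -
  assume x: "x \<in> frontier {x. u x \<ge> l}"
  have "closed {x. u x \<ge> l}" using u_cont by (intro closed_Collect_le) auto
  then have "l \<le> u x" using x frontier_subset_closed by blast
  moreover have "\<not> l < u x"
  proof
    assume "l < u x"
    moreover have "open {x. l < u x}" using u_cont by (intro open_Collect_less) auto
    ultimately have "x \<in> interior {x. u x \<ge> l}"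
      by (intro interiorI[of "{x. l < u x}"]) auto
    then show False using x by (simp add: frontier_def)
  qed
  ultimately show ?thesis by simp
qed

lemma superlevel_strictly_starshaped:
  assumes l: "0 < l" "l < 1"
  shows "strictly_starshaped {x. u x \<ge> l}"
  unfolding strictly_starshaped_def
proof (intro conjI allI impI)
  let ?U = "{x. u x \<ge> l}"
  have "D1 \<subseteq> ?U" using u_in closure_subset l by fastforce
  then show "0 \<in> interior ?U" using open_D1 zero_D1 by (intro interiorI) auto
  fix v :: 'a assume v: "v \<noteq> 0"
  have U: "?U \<subseteq> D0" using u_out l by fastforce
  have "\<exists>p. p \<in> ray v \<inter> frontier ?U"
  proof -
    obtain r where r: "r > 0" "\<And>x. x \<in> D0 \<Longrightarrow> norm x \<le> r" using bounded_D0 bounded_pos by metis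
    \<comment> \<open>A point of the ray beyond \<open>D0\<close>: the segment to it starts in the
      superlevel set and ends outside, so it meets the frontier.\<close>
    define w where "w = ((r + 1) / norm v) *\<^sub>R v"
    have "norm w = r + 1" using v r by (simp add: w_def)
    then have "w \<notin> ?U" using U r by fastforce
    moreover have "0 \<in> ?U" using u_in[OF zero_closure_D1] l by simp
    moreover have "0 \<in> closed_segment 0 w" "w \<in> closed_segment 0 w" by auto
    ultimately have "closed_segment 0 w \<inter> frontier ?U \<noteq> {}"
      by (intro connected_Int_frontier) blast+
    moreover have "closed_segment 0 w \<subseteq> ray v"
    proof
      fix x assume "x \<in> closed_segment 0 w"
      then obtain t where t: "0 \<le> t" "x = t *\<^sub>R w" by (auto simp: in_segment)
      have "x = (t * ((r + 1) / norm v)) *\<^sub>R v" using t by (simp add: w_def)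
      moreover have "t * ((r + 1) / norm v) \<ge> 0" using t r by simp
      ultimately show "x \<in> ray v" unfolding ray_def by blast
    qed
    ultimately show ?thesis by blast
  qed
  moreover have "p = q" if p: "p \<in> ray v \<inter> frontier ?U" and q: "q \<in> ray v \<inter> frontier ?U" for p q
  proof -
    have mem: "x \<in> \<Omega>" if "u x = l" for x using that l u_out[of x] u_in[of x] by force
    obtain a b where a: "a \<ge> 0" "p = a *\<^sub>R v" and b: "b \<ge> 0" "q = b *\<^sub>R v"
      using p q unfolding ray_def by blast
    have up: "u p = l" "u q = l" using p q frontier_superlevel by auto
    \<comment> \<open>The nearer of two frontier points is the contraction of the farther one by a /
      b < 1, under which \<open>u\<close> strictly increases, although both values equal
      \<open>l\<close>.\<close>
    have no: "\<not> a < b" if "0 \<le> a" "u (a *\<^sub>R v) = l" "u (b *\<^sub>R v) = l" for a b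
    proof
      assume "a < b"
      have "a \<noteq> 0" using that u_in[OF zero_closure_D1] l by auto
      then have s: "0 < a / b" "a / b < 1" using that \<open>a < b\<close> by auto
      have "u (b *\<^sub>R v) < u ((a / b) *\<^sub>R (b *\<^sub>R v))" by (rule u_scale_greater[OF s mem[OF that(3)]])
      also have "(a / b) *\<^sub>R (b *\<^sub>R v) = a *\<^sub>R v" using that \<open>a < b\<close> by simp
      finally show False using that by simp
    qed
    have "a = b" using no[of a b] no[of b a] a b up by auto
    then show ?thesis using a b by simp
  qed
  ultimately show "\<exists>!p. p \<in> ray v \<inter> frontier ?U" by blast
qed

end

text \<open>The difference vanishes off the annulus and is harmonic in it, so the maximum principle
  applies; exchanging the solutions then gives uniqueness.\<close>

lemma solution_le:
  assumes u: "solves_P \<alpha> D0 D1 u" and v: "solves_P \<alpha> D0 D1 v"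
  shows "u x \<le> v x"
proof -
  have "u x - v x \<le> 0"
  proof (rule distr_max_principle[OF _ _ bounded_annulus])
    show "uniformly_continuous_on UNIV (\<lambda>x. u x - v x)"
      by (intro uniformly_continuous_on_diff u_uniformly_continuous u v)
    show "\<bar>u x - v x\<bar> \<le> 1" for x
      using u_nonneg[OF u, of x] u_le_1[OF u, of x] u_nonneg[OF v, of x] u_le_1[OF v, of x] by linarith
    show "u x - v x \<le> 0" if "x \<notin> \<Omega>" for x
      using that u_in[OF u, of x] u_in[OF v, of x] u_out[OF u, of x] u_out[OF v, of x] by (cases "x \<in> D0") auto
    show "(LINT x|lborel. (u x - v x) * frac_lim \<phi> x) \<le> 0" if t: "\<phi> \<in> test_functions \<Omega>" for \<phi>
    proof -
      have "(LINT x|lborel. (u x - v x) * frac_lim \<phi> x)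
          = (LINT x|lborel. u x * frac_lim \<phi> x) - (LINT x|lborel. v x * frac_lim \<phi> x)"
        unfolding left_diff_distrib
        by (intro Bochner_Integration.integral_diff frac_lim_integrable test_function_compact_C2[OF t]
            u_bdd_borel u v)
      then show ?thesis using u_harm[OF u t] u_harm[OF v t] by simp
    qed
  qed
  then show ?thesis by simp
qed

end

theorem corollary1p4:
  fixes \<alpha> :: real and D0 D1 :: "(real ^ 'n) set"
  assumes "0 < \<alpha>" and "\<alpha> < 2"
    and "bounded D0" and "open D0" and "starshaped D0"
    and "bounded D1" and "open D1" and "starshaped D1"
    and "0 \<in> D1" and "closure D1 \<subseteq> D0"
    and "uniform_exterior_cone (D0 - closure D1)"
  shows "(\<exists>!u. solves_P \<alpha> D0 D1 u) \<and>
    (\<forall>u. solves_P \<alpha> D0 D1 u \<longrightarrow>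
      (\<forall>x\<in>D0 - closure D1. 0 < u x \<and> u x < 1) \<and>
      (\<forall>l\<in>{0<..<1}. starshaped {x. u x \<ge> l}) \<and>
      (strictly_starshaped D0 \<and> strictly_starshaped D1 \<longrightarrow>
        (\<forall>l\<in>{0<..<1}. strictly_starshaped {x. u x \<ge> l})))"
proof -
  interpret problem_P \<alpha> D0 D1 by unfold_locales (use assms in auto)
  have "u = v" if "solves_P \<alpha> D0 D1 u" "solves_P \<alpha> D0 D1 v" for u v
    using solution_le[OF that] solution_le[OF that(2,1)] by (intro ext antisym)
  then have "\<exists>!u. solves_P \<alpha> D0 D1 u" using solution_exists by blast
  then show ?thesis
    using u_pos u_less_1 superlevel_starshaped superlevel_strictly_starshaped by auto
qed

end
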